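(* Let $\alpha>0$ and $1<\tau<2$ be such that $\gamma:=\alpha(\tau-1)$ satisfies $1<\gamma<2$, and for each $N$ let $G_N$ be the scale-free percolation random graph on the torus $\mathbb{T}_N$ with parameters $\alpha,\tau$. There exist a constant $c>0$ and a slowly varying function $\ell:\mathbb{N}\to(0,\infty)$ such that $$\mathbb{P}\big(N^{\gamma-1}(\log N)^{-c}\le t_{\rm mix}(G_N)\le N^{\gamma-1}\ell(N)\big)\xrightarrow{N\to\infty}1 .$$
   Context: Scale-free percolation (SFP) on the torus. Fix $\tau>1$ and $\alpha>0$ and write $\gamma:=\alpha(\tau-1)$. The vertex set of $G_N$ is $\mathbb{T}_N=\{1,\dots,N\}\cong\mathbb{Z}/N\mathbb{Z}$, with torus distance $\|x-y\|:=|x-y|\wedge(N-|x-y|)$. To the vertices one associates i.i.d. random weights $(W_x)_{x\in\mathbb{T}_N}$ with Pareto law $\mathbb{P}(W_1\ge t)=t^{-(\tau-1)}$ for $t\ge1$ and $\mathbb{P}(W_1\ge t)=1$ for $t<1$. Given the weights, pairs of distinct vertices $x,y$ are joined by an (undirected) edge independently with probability $1-\exp(-W_xW_y/\|x-y\|^{\alpha})$, except that $x$ and $x+1$ are always joined by an edge, for all $x\in\mathbb{T}_N$ (with $N+1$ identified with $1$). Mixing time. For a finite connected graph $G=(V,E)$ with degrees $D_x$, the lazy simple random walk on $G$ has transition matrix $P(x,x)=1/2$ and $P(x,y)=\frac{1}{2D_x}$ if $x,y$ are joined by an edge ($P(x,y)=0$ for other $y\ne x$); its reversible measure is $\pi(x)=D_x/\sum_{z\in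 V}D_z$. With $\|\mu-\nu\|_{\rm TV}=\frac12\sum_{x\in V}|\mu(x)-\nu(x)|$ and $d(n)=\sup_{x\in V}\|P^n(x,\cdot)-\pi\|_{\rm TV}$, set $t_{\rm mix}(G):=\inf\{n\in\mathbb{N}: d(n)<1/4\}$. A function $\ell:\mathbb{N}\to(0,\infty)$ is slowly varying if $\lim_{n\to\infty}\ell(\lfloor sn\rfloor)/\ell(n)=1$ for every $s\in(0,\infty)$. *)

theory Defs
  imports "HOL-Probability.Probability"
begin

section \<open>Lazy random walk and mixing time\<close>

text \<open>
  A finite simple graph is given by its vertex set \<open>V\<close> and its set \<open>E\<close> of edges,
  an edge being an unordered pair \<open>{x, y}\<close> of distinct vertices.
\<close>

definition degree :: "'a set \<Rightarrow> 'a set set \<Rightarrow> 'a \<Rightarrow> nat" where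
  "degree V E x = card {y \<in> V. y \<noteq> x \<and> {x, y} \<in> E}"

definition lazy_walk :: "'a set \<Rightarrow> 'a set set \<Rightarrow> 'a \<Rightarrow> 'a \<Rightarrow> real" where
  "lazy_walk V E x y =
     (if y = x then 1 / 2
      else if {x, y} \<in> E then 1 / (2 * real (degree V E x)) else 0)"

fun matrix_power :: "'a set \<Rightarrow> ('a \<Rightarrow> 'a \<Rightarrow> real) \<Rightarrow> nat \<Rightarrow> 'a \<Rightarrow> 'a \<Rightarrow> real" where
  "matrix_power V P 0 x y = (if x = y then 1 else 0)"
| "matrix_power V P (Suc n) x y = (\<Sum>z\<in>V. P x z * matrix_power V P n z y)"

definition reversible_measure :: "'a set \<Rightarrow> 'a set set \<Rightarrow> 'a \<Rightarrow> real" where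
  "reversible_measure V E x = real (degree V E x) / (\<Sum>z\<in>V. real (degree V E z))"

definition tv_dist :: "'a set \<Rightarrow> ('a \<Rightarrow> real) \<Rightarrow> ('a \<Rightarrow> real) \<Rightarrow> real" where
  "tv_dist V \<mu> \<nu> = (1 / 2) * (\<Sum>x\<in>V. \<bar>\<mu> x - \<nu> x\<bar>)"

definition walk_dist :: "'a set \<Rightarrow> 'a set set \<Rightarrow> nat \<Rightarrow> real" where
  "walk_dist V E n =
     (SUP x\<in>V. tv_dist V (matrix_power V (lazy_walk V E) n x) (reversible_measure V E))"

text \<open>
  On a finite connected graph with at least two vertices the set below is nonempty,
  so the value of \<open>Inf {}\<close> on the natural numbers plays no role.
\<close>

definition mixing_time :: "'a set \<Rightarrow> 'a set set \<Rightarrow> nat" where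
  "mixing_time V E = Inf {n. walk_dist V E n < 1 / 4}"


section \<open>Scale-free percolation on the torus\<close>

definition torus :: "nat \<Rightarrow> nat set" where
  "torus N = {1..N}"

definition torus_dist :: "nat \<Rightarrow> nat \<Rightarrow> nat \<Rightarrow> real" where
  "torus_dist N x y = min \<bar>real x - real y\<bar> (real N - \<bar>real x - real y\<bar>)"

definition torus_succ :: "nat \<Rightarrow> nat \<Rightarrow> nat" where
  "torus_succ N x = (if x = N then 1 else x + 1)"

text \<open>The law on the real line with distribution function \<open>t \<mapsto> 1 - t\<^sup>-\<^sup>(\<^sup>\<tau>\<^sup>-\<^sup>1\<^sup>)\<close> on \<open>[1, \<infinity>)\<close>.\<close>

definition pareto :: "real \<Rightarrow> real measure" where
  "pareto \<tau> = interval_measure (\<lambda>t. if t < 1 then 0 else 1 - t powr (- (\<tau> - 1)))"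

definition edge_prob :: "nat \<Rightarrow> real \<Rightarrow> (nat \<Rightarrow> real) \<Rightarrow> nat \<Rightarrow> nat \<Rightarrow> real" where
  "edge_prob N \<alpha> w x y =
     (if y = torus_succ N x \<or> x = torus_succ N y then 1
      else 1 - exp (- (w x * w y / torus_dist N x y powr \<alpha>)))"

text \<open>Each unordered pair of distinct vertices is listed once, with its smaller element first.\<close>

definition vertex_pairs :: "nat \<Rightarrow> (nat \<times> nat) set" where
  "vertex_pairs N = {(x, y). x \<in> torus N \<and> y \<in> torus N \<and> x < y}"

text \<open>
  The law of the edge set given the weights \<open>w\<close>: the pairs are open independently of each
  other. (Almost all weight vectors have all entries at least 1; only for those is
  \<open>edge_prob\<close> guaranteed to lie in the unit interval.)
\<close>

definition sfp_given_weights :: "nat \<Rightarrow> real \<Rightarrow> (nat \<Rightarrow> real) \<Rightarrow> nat set set pmf" where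
  "sfp_given_weights N \<alpha> w =
     map_pmf (\<lambda>g. {{x, y} | x y. (x, y) \<in> vertex_pairs N \<and> g (x, y)})
       (Pi_pmf (vertex_pairs N) False (\<lambda>(x, y). bernoulli_pmf (edge_prob N \<alpha> w x y)))"

text \<open>The law of the edge set, where the weights are i.i.d. with law \<open>pareto \<tau>\<close>.\<close>

definition sfp :: "nat \<Rightarrow> real \<Rightarrow> real \<Rightarrow> nat set set measure" where
  "sfp N \<alpha> \<tau> =
     (\<Pi>\<^sub>M x\<in>torus N. pareto \<tau>) \<bind> (\<lambda>w. measure_pmf (sfp_given_weights N \<alpha> w))"

definition slowly_varying :: "(nat \<Rightarrow> real) \<Rightarrow> bool" where
  "slowly_varying l \<longleftrightarrow>
     (\<forall>n. l n > 0) \<and>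
     (\<forall>s>0. (\<lambda>n. l (nat \<lfloor>s * real n\<rfloor>) / l n) \<longlonglongrightarrow> 1)"


subsection \<open>The laws are well defined\<close>

lemma pareto_cdf_props:
  fixes F :: "real \<Rightarrow> real"
  assumes "\<tau> > 1" and F: "F = (\<lambda>t. if t < 1 then 0 else 1 - t powr (- (\<tau> - 1)))"
  shows "\<And>x y. x \<le> y \<Longrightarrow> F x \<le> F y" "\<And>a. continuous (at_right a) F"
    "(F \<longlongrightarrow> 0) at_bot" "(F \<longlongrightarrow> 1) at_top" "isCont F a"
proof -
  show mono: "F x \<le> F y" if "x \<le> y" for x y
  proof (cases "x < 1")
    case True
    have "y powr (- (\<tau> - 1)) \<le> 1" if "y \<ge> 1"
      using powr_mono2'[of "-(\<tau> - 1)" 1 y] that assms by simp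
    then show ?thesis using True by (auto simp: F)
  next
    case False
    then have "y powr (- (\<tau> - 1)) \<le> x powr (- (\<tau> - 1))"
      using that assms by (intro powr_mono2') auto
    then show ?thesis using False that by (auto simp: F)
  qed
  have Fmax: "F = (\<lambda>t. 1 - (max 1 t) powr (- (\<tau> - 1)))"
    by (auto simp: F max_def fun_eq_iff)
  show cont: "isCont F a" for a
    unfolding Fmax by (intro continuous_intros) auto
  show "continuous (at_right a) F" for a
    using cont[of a] continuous_at_imp_continuous_at_within by blast
  show "(F \<longlongrightarrow> 0) at_bot"
    by (rule tendsto_eventually) (auto simp: F eventually_at_bot_linorder intro!: exI[of _ 0])
  have "((\<lambda>t. 1 - t powr (- (\<tau> - 1))) \<longlongrightarrow> 1 - 0) at_top"
    using assms by (intro tendsto_intros tendsto_neg_powr filterlim_ident) auto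
  moreover have "eventually (\<lambda>t. 1 - t powr (- (\<tau> - 1)) = F t) at_top"
    using eventually_ge_at_top[of 1] by eventually_elim (auto simp: F)
  ultimately show "(F \<longlongrightarrow> 1) at_top"
    by (simp add: tendsto_cong)
qed

lemma real_distribution_pareto: "\<tau> > 1 \<Longrightarrow> real_distribution (pareto \<tau>)"
  unfolding pareto_def
  using pareto_cdf_props[OF _ refl] by (intro real_distribution_interval_measure) auto

lemma prob_space_pareto: "\<tau> > 1 \<Longrightarrow> prob_space (pareto \<tau>)"
  using real_distribution_pareto real_distribution.axioms(1) by blast

lemma sets_pareto [simp, measurable_cong]: "sets (pareto \<tau>) = sets borel"
  by (simp add: pareto_def)

lemma measure_pareto_tail:
  assumes "\<tau> > 1"
  shows "measure (pareto \<tau>) {t..} = (if t \<ge> 1 then t powr (- (\<tau> - 1)) else 1)"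
proof -
  interpret real_distribution "pareto \<tau>" by (rule real_distribution_pareto[OF assms])
  define F where "F = (\<lambda>t::real. if t < 1 then 0 else 1 - t powr (- (\<tau> - 1)))"
  note P = pareto_cdf_props[OF assms F_def]
  have cdf: "cdf (pareto \<tau>) = F"
    unfolding pareto_def F_def[symmetric] using P by (intro cdf_interval_measure) auto
  have "isCont (cdf (pareto \<tau>)) t" unfolding cdf by (rule P)
  then have "measure (pareto \<tau>) {t} = 0" by (simp add: isCont_cdf)
  moreover have "{..t} = {..<t} \<union> {t}" by auto
  ultimately have "measure (pareto \<tau>) {..<t} = F t"
    using finite_measure_Union[of "{..<t}" "{t}"]
    by (simp add: cdf[symmetric] cdf_def)
  moreover have "measure (pareto \<tau>) {t..} = 1 - measure (pareto \<tau>) {..<t}"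
    using prob_compl[of "{..<t}"] by (simp add: Compl_eq_Diff_UNIV[symmetric])
  ultimately show ?thesis by (auto simp: F_def)
qed

lemma finite_vertex_pairs: "finite (vertex_pairs N)"
  by (rule finite_subset[of _ "torus N \<times> torus N"]) (auto simp: vertex_pairs_def torus_def)

lemma pmf_bernoulli_clamp:
  "pmf (bernoulli_pmf p) b = (if b then min 1 (max 0 p) else 1 - min 1 (max 0 p))"
proof -
  interpret pmf_as_function .
  show ?thesis by transfer simp
qed

lemma measurable_sfp_given_weights:
  "(\<lambda>w. measure_pmf (sfp_given_weights N \<alpha> w))
     \<in> measurable (\<Pi>\<^sub>M x\<in>torus N. pareto \<tau>) (subprob_algebra (count_space UNIV))"
proof (rule measurable_subprob_algebra)
  fix w
  show "subprob_space (measure_pmf (sfp_given_weights N \<alpha> w))"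
    by (rule subprob_space_measure_pmf)
  show "sets (measure_pmf (sfp_given_weights N \<alpha> w)) = sets (count_space UNIV)" by simp
next
  fix A :: "nat set set set"
  define h :: "(nat \<times> nat \<Rightarrow> bool) \<Rightarrow> nat set set"
    where "h = (\<lambda>g. {{x, y} | x y. (x, y) \<in> vertex_pairs N \<and> g (x, y)})"
  define S where "S = PiE_dflt (vertex_pairs N) False (\<lambda>_. UNIV :: bool set)"
  define q where "q = (\<lambda>w (x, y). bernoulli_pmf (edge_prob N \<alpha> w x y))"
  have finS: "finite S" unfolding S_def by (intro finite_PiE_dflt finite_vertex_pairs) auto
  have eq: "emeasure (measure_pmf (sfp_given_weights N \<alpha> w)) A
      = ennreal (\<Sum>g\<in>S \<inter> h -` A. \<Prod>e\<in>vertex_pairs N. pmf (q w e) (g e))" for w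
  proof -
    let ?M = "Pi_pmf (vertex_pairs N) False (q w)"
    have sub: "set_pmf ?M \<subseteq> S"
      using set_Pi_pmf_subset[OF finite_vertex_pairs, of N False "q w"]
      by (auto simp: S_def PiE_dflt_def)
    have "measure (measure_pmf (sfp_given_weights N \<alpha> w)) A = measure ?M (h -` A)"
      by (simp add: sfp_given_weights_def h_def q_def)
    also have "\<dots> = measure ?M (S \<inter> h -` A)"
      using sub by (intro measure_pmf.finite_measure_eq_AE) (auto simp: AE_measure_pmf_iff)
    also have "\<dots> = (\<Sum>g\<in>S \<inter> h -` A. pmf ?M g)"
      using finS by (intro measure_measure_pmf_finite) auto
    also have "\<dots> = (\<Sum>g\<in>S \<inter> h -` A. \<Prod>e\<in>vertex_pairs N. pmf (q w e) (g e))"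
      by (intro sum.cong refl pmf_Pi' finite_vertex_pairs) (auto simp: S_def PiE_dflt_def)
    finally show ?thesis by (simp add: measure_pmf.emeasure_eq_measure)
  qed
  have [measurable]: "(\<lambda>w. edge_prob N \<alpha> w x y) \<in> borel_measurable (\<Pi>\<^sub>M x\<in>torus N. pareto \<tau>)"
    if "(x, y) \<in> vertex_pairs N" for x y
  proof -
    have [measurable]: "(\<lambda>w. w x) \<in> borel_measurable (\<Pi>\<^sub>M x\<in>torus N. pareto \<tau>)"
      "(\<lambda>w. w y) \<in> borel_measurable (\<Pi>\<^sub>M x\<in>torus N. pareto \<tau>)"
      using that measurable_component_singleton[of _ "torus N" "\<lambda>_. pareto \<tau>"]
      by (auto simp: vertex_pairs_def cong: measurable_cong_sets)
    show ?thesis unfolding edge_prob_def by measurable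
  qed
  have "(\<lambda>w. pmf (q w e) b) \<in> borel_measurable (\<Pi>\<^sub>M x\<in>torus N. pareto \<tau>)"
    if "e \<in> vertex_pairs N" for e b
    using that by (cases e) (auto simp: q_def pmf_bernoulli_clamp)
  then show "(\<lambda>w. emeasure (measure_pmf (sfp_given_weights N \<alpha> w)) A)
      \<in> borel_measurable (\<Pi>\<^sub>M x\<in>torus N. pareto \<tau>)"
    unfolding eq by (intro measurable_compose[OF _ measurable_ennreal] borel_measurable_sum borel_measurable_prod) auto
qed

lemma prob_space_sfp:
  assumes "\<tau> > 1"
  shows "prob_space (sfp N \<alpha> \<tau>)"
  unfolding sfp_def
proof (rule prob_space.prob_space_bind)
  show "prob_space (\<Pi>\<^sub>M x\<in>torus N. pareto \<tau>)"
    using assms by (intro prob_space_PiM prob_space_pareto)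
qed (auto intro: measurable_sfp_given_weights measure_pmf.prob_space_axioms)

lemma sets_sfp:
  assumes "\<tau> > 1"
  shows "sets (sfp N \<alpha> \<tau>) = UNIV"
proof -
  interpret prob_space "\<Pi>\<^sub>M x\<in>torus N. pareto \<tau>"
    using assms by (intro prob_space_PiM prob_space_pareto)
  show ?thesis
    unfolding sfp_def using not_empty by (subst sets_bind[where N = "count_space UNIV"]) auto
qed

end

theory Submission
  imports Defs "HOL-Real_Asymp.Real_Asymp"
begin

text \<open>
  Put \<open>X\<^sub>x = W\<^sub>x^(1/\<alpha>)\<close>. These variables are Pareto with exponent \<open>\<gamma>\<close>, and \<open>x\<close>, \<open>y\<close> are
  joined with probability \<open>1 - exp (-(X\<^sub>x X\<^sub>y / |x - y|)^\<alpha>)\<close>. So, up to logarithmic factors, an edge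
  is present when \<open>X\<^sub>x X\<^sub>y\<close> exceeds the distance, and rarely otherwise. Three consequences govern
  everything: an interval of length \<open>s\<close> contains a hub with \<open>X \<approx> s^(1/\<gamma>)\<close>; the degree of \<open>x\<close> is about
  \<open>X\<^sub>x\<close>, hence has finite mean because \<open>\<gamma> > 1\<close>; and \<open>P(x ~ y)\<close> is about \<open>|x - y|^(-\<gamma>)\<close>.

  \<^bold>\<open>Lower bound.\<close> Only about \<open>N^(2-\<gamma>)\<close> edges leave one half of the torus, while both halves have volume at
  least of order \<open>N\<close>. A walk started in equilibrium on the lighter half therefore needs about
  \<open>N / N^(2-\<gamma>) = N^(\<gamma>-1)\<close> steps to leave it with noticeable probability (\<open>walk_dist_cut\<close>).

  \<^bold>\<open>Upper bound.\<close> A Poincare inequality with constant \<open>K\<close> makes the lazy walk contract the variance by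
  the factor \<open>1 - 1/(4K)\<close> in each step, so it mixes in \<open>O(K log N)\<close> steps (\<open>mixing_time_le_Poincare\<close>). A
  Cheeger-type argument would lose a square here, so the Poincare inequality is proved directly, by
  routing every vertex to a single hub through hubs of intervals of doubling length. The decisive
  point is that two vertices of an interval of length \<open>s\<close> whose \<open>X\<close> is at least that of a typical hub,
  \<open>s^(1/\<gamma>)\<close>, are both joined to every \<open>y\<close> in the interval with \<open>X\<^sub>y \<ge> s^(1-1/\<gamma>)\<close>. There are about
  \<open>s \<cdot> s^(-(\<gamma>-1)) = s^(2-\<gamma>)\<close> such \<open>y\<close>, so that many paths of length two connect the two vertices and
  the effective resistance between them is about \<open>s^(-(2-\<gamma>))\<close> (\<open>strong_pair_bound\<close>). A vertex with
  \<open>X\<^sub>x > s\<close> is itself as good as a hub at scale \<open>s\<close>; the remaining vertices of the interval have total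
  degree about \<open>s\<close>. The scale \<open>s\<close> thus costs \<open>s \<cdot> s^(-(2-\<gamma>)) = s^(\<gamma>-1)\<close>, which is largest for \<open>s = N\<close>
  (\<open>interval_Poincare\<close>, \<open>hub_Poincare\<close>). All errors are powers of \<open>log N\<close>, so a power of
  the logarithm serves as slowly varying function.

  \<^bold>\<open>Probability.\<close> Most of the exceptional events are of three kinds: a sum of independent variables with values in
  \<open>[0,1]\<close> is much larger than its mean, an interval contains no large weight, or an edge that is very likely
  given the weights is absent. With the slack \<open>T = (log N)^3\<close> in all thresholds each of them has
  probability at most \<open>exp (-T/2)\<close>, which survives a union bound over polynomially many choices
  (\<open>good_weights_likely\<close>, \<open>good_graph_likely\<close>). The weights are exposed first, the edges second. The truncation of
  the weights at \<open>N^\<alpha>\<close> fails with probability at most \<open>N^(1-\<gamma>)\<close>, and the size of the cut is controlled by its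
  expectation.
\<close>

section \<open>Poincare inequalities, cuts and the lazy walk\<close>

definition neighbours :: "'a set \<Rightarrow> 'a set set \<Rightarrow> 'a \<Rightarrow> 'a set" where
  "neighbours V E x = {y \<in> V. y \<noteq> x \<and> {x, y} \<in> E}"

text \<open>
  The sum runs over ordered pairs, so this is twice the usual sum over edges. Energies of disjoint
  vertex sets count only the edges inside each set, which makes them superadditive.
\<close>

definition energy :: "'a set \<Rightarrow> 'a set set \<Rightarrow> ('a \<Rightarrow> real) \<Rightarrow> real" where
  "energy V E f = (\<Sum>x\<in>V. \<Sum>y\<in>neighbours V E x. (f x - f y)\<^sup>2)"

definition cut_size :: "'a set \<Rightarrow> 'a set set \<Rightarrow> 'a set \<Rightarrow> real" where
  "cut_size V E A = (\<Sum>x\<in>A. \<Sum>y\<in>V - A. of_bool ({x, y} \<in> E))"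

lemma finite_neighbours: "finite V \<Longrightarrow> finite (neighbours V E x)"
  by (simp add: neighbours_def)

lemma degree_eq_card_neighbours: "degree V E x = card (neighbours V E x)"
  by (simp add: degree_def neighbours_def)

lemma energy_nonneg: "energy V E f \<ge> 0"
  unfolding energy_def by (intro sum_nonneg) auto

lemma divide_le_self: "a / b \<le> a" if "a \<ge> 0" "b \<ge> 1" for a b :: real
  using that by (simp add: divide_le_eq mult_le_cancel_left1)

locale finite_graph =
  fixes V :: "'a set" and E :: "'a set set"
  assumes finite_V: "finite V" and V_nonempty: "V \<noteq> {}"
    and degree_pos: "x \<in> V \<Longrightarrow> degree V E x > 0"
begin

abbreviation "deg x \<equiv> real (degree V E x)"
abbreviation "P \<equiv> lazy_walk V E"
abbreviation "nbr \<equiv> neighbours V E"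
abbreviation "vol \<equiv> (\<Sum>z\<in>V. deg z)"

definition walk_op :: "('a \<Rightarrow> real) \<Rightarrow> 'a \<Rightarrow> real" where
  "walk_op f x = (\<Sum>y\<in>V. P x y * f y)"

lemma sum_neighbours_swap:
  "(\<Sum>x\<in>V. \<Sum>y\<in>nbr x. F x y) = (\<Sum>x\<in>V. \<Sum>y\<in>nbr x. F y x)"
proof -
  have "(\<Sum>x\<in>V. \<Sum>y\<in>nbr x. F x y) = (\<Sum>x\<in>V. \<Sum>y\<in>{y \<in> V. y \<noteq> x \<and> {x, y} \<in> E}. F x y)"
    by (simp add: neighbours_def)
  also have "\<dots> = (\<Sum>y\<in>V. \<Sum>x\<in>{x \<in> V. y \<noteq> x \<and> {x, y} \<in> E}. F x y)"
    by (intro sum.swap_restrict finite_V)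
  also have "\<dots> = (\<Sum>x\<in>V. \<Sum>y\<in>nbr x. F y x)"
    by (intro sum.cong refl) (auto simp: neighbours_def insert_commute)
  finally show ?thesis .
qed

lemma degree_le_card: "x \<in> V \<Longrightarrow> deg x \<le> real (card V)"
  unfolding degree_def using finite_V by (auto intro!: card_mono)

lemma degree_ge_1: "x \<in> V \<Longrightarrow> deg x \<ge> 1"
  using degree_pos[of x] by linarith

lemma vol_pos: "vol > 0"
  using V_nonempty finite_V degree_pos by (intro sum_pos) auto

lemma walk_op_eq:
  assumes x: "x \<in> V"
  shows "walk_op f x = f x / 2 + (\<Sum>y\<in>nbr x. f y) / (2 * deg x)"
proof -
  have "walk_op f x = P x x * f x + (\<Sum>y\<in>V - {x}. P x y * f y)"
    unfolding walk_op_def using x finite_V by (simp add: sum.remove)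
  also have "(\<Sum>y\<in>V - {x}. P x y * f y) = (\<Sum>y\<in>nbr x. f y / (2 * deg x))"
    using finite_V by (intro sum.mono_neutral_cong_right) (auto simp: lazy_walk_def neighbours_def)
  finally show ?thesis by (simp add: lazy_walk_def sum_divide_distrib)
qed

lemma walk_op_const: "x \<in> V \<Longrightarrow> walk_op (\<lambda>_. c) x = c"
  using degree_pos[of x] by (simp add: walk_op_eq degree_eq_card_neighbours)

lemma walk_op_diff: "walk_op (\<lambda>y. f y - g y) x = walk_op f x - walk_op g x"
  unfolding walk_op_def by (simp add: right_diff_distrib sum_subtractf)

lemma lazy_walk_nonneg: "P x y \<ge> 0"
  by (simp add: lazy_walk_def)

lemma lazy_walk_reversible:
  assumes "x \<in> V" "y \<in> V"
  shows "deg x * P x y = deg y * P y x"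
  using degree_pos[OF assms(1)] degree_pos[OF assms(2)]
  by (auto simp: lazy_walk_def insert_commute)

lemma energy_expand:
  "energy V E f = 2 * (\<Sum>x\<in>V. deg x * (f x)\<^sup>2) - 2 * (\<Sum>x\<in>V. f x * (\<Sum>y\<in>nbr x. f y))"
proof -
  have "energy V E f = (\<Sum>x\<in>V. \<Sum>y\<in>nbr x. (f x)\<^sup>2) + (\<Sum>x\<in>V. \<Sum>y\<in>nbr x. (f y)\<^sup>2)
      - 2 * (\<Sum>x\<in>V. \<Sum>y\<in>nbr x. f x * f y)"
    unfolding energy_def by (simp add: power2_diff sum.distrib sum_subtractf sum_distrib_left mult.assoc)
  also have "(\<Sum>x\<in>V. \<Sum>y\<in>nbr x. (f y)\<^sup>2) = (\<Sum>x\<in>V. \<Sum>y\<in>nbr x. (f x)\<^sup>2)"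
    by (rule sum_neighbours_swap)
  also have "(\<Sum>x\<in>V. \<Sum>y\<in>nbr x. (f x)\<^sup>2) = (\<Sum>x\<in>V. deg x * (f x)\<^sup>2)"
    by (simp add: degree_eq_card_neighbours)
  finally show ?thesis by (simp add: sum_distrib_left)
qed

text \<open>
  Writing the lazy kernel as \<open>(1 + Q)/2\<close>, where \<open>Q\<close> is the kernel of the simple walk,
  \<open>\<parallel>P f\<parallel>\<^sup>2 = (\<parallel>f\<parallel>\<^sup>2 + 2\<langle>f, Q f\<rangle> + \<parallel>Q f\<parallel>\<^sup>2) / 4 \<le> (\<parallel>f\<parallel>\<^sup>2 + \<langle>f, Q f\<rangle>) / 2\<close>, because \<open>Q\<close> is a
  contraction. Laziness is what allows the bound to avoid negative eigenvalues of \<open>Q\<close>.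
\<close>

lemma walk_op_contraction:
  "(\<Sum>x\<in>V. deg x * (walk_op f x)\<^sup>2) \<le> (\<Sum>x\<in>V. deg x * (f x)\<^sup>2) - energy V E f / 4"
proof -
  have pt: "deg x * (walk_op f x)\<^sup>2 \<le> deg x * (f x)\<^sup>2 / 4 + f x * (\<Sum>y\<in>nbr x. f y) / 2
      + (\<Sum>y\<in>nbr x. (f y)\<^sup>2) / 4" if x: "x \<in> V" for x
  proof -
    define s where "s = (\<Sum>y\<in>nbr x. f y)"
    have d: "deg x > 0" using degree_pos[OF x] by simp
    have "s\<^sup>2 \<le> deg x * (\<Sum>y\<in>nbr x. (f y)\<^sup>2)"
      unfolding s_def degree_eq_card_neighbours using sum_squared_le_sum_of_squares[of "f" "nbr x"]
      by (simp add: finite_neighbours finite_V mult.commute)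
    then have "s\<^sup>2 / deg x \<le> (\<Sum>y\<in>nbr x. (f y)\<^sup>2)"
      using d by (simp add: field_simps)
    moreover have "deg x * (walk_op f x)\<^sup>2 = deg x * (f x)\<^sup>2 / 4 + f x * s / 2 + s\<^sup>2 / deg x / 4"
      unfolding walk_op_eq[OF x] s_def[symmetric] using d by (simp add: power2_eq_square field_simps)
    ultimately have "deg x * (walk_op f x)\<^sup>2 \<le> deg x * (f x)\<^sup>2 / 4 + f x * s / 2
        + (\<Sum>y\<in>nbr x. (f y)\<^sup>2) / 4" by simp
    then show ?thesis unfolding s_def .
  qed
  have "(\<Sum>x\<in>V. deg x * (walk_op f x)\<^sup>2) \<le> (\<Sum>x\<in>V. deg x * (f x)\<^sup>2 / 4 + f x * (\<Sum>y\<in>nbr x. f y) / 2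
      + (\<Sum>y\<in>nbr x. (f y)\<^sup>2) / 4)"
    by (intro sum_mono pt)
  also have "\<dots> = (\<Sum>x\<in>V. deg x * (f x)\<^sup>2) / 4 + (\<Sum>x\<in>V. f x * (\<Sum>y\<in>nbr x. f y)) / 2
      + (\<Sum>x\<in>V. \<Sum>y\<in>nbr x. (f y)\<^sup>2) / 4"
    by (simp add: sum.distrib sum_divide_distrib)
  also have "(\<Sum>x\<in>V. \<Sum>y\<in>nbr x. (f y)\<^sup>2) = (\<Sum>x\<in>V. \<Sum>y\<in>nbr x. (f x)\<^sup>2)"
    by (rule sum_neighbours_swap)
  also have "(\<Sum>x\<in>V. \<Sum>y\<in>nbr x. (f x)\<^sup>2) = (\<Sum>x\<in>V. deg x * (f x)\<^sup>2)"
    by (simp add: degree_eq_card_neighbours)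
  finally show ?thesis unfolding energy_expand by (simp add: diff_divide_distrib)
qed

lemma matrix_power_walk_op: "matrix_power V P (Suc n) x y = walk_op (\<lambda>z. matrix_power V P n z y) x"
  by (simp add: walk_op_def)

lemma matrix_power_Suc_right:
  "x \<in> V \<Longrightarrow> y \<in> V \<Longrightarrow> matrix_power V P (Suc n) x y = (\<Sum>z\<in>V. matrix_power V P n x z * P z y)"
proof (induction n arbitrary: x)
  case 0
  have "matrix_power V P (Suc 0) x y = P x y"
    using 0 finite_V by (simp add: if_distrib[of "\<lambda>t. P _ _ * t"] cong: if_cong)
  then show ?case using 0 finite_V by (simp add: if_distrib[of "\<lambda>t. t * P _ _"] cong: if_cong)
next
  case (Suc n)
  have "matrix_power V P (Suc (Suc n)) x y = (\<Sum>z\<in>V. P x z * (\<Sum>u\<in>V. matrix_power V P n z u * P u y))"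
    using Suc by (subst matrix_power.simps(2)) (auto intro!: sum.cong simp del: matrix_power.simps)
  also have "\<dots> = (\<Sum>u\<in>V. \<Sum>z\<in>V. P x z * matrix_power V P n z u * P u y)"
    by (subst sum.swap) (simp add: sum_distrib_left mult.assoc)
  finally show ?case by (simp add: sum_distrib_right)
qed

lemma matrix_power_reversible:
  "x \<in> V \<Longrightarrow> y \<in> V \<Longrightarrow> deg x * matrix_power V P n x y = deg y * matrix_power V P n y x"
proof (induction n arbitrary: x y)
  case (Suc n)
  have "deg x * matrix_power V P (Suc n) x y = (\<Sum>z\<in>V. (deg x * P x z) * matrix_power V P n z y)"
    by (simp add: sum_distrib_left mult.assoc)
  also have "\<dots> = (\<Sum>z\<in>V. (deg z * matrix_power V P n z y) * P z x)"
    using Suc.prems lazy_walk_reversible by (intro sum.cong) (auto simp: mult_ac)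
  also have "\<dots> = (\<Sum>z\<in>V. deg y * matrix_power V P n y z * P z x)"
    using Suc by (intro sum.cong) auto
  also have "\<dots> = deg y * matrix_power V P (Suc n) y x"
    using Suc.prems by (subst matrix_power_Suc_right) (auto simp: sum_distrib_left mult.assoc)
  finally show ?case .
qed auto

lemma matrix_power_nonneg: "matrix_power V P n x y \<ge> 0"
  by (induction n arbitrary: x) (auto intro!: sum_nonneg simp: lazy_walk_nonneg)

lemma matrix_power_sum: "x \<in> V \<Longrightarrow> (\<Sum>y\<in>V. matrix_power V P n x y) = 1"
proof (induction n arbitrary: x)
  case 0 then show ?case using finite_V by simp
next
  case (Suc n)
  have "(\<Sum>y\<in>V. matrix_power V P (Suc n) x y) = (\<Sum>z\<in>V. P x z * (\<Sum>y\<in>V. matrix_power V P n z y))"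
    by (simp add: sum_distrib_left) (rule sum.swap)
  also have "\<dots> = walk_op (\<lambda>_. 1) x" using Suc by (simp add: walk_op_def)
  finally show ?case using Suc walk_op_const by simp
qed

text \<open>
  For fixed \<open>x\<close> the density \<open>y \<mapsto> P^n(x, y) / \<pi>(y)\<close> equals, by reversibility, a multiple of
  \<open>y \<mapsto> P^n(y, x)\<close>, and the latter evolves by applying \<open>P\<close>. Its centred version \<open>u\<close> keeps mean zero,
  so the Poincare inequality bounds its squared norm by a multiple of its energy, and the norm decays
  geometrically. Cauchy-Schwarz turns this norm into total variation distance.
  The constant \<open>c\<close> in the hypothesis is free because the mean minimises the left-hand side.
\<close>

lemma tv_dist_Poincare_bound:
  assumes K: "K \<ge> 1" and poincare: "\<And>f. \<exists>c. (\<Sum>x\<in>V. deg x * (f x - c)\<^sup>2) \<le> K * energy V E f"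
    and x: "x \<in> V"
  shows "tv_dist V (matrix_power V P n x) (reversible_measure V E)
           \<le> sqrt (vol * exp (- (real n / (4 * K)))) / 2"
proof -
  define q where "q = reversible_measure V E"
  define u where "u = (\<lambda>n y. matrix_power V P n y x - q x)"
  define S where "S = (\<lambda>n. \<Sum>y\<in>V. deg y * (u n y)\<^sup>2)"
  have dx: "deg x \<ge> 1" by (rule degree_ge_1[OF x])
  have qy: "q y = deg y / vol" for y by (simp add: q_def reversible_measure_def)
  have qx: "vol * q x = deg x" using vol_pos by (simp add: qy)
  have mean0: "(\<Sum>y\<in>V. deg y * u n y) = 0" for n
  proof -
    have "(\<Sum>y\<in>V. deg y * u n y) = (\<Sum>y\<in>V. deg x * matrix_power V P n x y) - vol * q x"
      using x by (simp add: u_def right_diff_distrib sum_subtractf sum_distrib_right matrix_power_reversible)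
    then show ?thesis
      by (simp add: qx sum_distrib_left[symmetric] matrix_power_sum[OF x])
  qed
  have step: "u (Suc n) y = walk_op (u n) y" if "y \<in> V" for n y
    unfolding u_def matrix_power_walk_op walk_op_diff using walk_op_const that by simp
  have decay: "S (Suc n) \<le> exp (- (1 / (4 * K))) * S n" for n
  proof -
    obtain c where c: "(\<Sum>x\<in>V. deg x * (u n x - c)\<^sup>2) \<le> K * energy V E (u n)" using poincare by blast
    have "(\<Sum>x\<in>V. deg x * (u n x - c)\<^sup>2) = S n + c\<^sup>2 * vol - 2 * c * (\<Sum>x\<in>V. deg x * u n x)"
      unfolding S_def by (simp add: power2_diff algebra_simps sum.distrib sum_subtractf sum_distrib_left)
    then have "S n \<le> K * energy V E (u n)" using c vol_pos by (simp add: mean0)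
        (smt (verit) mult_nonneg_nonneg zero_le_power2)
    then have "energy V E (u n) \<ge> S n / K" using K by (simp add: field_simps)
    moreover have "S (Suc n) \<le> S n - energy V E (u n) / 4"
      using walk_op_contraction[of "u n"] by (simp add: S_def step)
    ultimately have "S (Suc n) \<le> (1 - 1 / (4 * K)) * S n" by (simp add: algebra_simps)
    moreover have "1 - 1 / (4 * K) \<le> exp (- (1 / (4 * K)))"
      using exp_ge_add_one_self[of "- (1 / (4 * K))"] by simp
    moreover have "S n \<ge> 0" unfolding S_def by (intro sum_nonneg) auto
    ultimately show ?thesis by (meson mult_right_mono order_trans)
  qed
  have S0: "S 0 \<le> deg x"
  proof -
    have "S 0 = (\<Sum>y\<in>V. deg y * ((if y = x then 1 else 0) - 2 * q x * (if y = x then 1 else 0) + (q x)\<^sup>2))"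
      unfolding S_def u_def by (intro sum.cong) (auto simp: power2_diff)
    also have "\<dots> = deg x - 2 * q x * deg x + vol * (q x)\<^sup>2"
      using x finite_V
      by (simp add: algebra_simps sum.distrib sum_subtractf sum_distrib_left if_distrib[of "\<lambda>t. _ * t"] cong: if_cong)
    also have "vol * (q x)\<^sup>2 = deg x * q x" by (simp add: power2_eq_square qx[symmetric])
    finally have "S 0 = deg x - deg x * q x" by simp
    moreover have "q x \<ge> 0" using vol_pos by (simp add: qy)
    ultimately show ?thesis using dx by simp
  qed
  have Sn: "S n \<le> deg x * exp (- (real n / (4 * K)))" for n
  proof (induction n)
    case 0 then show ?case using S0 by simp
  next
    case (Suc n)
    have "S (Suc n) \<le> exp (- (1 / (4 * K))) * (deg x * exp (- (real n / (4 * K))))"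
      using decay[of n] Suc by (smt (verit) exp_gt_zero mult_left_mono)
    also have "\<dots> = deg x * exp (- (real (Suc n) / (4 * K)))"
      by (simp add: exp_add[symmetric] add_divide_distrib algebra_simps)
    finally show ?case .
  qed
  have pt: "\<bar>matrix_power V P n x y - q y\<bar> = deg y * \<bar>u n y\<bar> / deg x" if y: "y \<in> V" for y
  proof -
    have "deg x * matrix_power V P n x y = deg y * matrix_power V P n y x"
      by (rule matrix_power_reversible[OF x y])
    moreover have "deg x * q y = deg y * q x" by (simp add: qy)
    ultimately have "deg x * (matrix_power V P n x y - q y) = deg y * u n y"
      by (simp add: u_def algebra_simps)
    then have "deg x * \<bar>matrix_power V P n x y - q y\<bar> = deg y * \<bar>u n y\<bar>"
      by (metis abs_mult abs_of_nat)
    then show ?thesis using dx by (simp add: field_simps)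
  qed
  have "(\<Sum>y\<in>V. deg y * \<bar>u n y\<bar>)\<^sup>2 = (\<Sum>y\<in>V. sqrt (deg y) * (sqrt (deg y) * \<bar>u n y\<bar>))\<^sup>2"
    by (simp add: mult.assoc[symmetric])
  also have "\<dots> \<le> (\<Sum>y\<in>V. (sqrt (deg y))\<^sup>2) * (\<Sum>y\<in>V. (sqrt (deg y) * \<bar>u n y\<bar>)\<^sup>2)"
    by (rule Cauchy_Schwarz_ineq_sum)
  also have "\<dots> = vol * S n" by (simp add: S_def power_mult_distrib)
  also have "\<dots> \<le> vol * (deg x * exp (- (real n / (4 * K))))"
    using Sn vol_pos by (intro mult_left_mono) auto
  also have "\<dots> = (deg x)\<^sup>2 * (vol * exp (- (real n / (4 * K)))) / deg x"
    using dx by (simp add: power2_eq_square)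
  also have "\<dots> \<le> (deg x)\<^sup>2 * (vol * exp (- (real n / (4 * K))))"
    using dx vol_pos by (intro divide_le_self) auto
  finally have "(\<Sum>y\<in>V. deg y * \<bar>u n y\<bar>) \<le> sqrt ((deg x)\<^sup>2 * (vol * exp (- (real n / (4 * K)))))"
    by (rule real_le_rsqrt)
  also have "\<dots> = deg x * sqrt (vol * exp (- (real n / (4 * K))))"
    by (simp add: real_sqrt_mult)
  finally have "(\<Sum>y\<in>V. deg y * \<bar>u n y\<bar>) / deg x \<le> sqrt (vol * exp (- (real n / (4 * K))))"
    using dx by (simp add: field_simps)
  moreover have "(\<Sum>y\<in>V. \<bar>matrix_power V P n x y - q y\<bar>) = (\<Sum>y\<in>V. deg y * \<bar>u n y\<bar>) / deg x"
    by (simp add: pt sum_divide_distrib)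
  ultimately show ?thesis
    unfolding tv_dist_def q_def[symmetric] by simp
qed

lemma walk_dist_less_iff:
  "walk_dist V E n < a \<longleftrightarrow> (\<forall>x\<in>V. tv_dist V (matrix_power V P n x) (reversible_measure V E) < a)"
  unfolding walk_dist_def using finite_V V_nonempty
  by (subst cSup_eq_Max) auto

lemma walk_dist_Poincare:
  assumes K: "K \<ge> 1" and poincare: "\<And>f. \<exists>c. (\<Sum>x\<in>V. deg x * (f x - c)\<^sup>2) \<le> K * energy V E f"
    and n: "real n \<ge> 8 * K * ln (3 * real (card V))"
  shows "walk_dist V E n < 1 / 4"
proof -
  have card: "real (card V) \<ge> 1" using finite_V V_nonempty by (simp add: Suc_le_eq card_gt_0_iff)
  have "vol \<le> (\<Sum>z\<in>V. real (card V))" by (intro sum_mono degree_le_card)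
  then have vol: "vol \<le> (real (card V))\<^sup>2" by (simp add: power2_eq_square)
  have "exp (- (real n / (4 * K))) \<le> exp (- (2 * ln (3 * real (card V))))"
    using n K by (auto simp: field_simps)
  also have "\<dots> = 1 / (3 * real (card V))\<^sup>2"
    unfolding exp_minus exp_double using card by (simp add: inverse_eq_divide)
  finally have "vol * exp (- (real n / (4 * K))) \<le> (real (card V))\<^sup>2 * (1 / (3 * real (card V))\<^sup>2)"
    using vol by (intro mult_mono) auto
  also have "\<dots> = (1 / 3)\<^sup>2" using card by (simp add: power2_eq_square)
  finally have "sqrt (vol * exp (- (real n / (4 * K)))) \<le> 1 / 3"
    by (intro real_le_lsqrt) auto
  then show ?thesis
    unfolding walk_dist_less_iff using tv_dist_Poincare_bound[OF K poincare, of _ n] by fastforce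
qed

lemma mixing_time_le_Poincare:
  assumes K: "K \<ge> 1" and poincare: "\<And>f. \<exists>c. (\<Sum>x\<in>V. deg x * (f x - c)\<^sup>2) \<le> K * energy V E f"
  shows "real (mixing_time V E) \<le> 8 * K * ln (3 * real (card V)) + 1"
    and "walk_dist V E (mixing_time V E) < 1 / 4"
proof -
  define n where "n = nat \<lceil>8 * K * ln (3 * real (card V))\<rceil>"
  have card: "real (card V) \<ge> 1" using finite_V V_nonempty by (simp add: Suc_le_eq card_gt_0_iff)
  have pos: "8 * K * ln (3 * real (card V)) \<ge> 0" using K card by simp
  have n: "walk_dist V E n < 1 / 4"
    by (rule walk_dist_Poincare[OF K poincare]) (simp add: n_def real_nat_ceiling_ge)
  then have "mixing_time V E \<le> n" unfolding mixing_time_def by (intro cInf_lower) auto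
  moreover have "real n \<le> 8 * K * ln (3 * real (card V)) + 1" using pos unfolding n_def by linarith
  ultimately show "real (mixing_time V E) \<le> 8 * K * ln (3 * real (card V)) + 1" by linarith
  show "walk_dist V E (mixing_time V E) < 1 / 4"
    unfolding mixing_time_def using Inf_nat_def1[of "{n. walk_dist V E n < 1 / 4}"] n by auto
qed

text \<open>
  In each step, the mass that leaves \<open>A\<close> when the walk starts from the degree measure restricted to \<open>A\<close>
  is at most half the number of boundary edges, since the walk restricted to \<open>A\<close> never has more mass at a
  vertex than that measure.
\<close>

lemma escape_bound:
  assumes A: "A \<subseteq> V"
  shows "(\<Sum>x\<in>A. deg x * (\<Sum>y\<in>V - A. matrix_power V P n x y)) \<le> real n * cut_size V E A / 2"
proof (induction n)
  case 0
  have "(\<Sum>y\<in>V - A. matrix_power V P 0 x y) = 0" if "x \<in> A" for x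
    using that by (intro sum.neutral) auto
  then show ?case by simp
next
  case (Suc n)
  define u where "u = (\<lambda>n x. \<Sum>y\<in>V - A. matrix_power V P n x y)"
  have finA: "finite A" using A finite_V finite_subset by blast
  have u: "0 \<le> u n x" "x \<in> V \<Longrightarrow> u n x \<le> 1" for x
  proof -
    show "0 \<le> u n x" unfolding u_def by (intro sum_nonneg matrix_power_nonneg)
    assume x: "x \<in> V"
    have "u n x \<le> (\<Sum>y\<in>V. matrix_power V P n x y)"
      unfolding u_def using finite_V by (intro sum_mono2) (auto intro: matrix_power_nonneg)
    then show "u n x \<le> 1" by (simp add: matrix_power_sum[OF x])
  qed
  have "u (Suc n) x = (\<Sum>z\<in>V. P x z * u n z)" for x
    unfolding u_def by (simp add: sum_distrib_left) (rule sum.swap)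
  then have "(\<Sum>x\<in>A. deg x * u (Suc n) x) = (\<Sum>z\<in>V. \<Sum>x\<in>A. deg x * P x z * u n z)"
    by (simp add: sum_distrib_left mult.assoc) (rule sum.swap)
  also have "\<dots> = (\<Sum>z\<in>A. \<Sum>x\<in>A. deg x * P x z * u n z) + (\<Sum>z\<in>V - A. \<Sum>x\<in>A. deg x * P x z * u n z)"
    using A finite_V by (simp add: sum.subset_diff)
  also have "(\<Sum>z\<in>A. \<Sum>x\<in>A. deg x * P x z * u n z) \<le> (\<Sum>z\<in>A. deg z * u n z)"
  proof (intro sum_mono)
    fix z assume z: "z \<in> A"
    then have zV: "z \<in> V" using A by auto
    have "(\<Sum>x\<in>A. deg x * P x z * u n z) = deg z * u n z * (\<Sum>x\<in>A. P z x)"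
      using A zV lazy_walk_reversible[OF _ zV] by (auto simp: sum_distrib_left subset_iff intro!: sum.cong)
    also have "(\<Sum>x\<in>A. P z x) \<le> (\<Sum>x\<in>V. P z x)"
      using A finite_V by (intro sum_mono2) (auto simp: lazy_walk_nonneg)
    also have "(\<Sum>x\<in>V. P z x) = 1" using walk_op_const[OF zV, of 1] by (simp add: walk_op_def)
    finally show "(\<Sum>x\<in>A. deg x * P x z * u n z) \<le> deg z * u n z"
      using u by (simp add: mult_left_mono)
  qed
  also have "(\<Sum>z\<in>V - A. \<Sum>x\<in>A. deg x * P x z * u n z) \<le> (\<Sum>z\<in>V - A. \<Sum>x\<in>A. of_bool ({x, z} \<in> E) / 2)"
  proof (intro sum_mono)
    fix z x assume zx: "z \<in> V - A" "x \<in> A"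
    have "deg x * P x z = of_bool ({x, z} \<in> E) / 2"
      using zx A degree_pos[of x] by (auto simp: lazy_walk_def)
    then have "deg x * P x z * u n z = of_bool ({x, z} \<in> E) / 2 * u n z" by (simp only:)
    also have "\<dots> \<le> of_bool ({x, z} \<in> E) / 2"
      using u[of z] zx by (intro mult_left_le) auto
    finally show "deg x * P x z * u n z \<le> of_bool ({x, z} \<in> E) / 2" .
  qed
  also have "(\<Sum>z\<in>V - A. \<Sum>x\<in>A. of_bool ({x, z} \<in> E) / 2) = cut_size V E A / 2"
    unfolding cut_size_def by (subst sum.swap) (simp add: sum_divide_distrib)
  finally have "(\<Sum>x\<in>A. deg x * u (Suc n) x) \<le> (\<Sum>z\<in>A. deg z * u n z) + cut_size V E A / 2"
    by simp
  moreover have "(\<Sum>z\<in>A. deg z * u n z) \<le> real n * cut_size V E A / 2"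
    using Suc unfolding u_def .
  ultimately have "(\<Sum>x\<in>A. deg x * u (Suc n) x) \<le> real (Suc n) * cut_size V E A / 2"
    by (simp add: add_divide_distrib distrib_right)
  then show ?case unfolding u_def .
qed

lemma tv_dist_ge_set:
  assumes "B \<subseteq> V" "(\<Sum>y\<in>V. \<mu> y) = 1" "(\<Sum>y\<in>V. \<nu> y) = 1"
  shows "(\<Sum>y\<in>B. \<nu> y) - (\<Sum>y\<in>B. \<mu> y) \<le> tv_dist V \<mu> \<nu>"
proof -
  have *: "(\<Sum>y\<in>V. g y) = (\<Sum>y\<in>B. g y) + (\<Sum>y\<in>V - B. g y)" for g :: "'a \<Rightarrow> real"
    using assms(1) finite_V by (simp add: sum.subset_diff)
  have "(\<Sum>y\<in>B. \<nu> y - \<mu> y) \<le> (\<Sum>y\<in>B. \<bar>\<mu> y - \<nu> y\<bar>)"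
    "(\<Sum>y\<in>V - B. \<mu> y - \<nu> y) \<le> (\<Sum>y\<in>V - B. \<bar>\<mu> y - \<nu> y\<bar>)"
    by (intro sum_mono; linarith)+
  then show ?thesis
    using assms(2,3) unfolding tv_dist_def * by (simp add: sum_subtractf)
qed

text \<open>
  At a time when the walk is nearly mixed, every starting point in \<open>A\<close> must have probability at least
  \<open>1/2 - 1/4\<close> of being outside \<open>A\<close>.
\<close>

lemma walk_dist_cut_light_side:
  assumes A: "A \<subseteq> V" "A \<noteq> {}" and half: "2 * (\<Sum>x\<in>A. deg x) \<le> vol" and n: "walk_dist V E n < 1 / 4"
  shows "(\<Sum>x\<in>A. deg x) \<le> 2 * real n * cut_size V E A"
proof -
  have finA: "finite A" using A finite_V finite_subset by blast
  have sum1: "(\<Sum>y\<in>V. reversible_measure V E y) = 1"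
    using vol_pos by (simp add: reversible_measure_def sum_divide_distrib[symmetric])
  have "(\<Sum>y\<in>V - A. reversible_measure V E y) = (vol - (\<Sum>x\<in>A. deg x)) / vol"
    using A finite_V by (simp add: reversible_measure_def sum_divide_distrib[symmetric] sum_diff)
  moreover have "1 / 2 \<le> (vol - (\<Sum>x\<in>A. deg x)) / vol"
    using half vol_pos by (simp add: field_simps)
  ultimately have big: "(\<Sum>y\<in>V - A. reversible_measure V E y) \<ge> 1 / 2" by simp
  have "deg x * (1 / 4) \<le> deg x * (\<Sum>y\<in>V - A. matrix_power V P n x y)" if x: "x \<in> A" for x
  proof -
    have xV: "x \<in> V" using x A by auto
    have "(\<Sum>y\<in>V - A. reversible_measure V E y) - (\<Sum>y\<in>V - A. matrix_power V P n x y) < 1 / 4"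
      using n xV tv_dist_ge_set[of "V - A" "matrix_power V P n x" "reversible_measure V E"]
        matrix_power_sum[OF xV] sum1 unfolding walk_dist_less_iff by force
    then show ?thesis using big by (intro mult_left_mono) auto
  qed
  then have "(\<Sum>x\<in>A. deg x * (1 / 4)) \<le> (\<Sum>x\<in>A. deg x * (\<Sum>y\<in>V - A. matrix_power V P n x y))"
    by (rule sum_mono)
  also have "\<dots> \<le> real n * cut_size V E A / 2" by (rule escape_bound[OF A(1)])
  finally show ?thesis by (simp add: sum_divide_distrib[symmetric])
qed

text \<open>
  Cardinalities bound the volumes from below as all degrees are positive.
\<close>

lemma walk_dist_cut:
  assumes A: "A \<subseteq> V" "A \<noteq> {}" "A \<noteq> V" and n: "walk_dist V E n < 1 / 4"
  shows "min (real (card A)) (real (card (V - A))) \<le> 2 * real n * cut_size V E A"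
proof -
  have card_le: "real (card B) \<le> (\<Sum>x\<in>B. deg x)" if "B \<subseteq> V" for B
    using sum_mono[of B "\<lambda>_. 1" deg] that degree_ge_1 by (auto simp: subset_iff)
  have sym: "cut_size V E (V - A) = cut_size V E A"
    using A unfolding cut_size_def by (subst sum.swap) (simp add: double_diff insert_commute)
  have "vol = (\<Sum>x\<in>A. deg x) + (\<Sum>x\<in>V - A. deg x)" using A finite_V by (simp add: sum.subset_diff)
  then consider "2 * (\<Sum>x\<in>A. deg x) \<le> vol" | "2 * (\<Sum>x\<in>V - A. deg x) \<le> vol" by linarith
  then show ?thesis
  proof cases
    case 1
    then show ?thesis using walk_dist_cut_light_side[OF A(1,2) 1 n] card_le[OF A(1)] by linarith
  next
    case 2
    have "V - A \<noteq> {}" using A by auto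
    then show ?thesis using walk_dist_cut_light_side[OF _ _ 2 n] card_le[of "V - A"] sym by auto
  qed
qed

end

section \<open>A Poincare inequality from a hierarchy of hubs\<close>

lemma energy_ge_star:
  assumes "finite I" "u \<in> I" "S \<subseteq> I" "\<And>y. y \<in> S \<Longrightarrow> y \<noteq> u \<Longrightarrow> {u, y} \<in> E"
  shows "(\<Sum>y\<in>S. (f u - f y)\<^sup>2) \<le> energy I E f"
proof -
  have fS: "finite S" using assms finite_subset by blast
  have "(\<Sum>y\<in>S. (f u - f y)\<^sup>2) = (\<Sum>y\<in>S - {u}. (f u - f y)\<^sup>2)"
    using fS by (intro sum.mono_neutral_right) auto
  also have "\<dots> \<le> (\<Sum>y\<in>neighbours I E u. (f u - f y)\<^sup>2)"
    using assms by (intro sum_mono2) (auto simp: neighbours_def)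
  also have "\<dots> \<le> energy I E f"
    unfolding energy_def using assms by (intro member_le_sum) (auto intro!: sum_nonneg)
  finally show ?thesis .
qed

lemma energy_superadditive:
  assumes "finite I" "A \<union> B \<subseteq> I" "A \<inter> B = {}"
  shows "energy A E f + energy B E f \<le> energy I E f"
proof -
  have fin: "finite A" "finite B" using assms by (auto intro: finite_subset)
  have *: "energy C E f \<le> (\<Sum>x\<in>C. \<Sum>y\<in>neighbours I E x. (f x - f y)\<^sup>2)" if "C \<subseteq> I" for C
    unfolding energy_def using that assms(1)
    by (intro sum_mono sum_mono2) (auto simp: neighbours_def)
  have "energy A E f + energy B E f \<le> (\<Sum>x\<in>A. \<Sum>y\<in>neighbours I E x. (f x - f y)\<^sup>2)
      + (\<Sum>x\<in>B. \<Sum>y\<in>neighbours I E x. (f x - f y)\<^sup>2)"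
    using assms by (intro add_mono *) auto
  also have "\<dots> = (\<Sum>x\<in>A \<union> B. \<Sum>y\<in>neighbours I E x. (f x - f y)\<^sup>2)"
    using fin assms(3) by (simp add: sum.union_disjoint)
  also have "\<dots> \<le> energy I E f"
    unfolding energy_def using assms by (intro sum_mono2) (auto intro!: sum_nonneg)
  finally show ?thesis .
qed

text \<open>
  With \<open>J\<close> of the order of the number of scales, the factor \<open>1 + 1/J\<close> picked up at each scale
  multiplies up to a constant.
\<close>

lemma weighted_square_triangle:
  fixes a b c :: real
  assumes "J > 0"
  shows "(a - c)\<^sup>2 \<le> (1 + 1 / J) * (a - b)\<^sup>2 + (1 + J) * (b - c)\<^sup>2"
proof -
  define p q where "p = a - b" and "q = b - c"
  have "0 \<le> (p - J * q)\<^sup>2 / J" using assms by simp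
  also have "\<dots> = p\<^sup>2 / J - 2 * p * q + J * q\<^sup>2"
    using assms by (simp add: power2_diff field_simps power2_eq_square)
  finally have "(p + q)\<^sup>2 \<le> (1 + 1 / J) * p\<^sup>2 + (1 + J) * q\<^sup>2"
    by (simp add: power2_sum algebra_simps)
  then show ?thesis by (simp add: p_def q_def)
qed

text \<open>
  This isolates what the analytic part needs from the random graph. The function \<open>X\<close> plays the role of
  \<open>W^(1/\<alpha>)\<close>, the function \<open>D\<close> that of the degree, and the single parameter \<open>T\<close> collects the logarithmic
  losses in all estimates. Distances are those of the line: they are at least the torus
  distances, and intervals of the line suffice for the hierarchy.
\<close>

locale hub_graph =
  fixes N :: nat and \<gamma> T :: real and E :: "nat set set" and X D :: "nat \<Rightarrow> real"
  assumes gamma: "1 < \<gamma>" "\<gamma> < 2" and T: "T \<ge> 1"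
    and X_ge_1: "\<And>x. x \<in> {1..N} \<Longrightarrow> X x \<ge> 1"
    and D_nonneg: "\<And>x. D x \<ge> 0"
    and line: "\<And>x. 1 \<le> x \<Longrightarrow> x < N \<Longrightarrow> {x, Suc x} \<in> E"
    and hub: "\<And>a s. 1 \<le> s \<Longrightarrow> a + s \<le> N \<Longrightarrow> \<exists>x\<in>{a<..a + s}. real s \<le> T * X x powr \<gamma>"
    and conn: "\<And>x y. x \<in> {1..N} \<Longrightarrow> y \<in> {1..N} \<Longrightarrow> x \<noteq> y \<Longrightarrow>
        T * \<bar>real x - real y\<bar> \<le> X x * X y \<Longrightarrow> {x, y} \<in> E"
    and mass: "\<And>a s. 1 \<le> s \<Longrightarrow> a + s \<le> N \<Longrightarrow> (\<Sum>x\<in>{x\<in>{a<..a + s}. X x \<le> real s}. D x) \<le> real s * T"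
begin

lemma line_bound:
  assumes I: "a + s \<le> N" and xy: "x \<in> {a<..a + s}" "y \<in> {a<..a + s}"
  shows "(f x - f y)\<^sup>2 \<le> real s * energy {a<..a + s} E f"
proof -
  have *: "(f x - f y)\<^sup>2 \<le> real s * energy {a<..a + s} E f"
    if "x \<le> y" "x \<in> {a<..a + s}" "y \<in> {a<..a + s}" for x y
  proof -
    have "f y - f x = (\<Sum>i\<in>{x..<y}. f (Suc i) - f i)"
      using that(1) by (simp add: sum_Suc_diff')
    then have "(f x - f y)\<^sup>2 = (\<Sum>i\<in>{x..<y}. f (Suc i) - f i)\<^sup>2"
      by (metis power2_commute)
    also have "\<dots> \<le> real (card {x..<y}) * (\<Sum>i\<in>{x..<y}. (f (Suc i) - f i)\<^sup>2)"
      using sum_squared_le_sum_of_squares[of "\<lambda>i. f (Suc i) - f i" "{x..<y}"] by (simp add: mult.commute)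
    also have "\<dots> \<le> real s * (\<Sum>i\<in>{x..<y}. (f (Suc i) - f i)\<^sup>2)"
      using that by (intro mult_right_mono sum_nonneg) auto
    also have "(\<Sum>i\<in>{x..<y}. (f (Suc i) - f i)\<^sup>2) \<le> energy {a<..a + s} E f"
    proof -
      have "(\<Sum>i\<in>{x..<y}. (f (Suc i) - f i)\<^sup>2) \<le> (\<Sum>i\<in>{x..<y}. \<Sum>j\<in>neighbours {a<..a + s} E i. (f i - f j)\<^sup>2)"
      proof (rule sum_mono)
        fix i assume i: "i \<in> {x..<y}"
        then have "{i, Suc i} \<in> E" using line[of i] that I by auto
        then have "Suc i \<in> neighbours {a<..a + s} E i" using i that by (auto simp: neighbours_def)
        then have "(f i - f (Suc i))\<^sup>2 \<le> (\<Sum>j\<in>neighbours {a<..a + s} E i. (f i - f j)\<^sup>2)"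
          by (intro member_le_sum finite_neighbours) auto
        then show "(f (Suc i) - f i)\<^sup>2 \<le> (\<Sum>j\<in>neighbours {a<..a + s} E i. (f i - f j)\<^sup>2)"
          by (simp add: power2_commute)
      qed
      also have "\<dots> \<le> energy {a<..a + s} E f"
        unfolding energy_def using that by (intro sum_mono2) (auto intro!: sum_nonneg)
      finally show ?thesis .
    qed
    finally show ?thesis by (simp add: mult_left_mono)
  qed
  show ?thesis using *[of x y] *[of y x] xy by (cases "x \<le> y") (auto simp: power2_commute)
qed

text \<open>
  Cut the interval into \<open>n\<close> windows of length \<open>m \<approx> s^(\<gamma>-1)\<close>. The hub \<open>y\<close> of a window has
  \<open>X\<^sub>y \<approx> m^(1/\<gamma>) \<approx> s^(1-1/\<gamma>)\<close>, just enough for an edge to each vertex with \<open>X \<ge> s^(1/\<gamma>)\<close> at distance at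
  most \<open>s\<close>. So \<open>u\<close> and \<open>v\<close> have \<open>n \<approx> s^(2-\<gamma>)\<close> common neighbours, and averaging over the resulting paths
  of length two gives the bound. The factor 3 in the assumptions on \<open>u\<close> and \<open>v\<close> admits hubs of the two
  halves of the interval.
\<close>

lemma strong_pair_bound:
  assumes I: "1 \<le> s" "a + s \<le> N" and large: "4 * T ^ 4 * real s powr (\<gamma> - 1) \<le> real s"
    and uv: "u \<in> {a<..a + s}" "v \<in> {a<..a + s}"
    and strong: "real s \<le> 3 * T * X u powr \<gamma>" "real s \<le> 3 * T * X v powr \<gamma>"
  shows "real s * (f u - f v)\<^sup>2 \<le> 32 * T ^ 4 * real s powr (\<gamma> - 1) * energy {a<..a + s} E f"
proof -
  define I where "I = {a<..a + s}"
  define B where "B = T ^ 4 * real s powr (\<gamma> - 1)"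
  \<comment> \<open>Windows of length \<open>m\<close> are long enough for their hubs \<open>y\<close> to satisfy \<open>X\<^sub>u X\<^sub>y \<ge> T s\<close>.\<close>
  define m where "m = nat \<lceil>3 * B\<rceil>"
  define n where "n = s div m"
  have s0: "real s \<ge> 1" using I by simp
  have "real s powr (\<gamma> - 1) \<ge> 1" using s0 gamma by (intro ge_one_powr_ge_zero) auto
  moreover have "T ^ 4 \<ge> 1" using T by simp
  ultimately have B1: "B \<ge> 1" unfolding B_def
    using mult_mono[of 1 "T ^ 4" 1 "real s powr (\<gamma> - 1)"] by simp
  have m: "3 * B \<le> real m" "real m \<le> 4 * B" "m \<ge> 1"
    using B1 unfolding m_def by linarith+
  have ms: "m \<le> s" using m(2) large by (simp add: B_def)
  have n1: "n \<ge> 1" unfolding n_def using ms m(3) by (simp add: Suc_le_eq div_greater_zero_iff)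
  have nms: "n * m \<le> s" unfolding n_def by simp
  have sn: "s \<le> 2 * n * m"
  proof -
    have "s < n * m + m" unfolding n_def using m(3) dividend_less_div_times[of m s] by simp
    moreover have "m \<le> n * m" using n1 by simp
    ultimately show ?thesis unfolding mult.assoc by linarith
  qed
  have "\<exists>y. \<forall>i<n. y i \<in> {a + i * m<..a + i * m + m} \<and> real m \<le> T * X (y i) powr \<gamma>"
  proof -
    have "\<exists>y\<in>{a + i * m<..a + i * m + m}. real m \<le> T * X y powr \<gamma>" if "i < n" for i
    proof (rule hub[OF m(3)])
      have "i * m + m \<le> n * m" using that by (metis Suc_leI add.commute mult_Suc mult_le_mono1)
      then show "a + i * m + m \<le> N" using nms I by linarith
    qed
    then show ?thesis by metis
  qed
  then obtain y where y: "\<And>i. i < n \<Longrightarrow> y i \<in> {a + i * m<..a + i * m + m}"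
    "\<And>i. i < n \<Longrightarrow> real m \<le> T * X (y i) powr \<gamma>" by blast
  have yI: "y i \<in> I" if "i < n" for i
  proof -
    have "i * m + m \<le> n * m" using that by (metis Suc_leI add.commute mult_Suc mult_le_mono1)
    then show ?thesis using y(1)[OF that] nms by (auto simp: I_def)
  qed
  have inj: "inj_on y {..<n}"
  proof (rule linorder_inj_onI)
    fix i j assume ij: "i < j" "i \<in> {..<n}" "j \<in> {..<n}"
    have "i * m + m \<le> j * m" using ij by (metis Suc_leI add.commute mult_Suc mult_le_mono1)
    then show "y i \<noteq> y j" using y(1)[of i] y(1)[of j] ij by auto
  qed auto
  have adj: "{w, y i} \<in> E" if w: "w \<in> I" "real s \<le> 3 * T * X w powr \<gamma>" and i: "i < n" "y i \<noteq> w" for w i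
  proof (rule conn)
    show wN: "w \<in> {1..N}" and yN: "y i \<in> {1..N}" using w yI[OF i(1)] I by (auto simp: I_def)
    show "w \<noteq> y i" using i by simp
    have Xw: "X w \<ge> 1" and Xy: "X (y i) \<ge> 1" using X_ge_1 wN yN by auto
    have "(T * real s) powr \<gamma> * (3 * T\<^sup>2) = T powr \<gamma> * real s powr \<gamma> * (3 * T\<^sup>2)"
      using T s0 by (simp add: powr_mult)
    also have "\<dots> \<le> T powr 2 * real s powr \<gamma> * (3 * T\<^sup>2)"
      using T gamma by (intro mult_right_mono powr_mono) auto
    also have "\<dots> = real s * (3 * B)"
    proof -
      have "real s * real s powr (\<gamma> - 1) = real s powr \<gamma>"
        using s0 by (simp add: powr_mult_base)
      then show ?thesis using T by (simp add: B_def powr_numeral power2_eq_square power4_eq_xxxx algebra_simps)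
    qed
    also have "\<dots> \<le> (3 * T * X w powr \<gamma>) * (T * X (y i) powr \<gamma>)"
    proof (rule mult_mono[OF w(2)])
      show "3 * B \<le> T * X (y i) powr \<gamma>" using m(1) y(2)[OF i(1)] by linarith
      show "0 \<le> 3 * T * X w powr \<gamma>" using T by simp
    qed (use B1 in simp)
    also have "\<dots> = (X w * X (y i)) powr \<gamma> * (3 * T\<^sup>2)"
      using Xw Xy by (simp add: powr_mult power2_eq_square)
    finally have "(T * real s) powr \<gamma> \<le> (X w * X (y i)) powr \<gamma>" using T by simp
    then have "T * real s \<le> X w * X (y i)"
      using gamma Xw Xy T powr_less_mono2[of \<gamma> "X w * X (y i)" "T * real s"]
      by (meson leD leI less_le_trans less_numeral_extra(1) mult_nonneg_nonneg order_trans zero_le_one)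
    moreover have "\<bar>real w - real (y i)\<bar> \<le> real s" using w yI[OF i(1)] by (auto simp: I_def)
    ultimately show "T * \<bar>real w - real (y i)\<bar> \<le> X w * X (y i)"
      using T by (smt (verit) mult_left_mono)
  qed
  have star: "(\<Sum>i<n. (f w - f (y i))\<^sup>2) \<le> energy I E f"
    if "w \<in> I" "real s \<le> 3 * T * X w powr \<gamma>" for w
  proof -
    have "(\<Sum>i<n. (f w - f (y i))\<^sup>2) = (\<Sum>z\<in>y ` {..<n}. (f w - f z)\<^sup>2)"
      using inj by (simp add: sum.reindex)
    also have "\<dots> \<le> energy I E f"
      using that yI adj by (intro energy_ge_star) (auto simp: I_def)
    finally show ?thesis .
  qed
  have "real n * (f u - f v)\<^sup>2 = (\<Sum>i<n. (f u - f v)\<^sup>2)" by simp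
  also have "\<dots> \<le> (\<Sum>i<n. 2 * (f u - f (y i))\<^sup>2 + 2 * (f v - f (y i))\<^sup>2)"
    using weighted_square_triangle[of 1] by (intro sum_mono) (simp add: power2_commute)
  also have "\<dots> = 2 * (\<Sum>i<n. (f u - f (y i))\<^sup>2) + 2 * (\<Sum>i<n. (f v - f (y i))\<^sup>2)"
    by (simp add: sum.distrib sum_distrib_left)
  also have "\<dots> \<le> 4 * energy I E f"
    using star[of u] star[of v] uv strong unfolding I_def by linarith
  finally have n_bound: "real n * (f u - f v)\<^sup>2 \<le> 4 * energy I E f" .
  have "real s * (f u - f v)\<^sup>2 \<le> real (2 * n * m) * (f u - f v)\<^sup>2"
    using sn by (intro mult_right_mono) (auto simp flip: of_nat_mult)
  also have "\<dots> = 2 * real m * (real n * (f u - f v)\<^sup>2)" by simp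
  also have "\<dots> \<le> 2 * real m * (4 * energy I E f)"
    using n_bound by (intro mult_left_mono) auto
  also have "\<dots> \<le> 2 * (4 * B) * (4 * energy I E f)"
    using m energy_nonneg[of I E f] by (intro mult_right_mono) auto
  finally show ?thesis by (simp add: B_def I_def mult_ac)
qed

text \<open>
  Induction over halvings of the interval. A vertex with \<open>X\<close> at most the length of its half is compared
  with the hub of this half by the induction hypothesis, and that hub with \<open>r\<close> by \<open>strong_pair_bound\<close>; a vertex with
  larger \<open>X\<close> is compared with \<open>r\<close> directly. Intervals of length at most \<open>s0\<close>, too short for the windows
  of \<open>strong_pair_bound\<close>, are handled by the path along the line.
\<close>

lemma interval_Poincare:
  fixes s0 :: nat and J A :: real
  assumes s0: "s0 \<ge> 1" and large: "\<And>s. s > s0 \<Longrightarrow> 4 * T ^ 4 * real s powr (\<gamma> - 1) \<le> real s"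
    and J: "J > 0" and A1: "A \<ge> 32 * T ^ 5 * real N powr (\<gamma> - 1)" and A2: "A \<ge> (real s0)\<^sup>2 * T"
  shows "1 \<le> s \<Longrightarrow> a + s \<le> N \<Longrightarrow> s \<le> 2 ^ d * s0 \<Longrightarrow> r \<in> {a<..a + s} \<Longrightarrow> real s \<le> T * X r powr \<gamma> \<Longrightarrow>
    (\<Sum>x\<in>{x\<in>{a<..a + s}. X x \<le> real s}. D x * (f x - f r)\<^sup>2)
      \<le> (1 + 1 / J) ^ d * (1 + real d) * (1 + J) * A * energy {a<..a + s} E f"
proof (induction d arbitrary: s a r)
  case base: 0
  have "(\<Sum>x\<in>{x\<in>{a<..a + s}. X x \<le> real s}. D x * (f x - f r)\<^sup>2)
      \<le> (\<Sum>x\<in>{x\<in>{a<..a + s}. X x \<le> real s}. D x * (real s * energy {a<..a + s} E f))"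
    using base by (intro sum_mono mult_left_mono line_bound D_nonneg) auto
  also have "\<dots> = (\<Sum>x\<in>{x\<in>{a<..a + s}. X x \<le> real s}. D x) * (real s * energy {a<..a + s} E f)"
    by (simp add: sum_distrib_right)
  also have "\<dots> \<le> (real s * T) * (real s * energy {a<..a + s} E f)"
    using base by (intro mult_right_mono mass mult_nonneg_nonneg energy_nonneg) auto
  also have "\<dots> = ((real s)\<^sup>2 * T) * energy {a<..a + s} E f" by (simp add: power2_eq_square)
  also have "\<dots> \<le> ((real s0)\<^sup>2 * T) * energy {a<..a + s} E f"
    using base T by (intro mult_right_mono energy_nonneg power_mono) auto
  also have "\<dots> \<le> ((1 + J) * A) * energy {a<..a + s} E f"
  proof (intro mult_right_mono energy_nonneg)
    have "0 \<le> (real s0)\<^sup>2 * T" using T by simp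
    then have "A \<ge> 0" using A2 by linarith
    then have "A \<le> (1 + J) * A" using J by (simp add: mult_le_cancel_right1)
    then show "(real s0)\<^sup>2 * T \<le> (1 + J) * A" using A2 by linarith
  qed
  finally show ?case by simp
next
  case (Suc d)
  define I where "I = {a<..a + s}"
  define C where "C = (1 + 1 / J) ^ d * (1 + real d) * (1 + J) * A"
  have A0: "A \<ge> 0"
  proof -
    have "0 \<le> (real s0)\<^sup>2 * T" using T by simp
    then show ?thesis using A2 by linarith
  qed
  have pow: "(1 + 1 / J) ^ d \<le> (1 + 1 / J) ^ Suc d" using J by (intro power_increasing) auto
  have pow1: "(1 + 1 / J) ^ Suc d \<ge> 1" using J by (intro one_le_power) auto
  show ?case
  proof (cases "s \<le> 2 ^ d * s0")
    case True
    have "(\<Sum>x\<in>{x\<in>{a<..a + s}. X x \<le> real s}. D x * (f x - f r)\<^sup>2) \<le> C * energy I E f"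
      unfolding C_def I_def using Suc True by blast
    also have "\<dots> \<le> (1 + 1 / J) ^ Suc d * (1 + real (Suc d)) * (1 + J) * A * energy I E f"
      unfolding C_def using J A0 pow by (intro mult_right_mono mult_mono energy_nonneg) auto
    finally show ?thesis unfolding I_def .
  next
    case False
    have "1 * s0 \<le> 2 ^ d * s0" by (intro mult_le_mono1) simp
    then have "s > s0" using False by linarith
    then have s2: "s \<ge> 2" and lg: "4 * T ^ 4 * real s powr (\<gamma> - 1) \<le> real s"
      using s0 large by auto
    \<comment> \<open>\<open>Q\<close> is the bound from \<open>strong_pair_bound\<close> on every squared difference at the present scale.\<close>
    define Q where "Q = 32 * T ^ 4 * real s powr (\<gamma> - 1) * energy I E f / real s"
    have Q0: "Q \<ge> 0" unfolding Q_def using T energy_nonneg[of I E f] by simp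
    have pair: "(f u - f v)\<^sup>2 \<le> Q" if "u \<in> I" "v \<in> I" "real s \<le> 3 * T * X u powr \<gamma>" "real s \<le> 3 * T * X v powr \<gamma>" for u v
      using strong_pair_bound[OF Suc.prems(1,2) lg, of u v f] that s2
      unfolding Q_def I_def by (simp add: field_simps)
    have rI: "r \<in> I" and rs: "real s \<le> 3 * T * X r powr \<gamma>"
      using Suc.prems T by (auto simp: I_def intro: order_trans)
    have child: "(\<Sum>x\<in>{x\<in>{b<..b + t}. X x \<le> real s}. D x * (f x - f r)\<^sup>2)
        \<le> (1 + 1 / J) * (C * energy {b<..b + t} E f) + (1 + J) * Q * (\<Sum>x\<in>{x\<in>{b<..b + t}. X x \<le> real s}. D x)"
      if t: "1 \<le> t" "t \<le> s" "s \<le> 3 * t" "t \<le> 2 ^ d * s0" "{b<..b + t} \<subseteq> I" for b t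
    proof -
      have "b + t \<in> {b<..b + t}" using t(1) by simp
      then have bN: "b + t \<le> N" using t(5) Suc.prems(2) unfolding I_def by fastforce
      obtain q where q: "q \<in> {b<..b + t}" "real t \<le> T * X q powr \<gamma>" using hub[OF t(1) bN] by blast
      have st: "real s \<le> 3 * real t" using t(3) by simp
      have qs: "real s \<le> 3 * T * X q powr \<gamma>" using q st by linarith
      have qr: "(f q - f r)\<^sup>2 \<le> Q" using q t(5) rI rs qs by (intro pair) auto
      have pt: "D x * (f x - f r)\<^sup>2 \<le> (1 + 1 / J) * (if X x \<le> real t then D x * (f x - f q)\<^sup>2 else 0) + (1 + J) * Q * D x"
        if x: "x \<in> {b<..b + t}" for x
      proof (cases "X x \<le> real t")
        case True
        have "(f x - f r)\<^sup>2 \<le> (1 + 1 / J) * (f x - f q)\<^sup>2 + (1 + J) * (f q - f r)\<^sup>2"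
          by (rule weighted_square_triangle[OF J])
        also have "\<dots> \<le> (1 + 1 / J) * (f x - f q)\<^sup>2 + (1 + J) * Q"
          using qr J by (intro add_left_mono mult_left_mono) auto
        finally have "D x * (f x - f r)\<^sup>2 \<le> D x * ((1 + 1 / J) * (f x - f q)\<^sup>2 + (1 + J) * Q)"
          by (intro mult_left_mono D_nonneg)
        then show ?thesis using True by (simp add: algebra_simps)
      next
        case False
        have xI: "x \<in> I" using x t by auto
        then have Xx: "X x \<ge> 1" using X_ge_1[of x] Suc.prems(2) by (auto simp: I_def)
        have "X x \<le> X x powr \<gamma>" using Xx gamma powr_mono[of 1 \<gamma> "X x"] by simp
        then have "real s \<le> 3 * X x powr \<gamma>" using False st by linarith
        also have "\<dots> \<le> 3 * T * X x powr \<gamma>" using T by (intro mult_right_mono) auto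
        finally have "(f x - f r)\<^sup>2 \<le> Q" using pair xI rI rs by blast
        also have "\<dots> \<le> (1 + J) * Q" using J Q0 by (simp add: mult_le_cancel_right1)
        finally have "D x * (f x - f r)\<^sup>2 \<le> D x * ((1 + J) * Q)" by (intro mult_left_mono D_nonneg)
        then show ?thesis using False by (simp add: mult_ac)
      qed
      have "(\<Sum>x\<in>{x\<in>{b<..b + t}. X x \<le> real s}. D x * (f x - f r)\<^sup>2) \<le>
          (\<Sum>x\<in>{x\<in>{b<..b + t}. X x \<le> real s}. (1 + 1 / J) * (if X x \<le> real t then D x * (f x - f q)\<^sup>2 else 0) + (1 + J) * Q * D x)"
        by (intro sum_mono pt) auto
      also have "\<dots> = (1 + 1 / J) * (\<Sum>x\<in>{x\<in>{b<..b + t}. X x \<le> real s}. if X x \<le> real t then D x * (f x - f q)\<^sup>2 else 0)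
          + (1 + J) * Q * (\<Sum>x\<in>{x\<in>{b<..b + t}. X x \<le> real s}. D x)"
        by (simp add: sum.distrib sum_distrib_left)
      also have "(\<Sum>x\<in>{x\<in>{b<..b + t}. X x \<le> real s}. if X x \<le> real t then D x * (f x - f q)\<^sup>2 else 0)
          = (\<Sum>x\<in>{x\<in>{b<..b + t}. X x \<le> real t}. D x * (f x - f q)\<^sup>2)"
        using t(2) by (subst sum.inter_filter[symmetric]) (auto intro!: sum.cong)
      also have "\<dots> \<le> C * energy {b<..b + t} E f"
        unfolding C_def using q t bN by (intro Suc.IH) auto
      finally show ?thesis using J by (simp add: mult_left_mono)
    qed
    define s1 s2 where "s1 = s div 2" and "s2 = s - s div 2"
    define I1 I2 where "I1 = {a<..a + s1}" and "I2 = {a + s1<..a + s1 + s2}"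
    have half: "1 \<le> s1" "1 \<le> s2" "s1 \<le> s" "s2 \<le> s" "s \<le> 3 * s1" "s \<le> 3 * s2" "s1 + s2 = s"
      "s1 \<le> 2 ^ d * s0" "s2 \<le> 2 ^ d * s0"
      using \<open>s \<ge> 2\<close> Suc.prems(3) unfolding s1_def s2_def by auto
    have IU: "I1 \<union> I2 = I" "I1 \<inter> I2 = {}" "I1 \<subseteq> I" "I2 \<subseteq> I"
      using half(7) unfolding I1_def I2_def I_def by auto
    have split: "(\<Sum>x\<in>{x\<in>I. X x \<le> real s}. g x) = (\<Sum>x\<in>{x\<in>I1. X x \<le> real s}. g x) + (\<Sum>x\<in>{x\<in>I2. X x \<le> real s}. g x)"
      for g :: "nat \<Rightarrow> real"
    proof -
      have "{x\<in>I. X x \<le> real s} = {x\<in>I1. X x \<le> real s} \<union> {x\<in>I2. X x \<le> real s}" using IU by auto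
      then show ?thesis
        using IU by (simp, intro sum.union_disjoint) (auto simp: I1_def I2_def)
    qed
    have "(\<Sum>x\<in>{x\<in>I. X x \<le> real s}. D x * (f x - f r)\<^sup>2) \<le>
        (1 + 1 / J) * (C * energy I1 E f) + (1 + J) * Q * (\<Sum>x\<in>{x\<in>I1. X x \<le> real s}. D x) +
        ((1 + 1 / J) * (C * energy I2 E f) + (1 + J) * Q * (\<Sum>x\<in>{x\<in>I2. X x \<le> real s}. D x))"
      unfolding split[of "\<lambda>x. D x * (f x - f r)\<^sup>2"]
      using half IU unfolding I1_def I2_def by (intro add_mono child) auto
    also have "\<dots> = (1 + 1 / J) * C * (energy I1 E f + energy I2 E f) + (1 + J) * Q * (\<Sum>x\<in>{x\<in>I. X x \<le> real s}. D x)"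
      unfolding split[of D] by (simp add: algebra_simps)
    also have "\<dots> \<le> (1 + 1 / J) * C * energy I E f + (1 + J) * Q * (real s * T)"
      using J A0 Q0 IU mass[OF Suc.prems(1,2)]
      by (intro add_mono mult_left_mono energy_superadditive) (auto simp: I_def C_def)
    also have "(1 + J) * Q * (real s * T) \<le> (1 + J) * (A * energy I E f)"
    proof -
      have "Q * (real s * T) = 32 * T ^ 5 * real s powr (\<gamma> - 1) * energy I E f"
        using \<open>s \<ge> 2\<close> by (simp add: Q_def eval_nat_numeral)
      also have "\<dots> \<le> 32 * T ^ 5 * real N powr (\<gamma> - 1) * energy I E f"
        using T gamma Suc.prems(2) by (intro mult_right_mono mult_left_mono energy_nonneg powr_mono2) auto
      also have "\<dots> \<le> A * energy I E f" using A1 by (intro mult_right_mono energy_nonneg)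
      finally have "(1 + J) * (Q * (real s * T)) \<le> (1 + J) * (A * energy I E f)"
        using J by (intro mult_left_mono) auto
      then show ?thesis by (simp add: mult_ac)
    qed
    also have "(1 + J) * (A * energy I E f) \<le> (1 + 1 / J) ^ Suc d * ((1 + J) * (A * energy I E f))"
    proof -
      have "0 \<le> (1 + J) * (A * energy I E f)" using J A0 energy_nonneg[of I E f] by simp
      then show ?thesis using mult_right_mono[OF pow1] by fastforce
    qed
    also have "(1 + 1 / J) * C * energy I E f + (1 + 1 / J) ^ Suc d * ((1 + J) * (A * energy I E f))
        = (1 + 1 / J) ^ Suc d * (1 + real (Suc d)) * (1 + J) * A * energy I E f"
    proof -
      have "C = (1 + 1 / J) ^ d * ((1 + real d) * ((1 + J) * A))" unfolding C_def by (simp only: mult.assoc)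
      moreover have "z * (p * (q * w)) * e + (z * p) * (w * e) = (z * p) * (q + 1) * w * e" for z p q w e :: real
        by algebra
      ultimately show ?thesis by (simp only: power_Suc of_nat_Suc mult.assoc add.commute[of 1])
    qed
    finally show ?thesis unfolding I_def by simp
  qed
qed

theorem hub_Poincare:
  fixes s0 d :: nat
  assumes s0: "s0 \<ge> 1" and large: "\<And>s. s > s0 \<Longrightarrow> 4 * T ^ 4 * real s powr (\<gamma> - 1) \<le> real s"
    and d: "d \<ge> 1" "N \<le> 2 ^ d" and N: "N \<ge> 1" and X_le: "\<And>x. x \<in> {1..N} \<Longrightarrow> X x \<le> real N"
  shows "\<exists>c. (\<Sum>x\<in>{1..N}. D x * (f x - c)\<^sup>2)
     \<le> 3 * (1 + real d)\<^sup>2 * (32 * T ^ 5 * real N powr (\<gamma> - 1) + (real s0)\<^sup>2 * T) * energy {1..N} E f"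
proof -
  define A where "A = 32 * T ^ 5 * real N powr (\<gamma> - 1) + (real s0)\<^sup>2 * T"
  have A: "A \<ge> 32 * T ^ 5 * real N powr (\<gamma> - 1)" "A \<ge> (real s0)\<^sup>2 * T" "A \<ge> 0"
    using T by (auto simp: A_def)
  have I: "{0<..0 + N} = {1..N}" by auto
  have N2: "N \<le> 2 ^ d * s0" using d s0 by (metis le_trans mult.right_neutral mult_le_mono2)
  obtain r where r: "r \<in> {0<..0 + N}" "real N \<le> T * X r powr \<gamma>" using hub[of N 0] N by auto
  have set_eq: "{x\<in>{0<..0 + N}. X x \<le> real N} = {1..N}" using X_le by auto
  have "(\<Sum>x\<in>{1..N}. D x * (f x - f r)\<^sup>2)
      \<le> (1 + 1 / real d) ^ d * (1 + real d) * (1 + real d) * A * energy {1..N} E f"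
    using interval_Poincare[OF s0 large _ A(1,2) N _ N2 r, of "real d" f] d unfolding set_eq unfolding I by simp
  also have "\<dots> \<le> 3 * (1 + real d) * (1 + real d) * A * energy {1..N} E f"
  proof (intro mult_right_mono energy_nonneg A)
    have "(1 + 1 / real d) ^ d \<le> exp (1 / real d) ^ d" by (intro power_mono) auto
    also have "\<dots> = exp 1" using d by (simp add: exp_of_nat_mult[symmetric])
    finally show "(1 + 1 / real d) ^ d \<le> 3" using exp_le by linarith
  qed auto
  finally have "(\<Sum>x\<in>{1..N}. D x * (f x - f r)\<^sup>2) \<le> 3 * (1 + real d)\<^sup>2 * A * energy {1..N} E f"
    by (simp only: power2_eq_square mult.assoc)
  then show ?thesis unfolding A_def by blast
qed

end

section \<open>Tail bounds for independent coordinates and independent edges\<close>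

locale iid_coordinates =
  fixes \<mu> :: "real measure" and I :: "'i set"
  assumes prob_mu: "prob_space \<mu>" and finite_I: "finite I" and sets_mu [measurable_cong]: "sets \<mu> = sets borel"
begin

abbreviation "M \<equiv> (\<Pi>\<^sub>M i\<in>I. \<mu>)"

lemma nn_integral_coordinates_prod:
  assumes "\<And>i. i \<in> I \<Longrightarrow> f i \<in> borel_measurable borel"
  shows "(\<integral>\<^sup>+ w. (\<Prod>i\<in>I. f i (w i)) \<partial>M) = (\<Prod>i\<in>I. integral\<^sup>N \<mu> (f i))"
proof -
  interpret product_sigma_finite "\<lambda>_. \<mu>"
    unfolding product_sigma_finite_def using prob_mu prob_space_imp_sigma_finite by blast
  have "f i \<in> borel_measurable \<mu>" if "i \<in> I" for i
    using assms[OF that] by measurable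
  then show ?thesis by (intro product_nn_integral_prod finite_I)
qed

lemma coordinate_measurable: "i \<in> I \<Longrightarrow> (\<lambda>w. w i) \<in> borel_measurable M"
  using measurable_component_singleton[of i I "\<lambda>_. \<mu>"] by (simp add: measurable_cong_sets[OF refl sets_mu])

lemma emeasure_mu_UNIV: "emeasure \<mu> (space \<mu>) = 1"
  using prob_mu by (simp add: prob_space.emeasure_space_1)

lemma space_mu: "space \<mu> = UNIV"
  using sets_eq_imp_space_eq[OF sets_mu] by simp

lemma nn_integral_coordinate_pair:
  fixes h k :: "real \<Rightarrow> ennreal"
  assumes xy: "x \<in> I" "y \<in> I" "x \<noteq> y" and [measurable]: "h \<in> borel_measurable borel" "k \<in> borel_measurable borel"
  shows "(\<integral>\<^sup>+ w. h (w x) * k (w y) \<partial>M) = integral\<^sup>N \<mu> h * integral\<^sup>N \<mu> k"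
proof -
  define f where "f = (\<lambda>i. if i = x then h else if i = y then k else (\<lambda>_. 1))"
  have pr: "(\<Prod>i\<in>I. F i) = F x * F y" if "\<And>i. i \<noteq> x \<Longrightarrow> i \<noteq> y \<Longrightarrow> F i = 1" for F :: "'i \<Rightarrow> ennreal"
  proof -
    have "(\<Prod>i\<in>I. F i) = (\<Prod>i\<in>{x, y}. F i)"
      using xy finite_I that by (intro prod.mono_neutral_right) auto
    then show ?thesis using xy by simp
  qed
  have "(\<integral>\<^sup>+ w. h (w x) * k (w y) \<partial>M) = (\<integral>\<^sup>+ w. (\<Prod>i\<in>I. f i (w i)) \<partial>M)"
    using xy by (subst pr) (auto simp: f_def)
  also have "\<dots> = (\<Prod>i\<in>I. integral\<^sup>N \<mu> (f i))"
    by (rule nn_integral_coordinates_prod) (simp add: f_def)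
  also have "\<dots> = integral\<^sup>N \<mu> h * integral\<^sup>N \<mu> k"
    using xy by (subst pr) (auto simp: f_def emeasure_mu_UNIV)
  finally show ?thesis .
qed

lemma all_coordinates_in:
  assumes J: "J \<subseteq> I" and B: "B \<in> sets borel"
  shows "{w \<in> space M. \<forall>i\<in>J. w i \<in> B} \<in> sets M"
    and "emeasure M {w \<in> space M. \<forall>i\<in>J. w i \<in> B} = emeasure \<mu> B ^ card J"
proof -
  have finJ: "finite J" using J finite_I finite_subset by blast
  have [measurable]: "(\<lambda>w. w i) \<in> borel_measurable M" if "i \<in> J" for i using J that by auto
  note [measurable] = B
  show meas: "{w \<in> space M. \<forall>i\<in>J. w i \<in> B} \<in> sets M"
    using finJ by measurable
  define f where "f = (\<lambda>i. if i \<in> J then indicator B else (\<lambda>_. 1 :: ennreal))"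
  have "emeasure M {w \<in> space M. \<forall>i\<in>J. w i \<in> B} = (\<integral>\<^sup>+ w. indicator {w \<in> space M. \<forall>i\<in>J. w i \<in> B} w \<partial>M)"
    using meas by simp
  also have "\<dots> = (\<integral>\<^sup>+ w. (\<Prod>i\<in>I. f i (w i)) \<partial>M)"
  proof (rule nn_integral_cong)
    fix w assume w: "w \<in> space M"
    show "indicator {w \<in> space M. \<forall>i\<in>J. w i \<in> B} w = (\<Prod>i\<in>I. f i (w i))"
    proof (cases "\<forall>i\<in>J. w i \<in> B")
      case True
      then have "(\<Prod>i\<in>I. f i (w i)) = 1" by (intro prod.neutral) (auto simp: f_def)
      then show ?thesis using w True by simp
    next
      case False
      then obtain j where "j \<in> J" "w j \<notin> B" by blast
      then have "(\<Prod>i\<in>I. f i (w i)) = 0"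
        using J by (intro prod_zero[OF finite_I] bexI[of _ j]) (auto simp: f_def)
      then show ?thesis using False by auto
    qed
  qed
  also have "\<dots> = (\<Prod>i\<in>I. integral\<^sup>N \<mu> (f i))"
    by (rule nn_integral_coordinates_prod) (simp add: f_def)
  also have "\<dots> = (\<Prod>i\<in>J. emeasure \<mu> B)"
    using J finite_I by (intro prod.mono_neutral_cong_right) (auto simp: f_def emeasure_mu_UNIV sets_mu)
  finally show "emeasure M {w \<in> space M. \<forall>i\<in>J. w i \<in> B} = emeasure \<mu> B ^ card J" by simp
qed

text \<open>
  Exponential Markov inequality, with \<open>e^z \<le> 1 + 2z\<close> on \<open>[0,1]\<close>. The variables need not
  be identically distributed; \<open>m\<close> bounds their means.
\<close>

lemma sum_upper_tail:
  fixes g :: "'i \<Rightarrow> real \<Rightarrow> real" and m :: "'i \<Rightarrow> real"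
  assumes meas: "\<And>i. i \<in> I \<Longrightarrow> g i \<in> borel_measurable borel"
    and g01: "\<And>i v. i \<in> I \<Longrightarrow> 0 \<le> g i v \<and> g i v \<le> 1"
    and m: "\<And>i. i \<in> I \<Longrightarrow> m i \<ge> 0" "\<And>i. i \<in> I \<Longrightarrow> (\<integral>\<^sup>+ v. ennreal (g i v) \<partial>\<mu>) \<le> ennreal (m i)"
  shows "{w \<in> space M. (\<Sum>i\<in>I. g i (w i)) \<ge> t} \<in> sets M"
    and "emeasure M {w \<in> space M. (\<Sum>i\<in>I. g i (w i)) \<ge> t} \<le> ennreal (exp (2 * (\<Sum>i\<in>I. m i) - t))"
proof -
  have G: "(\<lambda>w. g i (w i)) \<in> borel_measurable M" if "i \<in> I" for i
    using measurable_compose[OF coordinate_measurable[OF that] meas[OF that]] .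
  have F [measurable]: "(\<lambda>w. \<Sum>i\<in>I. g i (w i)) \<in> borel_measurable M"
    by (intro borel_measurable_sum G)
  show "{w \<in> space M. (\<Sum>i\<in>I. g i (w i)) \<ge> t} \<in> sets M"
    using F unfolding borel_measurable_iff_ge by blast
  have one: "(\<integral>\<^sup>+ v. ennreal (exp (g i v)) \<partial>\<mu>) \<le> ennreal (exp (2 * m i))" if i: "i \<in> I" for i
  proof -
    have [measurable]: "g i \<in> borel_measurable \<mu>" using meas[OF i] by (simp add: measurable_cong_sets[OF sets_mu refl])
    have "(\<integral>\<^sup>+ v. ennreal (exp (g i v)) \<partial>\<mu>) \<le> (\<integral>\<^sup>+ v. 1 + ennreal 2 * ennreal (g i v) \<partial>\<mu>)"
    proof (rule nn_integral_mono)
      fix v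
      have g: "0 \<le> g i v" "g i v \<le> 1" using g01[OF i] by auto
      have "exp (g i v) \<le> 1 + g i v + (g i v)\<^sup>2" using g by (intro exp_bound)
      also have "\<dots> \<le> 1 + 2 * g i v" using g by (simp add: power2_eq_square mult_left_le)
      finally have "ennreal (exp (g i v)) \<le> ennreal (1 + 2 * g i v)" by (rule ennreal_leI)
      also have "\<dots> = 1 + ennreal 2 * ennreal (g i v)"
        using g by (simp add: ennreal_plus ennreal_mult)
      finally show "ennreal (exp (g i v)) \<le> 1 + ennreal 2 * ennreal (g i v)" .
    qed
    also have "\<dots> = 1 + ennreal 2 * (\<integral>\<^sup>+ v. ennreal (g i v) \<partial>\<mu>)"
      by (simp add: nn_integral_add nn_integral_cmult emeasure_mu_UNIV)
    also have "\<dots> \<le> 1 + ennreal 2 * ennreal (m i)"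
      by (intro add_left_mono mult_left_mono m i) auto
    also have "\<dots> = ennreal (1 + 2 * m i)" using m(1)[OF i] by (simp add: ennreal_plus ennreal_mult)
    also have "\<dots> \<le> ennreal (exp (2 * m i))" by (intro ennreal_leI) (rule exp_ge_add_one_self)
    finally show ?thesis .
  qed
  have "emeasure M {w \<in> space M. (\<Sum>i\<in>I. g i (w i)) \<ge> t} \<le>
      ennreal (exp (- 1 * t)) * (\<integral>\<^sup>+ w. ennreal (exp (1 * (\<Sum>i\<in>I. g i (w i)))) * indicator (space M) w \<partial>M)"
    by (intro Chernoff_ineq_nn_integral_ge) auto
  also have "(\<integral>\<^sup>+ w. ennreal (exp (1 * (\<Sum>i\<in>I. g i (w i)))) * indicator (space M) w \<partial>M)
      = (\<integral>\<^sup>+ w. (\<Prod>i\<in>I. ennreal (exp (g i (w i)))) \<partial>M)"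
    using finite_I by (intro nn_integral_cong) (simp add: exp_sum prod_ennreal)
  also have "\<dots> = (\<Prod>i\<in>I. \<integral>\<^sup>+ v. ennreal (exp (g i v)) \<partial>\<mu>)"
    by (rule nn_integral_coordinates_prod) (use meas in measurable)
  also have "\<dots> \<le> (\<Prod>i\<in>I. ennreal (exp (2 * m i)))"
    by (intro prod_mono_ennreal one)
  also have "\<dots> = ennreal (exp (2 * (\<Sum>i\<in>I. m i)))"
    using finite_I by (simp add: exp_sum prod_ennreal sum_distrib_left)
  also have "ennreal (exp (- 1 * t)) * \<dots> = ennreal (exp (2 * (\<Sum>i\<in>I. m i) - t))"
    by (simp add: ennreal_mult[symmetric] exp_add[symmetric])
  finally show "emeasure M {w \<in> space M. (\<Sum>i\<in>I. g i (w i)) \<ge> t} \<le> ennreal (exp (2 * (\<Sum>i\<in>I. m i) - t))"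
    by (simp add: mult_left_mono)
qed

end

lemma expectation_bernoulli:
  fixes f :: "bool \<Rightarrow> real"
  assumes "0 \<le> p" "p \<le> 1"
  shows "measure_pmf.expectation (bernoulli_pmf p) f = p * f True + (1 - p) * f False"
  using assms by simp

text \<open>
  The same exponential Markov inequality for Bernoulli variables.
\<close>

lemma Pi_pmf_sum_upper_tail:
  fixes p :: "'e \<Rightarrow> real"
  assumes fin: "finite S" and A: "A \<subseteq> S" and p: "\<And>e. e \<in> S \<Longrightarrow> 0 \<le> p e \<and> p e \<le> 1"
  shows "measure_pmf.prob (Pi_pmf S False (\<lambda>e. bernoulli_pmf (p e))) {g. (\<Sum>e\<in>A. of_bool (g e)) \<ge> t}
     \<le> exp (2 * (\<Sum>e\<in>A. p e) - t)"
proof -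
  define Q where "Q = Pi_pmf S False (\<lambda>e. bernoulli_pmf (p e))"
  define f where "f = (\<lambda>e b. if e \<in> A then exp (of_bool b :: real) else 1)"
  have finA: "finite A" using A fin finite_subset by blast
  have fprod: "(\<Prod>e\<in>S. f e (g e)) = exp (\<Sum>e\<in>A. of_bool (g e))" for g
  proof -
    have "(\<Prod>e\<in>S. f e (g e)) = (\<Prod>e\<in>A. exp (of_bool (g e)))"
      using A fin by (intro prod.mono_neutral_cong_right) (auto simp: f_def)
    then show ?thesis by (simp only: exp_sum[OF finA])
  qed
  have E: "measure_pmf.expectation Q (\<lambda>g. exp (\<Sum>e\<in>A. of_bool (g e))) \<le> exp (2 * (\<Sum>e\<in>A. p e))"
  proof -
    have "measure_pmf.expectation Q (\<lambda>g. exp (\<Sum>e\<in>A. of_bool (g e)))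
        = (\<Prod>e\<in>S. measure_pmf.expectation (bernoulli_pmf (p e)) (f e))"
      unfolding Q_def fprod[symmetric]
      by (intro expectation_prod_Pi_pmf fin) (auto simp: f_def intro!: integrable_measure_pmf_finite)
    also have "\<dots> = (\<Prod>e\<in>A. p e * exp 1 + (1 - p e))"
      using A fin p by (intro prod.mono_neutral_cong_right)
        (auto simp: f_def expectation_bernoulli subset_iff)
    also have "\<dots> \<le> (\<Prod>e\<in>A. exp (2 * p e))"
    proof (intro prod_mono conjI)
      fix e assume e: "e \<in> A"
      then have pe: "0 \<le> p e" "p e \<le> 1" using p A by auto
      then show "0 \<le> p e * exp 1 + (1 - p e)" by simp
      have "p e * exp 1 \<le> p e * 3" using pe exp_le by (intro mult_left_mono) auto
      then have "p e * exp 1 + (1 - p e) \<le> 1 + 2 * p e" by linarith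
      also have "\<dots> \<le> exp (2 * p e)" by (rule exp_ge_add_one_self)
      finally show "p e * exp 1 + (1 - p e) \<le> exp (2 * p e)" .
    qed
    also have "\<dots> = exp (2 * (\<Sum>e\<in>A. p e))" using finA by (simp add: exp_sum sum_distrib_left)
    finally show ?thesis .
  qed
  have bnd: "(\<Sum>e\<in>A. of_bool (g e)) \<le> real (card A)" for g :: "'e \<Rightarrow> bool"
    using sum_mono[of A "\<lambda>e. of_bool (g e)" "\<lambda>_. 1 :: real"] by simp
  have int: "integrable (measure_pmf Q) (\<lambda>g. exp (\<Sum>e\<in>A. of_bool (g e) :: real))"
    by (rule measure_pmf.integrable_const_bound[where B = "exp (real (card A))"]) (use bnd in auto)
  have "measure_pmf.prob Q {g \<in> space (measure_pmf Q). exp (\<Sum>e\<in>A. of_bool (g e)) \<ge> exp t}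
      \<le> measure_pmf.expectation Q (\<lambda>g. exp (\<Sum>e\<in>A. of_bool (g e))) / exp t"
    by (rule integral_Markov_inequality_measure[OF int, where A = "{}"]) auto
  also have "\<dots> \<le> exp (2 * (\<Sum>e\<in>A. p e)) / exp t" using E by (intro divide_right_mono) auto
  finally show ?thesis unfolding Q_def by (simp add: exp_diff)
qed

lemma Pi_pmf_sum_Markov:
  fixes p :: "'e \<Rightarrow> real"
  assumes fin: "finite S" and A: "A \<subseteq> S" and p: "\<And>e. e \<in> S \<Longrightarrow> 0 \<le> p e \<and> p e \<le> 1" and t: "t > 0"
  shows "measure_pmf.prob (Pi_pmf S False (\<lambda>e. bernoulli_pmf (p e))) {g. (\<Sum>e\<in>A. of_bool (g e)) \<ge> t}
     \<le> (\<Sum>e\<in>A. p e) / t"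
proof -
  define Q where "Q = Pi_pmf S False (\<lambda>e. bernoulli_pmf (p e))"
  have one: "measure_pmf.expectation Q (\<lambda>g. of_bool (g e)) = p e" if "e \<in> A" for e
  proof -
    have "measure_pmf.expectation Q (\<lambda>g. of_bool (g e)) = measure_pmf.expectation (map_pmf (\<lambda>g. g e) Q) (of_bool :: bool \<Rightarrow> real)"
      by simp
    also have "map_pmf (\<lambda>g. g e) Q = bernoulli_pmf (p e)"
      unfolding Q_def using that A by (subst Pi_pmf_component[OF fin]) auto
    finally show ?thesis using that A p by (simp add: expectation_bernoulli subset_iff)
  qed
  have int1: "integrable (measure_pmf Q) (\<lambda>g. of_bool (g e) :: real)" for e
    by (rule measure_pmf.integrable_const_bound[where B = 1]) auto
  have int: "integrable (measure_pmf Q) (\<lambda>g. (\<Sum>e\<in>A. of_bool (g e) :: real))"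
    using int1 by auto
  have "measure_pmf.prob Q {g \<in> space (measure_pmf Q). (\<Sum>e\<in>A. of_bool (g e)) \<ge> t}
      \<le> measure_pmf.expectation Q (\<lambda>g. (\<Sum>e\<in>A. of_bool (g e))) / t"
    using t by (intro integral_Markov_inequality_measure[OF int, where A = "{}"]) (auto intro!: sum_nonneg)
  also have "measure_pmf.expectation Q (\<lambda>g. (\<Sum>e\<in>A. of_bool (g e))) = (\<Sum>e\<in>A. p e)"
    using int1 one by simp
  finally show ?thesis unfolding Q_def by simp
qed

lemma Pi_pmf_closed:
  assumes fin: "finite S" and e: "e \<in> S" and p: "0 \<le> p e" "p e \<le> 1"
  shows "measure_pmf.prob (Pi_pmf S False (\<lambda>e. bernoulli_pmf (p e))) {g. \<not> g e} = 1 - p e"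
proof -
  let ?Q = "Pi_pmf S False (\<lambda>e. bernoulli_pmf (p e))"
  have "measure_pmf.prob ?Q {g. \<not> g e} = measure_pmf.prob (map_pmf (\<lambda>g. g e) ?Q) {False}"
    by (simp add: vimage_def)
  also have "map_pmf (\<lambda>g. g e) ?Q = bernoulli_pmf (p e)"
    using e by (subst Pi_pmf_component[OF fin]) auto
  finally show ?thesis using p by (simp add: measure_pmf_single)
qed

lemma emeasure_finite_union_le:
  assumes "finite S" and A: "\<And>i. i \<in> S \<Longrightarrow> A i \<in> sets M \<and> emeasure M (A i) \<le> ennreal e"
    and e: "e \<ge> 0" and n: "real (card S) \<le> n"
  shows "(\<Union>i\<in>S. A i) \<in> sets M" "emeasure M (\<Union>i\<in>S. A i) \<le> ennreal (n * e)"
proof -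
  show "(\<Union>i\<in>S. A i) \<in> sets M" using assms by (intro sets.finite_UN) auto
  have "emeasure M (\<Union>i\<in>S. A i) \<le> (\<Sum>i\<in>S. emeasure M (A i))"
    using assms by (intro emeasure_subadditive_finite) auto
  also have "\<dots> \<le> (\<Sum>i\<in>S. ennreal e)" using A by (intro sum_mono) auto
  also have "\<dots> = ennreal (real (card S) * e)"
    using e by (simp add: ennreal_of_nat_eq_real_of_nat ennreal_mult[symmetric])
  also have "\<dots> \<le> ennreal (n * e)" using n e by (intro ennreal_leI mult_right_mono)
  finally show "emeasure M (\<Union>i\<in>S. A i) \<le> ennreal (n * e)" .
qed

section \<open>Moments of the Pareto law and sums over the line\<close>

lemma pareto_tail:
  assumes "\<tau> > 1" "u \<ge> 1"
  shows "emeasure (pareto \<tau>) {v. u \<le> v powr (\<tau> - 1) \<and> 1 \<le> v} = ennreal (1 / u)"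
proof -
  interpret prob_space "pareto \<tau>" by (rule prob_space_pareto[OF assms(1)])
  define v0 where "v0 = u powr (1 / (\<tau> - 1))"
  have v0: "v0 \<ge> 1" unfolding v0_def using assms by (intro ge_one_powr_ge_zero) auto
  have v0u: "v0 powr (\<tau> - 1) = u" using assms by (simp add: v0_def powr_powr)
  have "{v. u \<le> v powr (\<tau> - 1) \<and> 1 \<le> v} = {v0..}"
  proof (intro set_eqI iffI)
    fix v assume v: "v \<in> {v. u \<le> v powr (\<tau> - 1) \<and> 1 \<le> v}"
    then have "v0 powr (\<tau> - 1) \<le> v powr (\<tau> - 1)" by (simp add: v0u)
    then show "v \<in> {v0..}" using v v0 assms powr_less_mono2[of "\<tau> - 1" v v0] by fastforce
  next
    fix v assume v: "v \<in> {v0..}"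
    then have "v0 powr (\<tau> - 1) \<le> v powr (\<tau> - 1)" using v0 assms by (intro powr_mono2) auto
    then show "v \<in> {v. u \<le> v powr (\<tau> - 1) \<and> 1 \<le> v}" using v v0 by (simp add: v0u)
  qed
  then have "emeasure (pareto \<tau>) {v. u \<le> v powr (\<tau> - 1) \<and> 1 \<le> v} = ennreal (v0 powr (- (\<tau> - 1)))"
    using v0 measure_pareto_tail[OF assms(1), of v0] by (simp add: emeasure_eq_measure)
  also have "v0 powr (- (\<tau> - 1)) = 1 / u" using v0u by (metis powr_minus inverse_eq_divide)
  finally show ?thesis .
qed

text \<open>
  The variable \<open>v^(\<tau>-1)\<close> is Pareto with exponent 1, so each dyadic range \<open>[2^k, 2^(k+1)]\<close> contributes at
  most 2 to the mean. The mean itself is infinite; truncation makes it logarithmic.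
\<close>

lemma pareto_truncated_moment:
  assumes \<tau>: "\<tau> > 1" and R: "R powr (\<tau> - 1) \<le> 2 ^ K"
  shows "(\<integral>\<^sup>+ v. ennreal (v powr (\<tau> - 1) * indicator {1..R} v) \<partial>pareto \<tau>) \<le> ennreal (2 * (real K + 1))"
proof -
  define S where "S = (\<lambda>k::nat. {v::real. 2 ^ k \<le> v powr (\<tau> - 1) \<and> 1 \<le> v})"
  have [measurable]: "S k \<in> sets borel" for k unfolding S_def by measurable
  have pt: "v powr (\<tau> - 1) * indicator {1..R} v \<le> (\<Sum>k\<le>K. 2 ^ Suc k * indicator (S k) v)" for v :: real
  proof (cases "v \<in> {1..R}")
    case True
    define z where "z = v powr (\<tau> - 1)"
    have z1: "z \<ge> 1" unfolding z_def using True \<tau> by (intro ge_one_powr_ge_zero) auto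
    have zK: "z \<le> 2 ^ K" using R True \<tau> powr_mono2[of "\<tau> - 1" v R] unfolding z_def by auto
    define k where "k = (GREATEST k. 2 ^ k \<le> z)"
    have bd: "\<forall>j. 2 ^ j \<le> z \<longrightarrow> j \<le> K"
    proof (intro allI impI)
      fix j :: nat assume "2 ^ j \<le> z"
      then have "(2::real) ^ j \<le> 2 ^ K" using zK by linarith
      then show "j \<le> K" by simp
    qed
    have k: "2 ^ k \<le> z" unfolding k_def by (rule GreatestI_nat[where k = 0 and b = K]) (use z1 bd in auto)
    have k': "\<not> 2 ^ Suc k \<le> z"
    proof
      assume "2 ^ Suc k \<le> z"
      then have "Suc k \<le> k" unfolding k_def by (rule Greatest_le_nat[where b = K]) (use bd in auto)
      then show False by simp
    qed
    have "k \<le> K" using bd k by blast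
    have "z \<le> 2 ^ Suc k * indicator (S k) v" using k k' True unfolding S_def z_def by simp
    also have "\<dots> \<le> (\<Sum>k\<le>K. 2 ^ Suc k * indicator (S k) v)"
      using \<open>k \<le> K\<close> by (intro member_le_sum) auto
    finally show ?thesis using True by (simp add: z_def)
  next
    case False then show ?thesis by (auto intro!: sum_nonneg)
  qed
  have "(\<integral>\<^sup>+ v. ennreal (v powr (\<tau> - 1) * indicator {1..R} v) \<partial>pareto \<tau>)
      \<le> (\<integral>\<^sup>+ v. (\<Sum>k\<le>K. ennreal (2 ^ Suc k) * indicator (S k) v) \<partial>pareto \<tau>)"
  proof (rule nn_integral_mono)
    fix v :: real
    have "ennreal (v powr (\<tau> - 1) * indicator {1..R} v) \<le> ennreal (\<Sum>k\<le>K. 2 ^ Suc k * indicator (S k) v)"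
      by (intro ennreal_leI pt)
    also have "\<dots> = (\<Sum>k\<le>K. ennreal (2 ^ Suc k * indicator (S k) v))"
      by (rule sum_ennreal[symmetric]) auto
    also have "\<dots> = (\<Sum>k\<le>K. ennreal (2 ^ Suc k) * indicator (S k) v)"
      by (intro sum.cong refl) (auto simp: indicator_def)
    finally show "ennreal (v powr (\<tau> - 1) * indicator {1..R} v) \<le> (\<Sum>k\<le>K. ennreal (2 ^ Suc k) * indicator (S k) v)" .
  qed
  also have "\<dots> = (\<Sum>k\<le>K. ennreal (2 ^ Suc k) * emeasure (pareto \<tau>) (S k))"
    by (subst nn_integral_sum) (auto simp: nn_integral_cmult_indicator)
  also have "\<dots> = (\<Sum>k\<le>K. ennreal 2)"
  proof (intro sum.cong refl)
    fix k
    show "ennreal (2 ^ Suc k) * emeasure (pareto \<tau>) (S k) = ennreal 2"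
      unfolding S_def by (subst pareto_tail[OF \<tau>]) (auto simp: ennreal_mult[symmetric] simp del: ennreal_power ennreal_numeral)
  qed
  also have "\<dots> = ennreal (2 * (real K + 1))"
    by (simp add: ennreal_of_nat_eq_real_of_nat ennreal_mult[symmetric] mult.commute algebra_simps flip: ennreal_numeral)
  finally show ?thesis .
qed

lemma harmonic_sum_le:
  assumes "n \<ge> 1"
  shows "(\<Sum>k\<in>{1..n}. 1 / real k) \<le> 1 + ln (real n)"
  using assms
proof (induction n rule: dec_induct)
  case base then show ?case by simp
next
  case (step n)
  have n: "real n > 0" using step by simp
  have "ln (real n / real (Suc n)) \<le> real n / real (Suc n) - 1" using n by (intro ln_le_minus_one) auto
  also have "\<dots> = - (1 / real (Suc n))" by (simp add: field_simps)
  finally have "1 / real (Suc n) \<le> ln (real (Suc n)) - ln (real n)" using n by (simp add: ln_div)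
  moreover have "(\<Sum>k\<in>{1..Suc n}. 1 / real k) = (\<Sum>k\<in>{1..n}. 1 / real k) + 1 / real (Suc n)"
    by simp
  ultimately show ?case using step.IH by linarith
qed

lemma sum_le_inj_image:
  fixes f :: "nat \<Rightarrow> real"
  assumes "finite B" "inj_on \<phi> A" "\<phi> ` A \<subseteq> B" "\<And>k. k \<in> B \<Longrightarrow> f k \<ge> 0"
  shows "(\<Sum>x\<in>A. f (\<phi> x)) \<le> (\<Sum>k\<in>B. f k)"
proof -
  have "(\<Sum>x\<in>A. f (\<phi> x)) = (\<Sum>k\<in>\<phi> ` A. f k)" using assms(2) by (simp add: sum.reindex)
  also have "\<dots> \<le> (\<Sum>k\<in>B. f k)" using assms by (intro sum_mono2) auto
  finally show ?thesis .
qed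

section \<open>Typical weights\<close>

text \<open>
  The lower bound on \<open>N\<close> gives \<open>log N \<ge> 1\<close>, so that constants can be absorbed into powers of the logarithm.
\<close>

locale sfp_parameters =
  fixes N :: nat and \<alpha> \<tau> \<gamma> :: real
  assumes alpha: "\<alpha> > 0" and tau: "1 < \<tau>" "\<tau> < 2"
    and gamma_eq: "\<gamma> = \<alpha> * (\<tau> - 1)" and gamma: "1 < \<gamma>" "\<gamma> < 2" and N3: "N \<ge> 3"
begin

abbreviation "L \<equiv> ln (real N)"
abbreviation "X v \<equiv> v powr (1 / \<alpha>)"
abbreviation "R \<equiv> real N powr \<alpha>"
abbreviation "tdist \<equiv> torus_dist N"
abbreviation "moment_fun v \<equiv> v powr (\<tau> - 1) * indicator {1..R} v"

sublocale iid_coordinates "pareto \<tau>" "torus N"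
proof (rule iid_coordinates.intro)
  show "prob_space (pareto \<tau>)" by (rule prob_space_pareto[OF tau(1)])
  show "finite (torus N)" by (simp add: torus_def)
  show "sets (pareto \<tau>) = sets borel" by (rule sets_pareto)
qed

lemma L_ge_1: "L \<ge> 1"
proof -
  have "exp 1 \<le> real N" using exp_le N3 by linarith
  then have "ln (exp 1) \<le> L" by (subst ln_le_cancel_iff) (use N3 in auto)
  then show ?thesis by simp
qed

lemma alpha_gt_gamma: "\<gamma> < \<alpha>" "1 < \<alpha>"
proof -
  have "\<alpha> * (\<tau> - 1) < \<alpha> * 1" using alpha tau by (intro mult_strict_left_mono) auto
  then show "\<gamma> < \<alpha>" by (simp add: gamma_eq)
  then show "1 < \<alpha>" using gamma by linarith
qed

lemma X_powr: "v \<ge> 0 \<Longrightarrow> X v powr \<gamma> = v powr (\<tau> - 1)" "v \<ge> 0 \<Longrightarrow> X v powr \<alpha> = v"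
  using alpha by (simp_all add: powr_powr gamma_eq)

lemma X_ge_1: "v \<ge> 1 \<Longrightarrow> X v \<ge> 1"
  using alpha by (intro ge_one_powr_ge_zero) auto

lemma X_mono: "0 \<le> u \<Longrightarrow> u \<le> v \<Longrightarrow> X u \<le> X v"
  using alpha by (intro powr_mono2) auto

lemma X_R: "X (real s powr \<alpha>) = real s"
  using alpha by (simp add: powr_powr)

lemma X_le_N: "0 \<le> v \<Longrightarrow> v \<le> R \<Longrightarrow> X v \<le> real N"
  using X_mono[of v R] X_R[of N] by simp

text \<open>
  All means below are estimated by this one: for \<open>v\<close> in the truncation range, \<open>v powr (\<tau> - 1)\<close> dominates
  the degree scale \<open>X v\<close> and, by \<open>edge_prob_le\<close>, controls the connection probabilities.
\<close>

lemma truncated_moment: "(\<integral>\<^sup>+ v. ennreal (moment_fun v) \<partial>pareto \<tau>) \<le> ennreal (10 * L)"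
proof -
  define K where "K = nat \<lceil>2 * log 2 (real N)\<rceil>"
  have N: "real N \<ge> 3" using N3 by simp
  have l2: "log 2 (real N) \<le> 3 / 2 * L"
  proof -
    have "L / ln 2 \<le> L / (2 / 3)" using ln2_ge_two_thirds L_ge_1 by (intro divide_left_mono) auto
    then show ?thesis by (simp add: log_def)
  qed
  have l0: "log 2 (real N) \<ge> 0" using N by simp
  have "R powr (\<tau> - 1) = real N powr \<gamma>" by (simp add: powr_powr gamma_eq)
  also have "\<dots> \<le> real N powr 2" using N gamma by (intro powr_mono) auto
  also have "\<dots> = (2 powr log 2 (real N)) powr 2" using N by simp
  also have "\<dots> = 2 powr (2 * log 2 (real N))" by (simp only: powr_powr mult.commute)
  also have "\<dots> \<le> 2 powr real K" unfolding K_def by (intro powr_mono real_nat_ceiling_ge) auto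
  also have "\<dots> = 2 ^ K" by (simp add: powr_realpow)
  finally have "(\<integral>\<^sup>+ v. ennreal (moment_fun v) \<partial>pareto \<tau>) \<le> ennreal (2 * (real K + 1))"
    using tau by (intro pareto_truncated_moment) auto
  also have "\<dots> \<le> ennreal (10 * L)"
  proof (rule ennreal_leI)
    have "real K \<le> 2 * log 2 (real N) + 1" unfolding K_def using l0 by linarith
    also have "\<dots> \<le> 3 * L + 1" using l2 by (simp add: field_simps)
    finally show "2 * (real K + 1) \<le> 10 * L" using L_ge_1 by (simp add: field_simps)
  qed
  finally show ?thesis .
qed

lemma torus_dist_props:
  assumes "x \<in> torus N" "y \<in> torus N" "x \<noteq> y"
  shows "1 \<le> tdist x y" "tdist x y \<le> \<bar>real x - real y\<bar>"
    "tdist x y = \<bar>real x - real y\<bar> \<or> tdist x y = real N - \<bar>real x - real y\<bar>"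
proof -
  have "1 \<le> \<bar>real x - real y\<bar>" "\<bar>real x - real y\<bar> \<le> real N - 1"
    using assms by (auto simp: torus_def abs_real_def)
  then show "1 \<le> tdist x y" "tdist x y \<le> \<bar>real x - real y\<bar>"
    "tdist x y = \<bar>real x - real y\<bar> \<or> tdist x y = real N - \<bar>real x - real y\<bar>"
    by (auto simp: torus_dist_def min_def)
qed

lemma torus_dist_succ:
  assumes "x \<in> torus N" "y = torus_succ N x \<or> x = torus_succ N y" "y \<in> torus N"
  shows "tdist x y = 1"
  using assms N3 by (auto simp: torus_dist_def torus_succ_def torus_def split: if_splits)

lemma torus_dist_commute: "tdist x y = tdist y x"
  by (simp add: torus_dist_def abs_minus_commute)

lemma edge_prob_commute: "edge_prob N \<alpha> w x y = edge_prob N \<alpha> w y x"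
  by (auto simp: edge_prob_def torus_dist_commute mult.commute)

lemma edge_prob_01:
  assumes "0 \<le> w x" "0 \<le> w y"
  shows "0 \<le> edge_prob N \<alpha> w x y" "edge_prob N \<alpha> w x y \<le> 1"
  using assms by (auto simp: edge_prob_def)

text \<open>
  From \<open>1 - exp (-u) \<le> min 1 u \<le> u^(\<tau>-1)\<close>, which uses \<open>\<tau> < 2\<close>. The bound factorises over the endpoints
  and covers the edges between consecutive vertices as well, since these have distance 1 and both weights
  are at least 1.
\<close>

lemma edge_prob_le:
  assumes "x \<in> torus N" "y \<in> torus N" "x \<noteq> y" and w: "1 \<le> w x" "1 \<le> w y"
  shows "edge_prob N \<alpha> w x y \<le> w x powr (\<tau> - 1) * w y powr (\<tau> - 1) / tdist x y powr \<gamma>"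
proof (cases "y = torus_succ N x \<or> x = torus_succ N y")
  case True
  then have "tdist x y = 1" using assms by (intro torus_dist_succ) auto
  moreover have "1 * 1 \<le> w x powr (\<tau> - 1) * w y powr (\<tau> - 1)"
    using w tau by (intro mult_mono ge_one_powr_ge_zero) auto
  ultimately show ?thesis using True by (auto simp: edge_prob_def)
next
  case False
  note d = torus_dist_props[OF assms(1-3)]
  define u where "u = w x * w y / tdist x y powr \<alpha>"
  have u: "u \<ge> 0" using w by (simp add: u_def)
  have "1 - exp (- u) \<le> u powr (\<tau> - 1)"
  proof (cases "u \<ge> 1")
    case True
    then have "u powr (\<tau> - 1) \<ge> 1" using tau by (intro ge_one_powr_ge_zero) auto
    then show ?thesis using exp_gt_zero[of "- u"] by linarith
  next
    case False
    have "1 - exp (- u) \<le> u" using exp_ge_add_one_self[of "- u"] by linarith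
    also have "u \<le> u powr (\<tau> - 1)"
      using powr_mono'[of "\<tau> - 1" 1 u] False u tau by simp
    finally show ?thesis .
  qed
  also have "u powr (\<tau> - 1) = w x powr (\<tau> - 1) * w y powr (\<tau> - 1) / tdist x y powr \<gamma>"
    using w d(1) by (simp add: u_def powr_divide powr_mult powr_powr gamma_eq)
  finally show ?thesis using False by (simp add: edge_prob_def u_def)
qed

lemma sum_inverse_dist:
  assumes x: "x \<in> torus N"
  shows "(\<Sum>y\<in>torus N - {x}. 1 / tdist x y) \<le> 8 * L"
proof -
  let ?f = "\<lambda>k::nat. 1 / real k"
  define H where "H = (\<Sum>k\<in>{1..N}. ?f k)"
  have H: "H \<le> 2 * L" unfolding H_def using harmonic_sum_le[of N] L_ge_1 N3 by linarith
  have x1: "1 \<le> x" "x \<le> N" using x by (auto simp: torus_def)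
  define Q where "Q = (\<lambda>(\<phi> :: nat \<Rightarrow> nat) A. (\<Sum>y\<in>A. ?f (\<phi> y)))"
  have Q: "Q \<phi> A \<le> H" if "inj_on \<phi> A" "\<phi> ` A \<subseteq> {1..N}" for \<phi> :: "nat \<Rightarrow> nat" and A
    unfolding Q_def H_def using that by (intro sum_le_inj_image) auto
  have split: "torus N - {x} = {1..<x} \<union> {x<..N}" using x1 by (auto simp: torus_def)
  have pt: "1 / tdist x y \<le> 1 / \<bar>real x - real y\<bar> + 1 / (real N - \<bar>real x - real y\<bar>)"
    if y: "y \<in> torus N - {x}" for y
  proof -
    have "1 \<le> \<bar>real x - real y\<bar>" "\<bar>real x - real y\<bar> \<le> real N - 1"
      using y x by (auto simp: torus_def abs_real_def)
    then show ?thesis using torus_dist_props(3)[of x y] x y by auto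
  qed
  have "(\<Sum>y\<in>torus N - {x}. 1 / tdist x y)
      \<le> (\<Sum>y\<in>torus N - {x}. 1 / \<bar>real x - real y\<bar> + 1 / (real N - \<bar>real x - real y\<bar>))"
    by (intro sum_mono pt)
  also have "\<dots> = (\<Sum>y\<in>{1..<x}. 1 / \<bar>real x - real y\<bar> + 1 / (real N - \<bar>real x - real y\<bar>)) +
      (\<Sum>y\<in>{x<..N}. 1 / \<bar>real x - real y\<bar> + 1 / (real N - \<bar>real x - real y\<bar>))"
    unfolding split by (intro sum.union_disjoint) auto
  also have "\<dots> = Q (\<lambda>y. x - y) {1..<x} + Q (\<lambda>y. N - (x - y)) {1..<x} +
      (Q (\<lambda>y. y - x) {x<..N} + Q (\<lambda>y. N - (y - x)) {x<..N})"
  proof -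
    have "(\<Sum>y\<in>{1..<x}. 1 / \<bar>real x - real y\<bar> + 1 / (real N - \<bar>real x - real y\<bar>))
        = Q (\<lambda>y. x - y) {1..<x} + Q (\<lambda>y. N - (x - y)) {1..<x}"
      unfolding Q_def sum.distrib[symmetric] using x1 by (intro sum.cong refl) (simp add: of_nat_diff)
    moreover have "(\<Sum>y\<in>{x<..N}. 1 / \<bar>real x - real y\<bar> + 1 / (real N - \<bar>real x - real y\<bar>))
        = Q (\<lambda>y. y - x) {x<..N} + Q (\<lambda>y. N - (y - x)) {x<..N}"
      unfolding Q_def sum.distrib[symmetric] using x1 by (intro sum.cong refl) (simp add: of_nat_diff)
    ultimately show ?thesis by simp
  qed
  also have "\<dots> \<le> H + H + (H + H)"
    using x1 by (intro add_mono Q) (auto simp: inj_on_def)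
  finally show ?thesis using H by linarith
qed

text \<open>
  If \<open>a\<close> and \<open>b\<close> are the distances of the endpoints to the boundary point, the distance between the
  endpoints is at least \<open>max a b\<close>, so its power \<open>-\<gamma>\<close> is at most \<open>a^(-\<gamma>/2) b^(-\<gamma>/2)\<close> and the double sum
  splits into a product. The torus has two boundary points, hence the two summands.
\<close>

lemma sum_dist_cut:
  assumes h: "1 \<le> h" "h < N"
  shows "(\<Sum>x\<in>{1..h}. \<Sum>y\<in>{h<..N}. 1 / tdist x y powr \<gamma>) \<le> 8 * L\<^sup>2 * real N powr (2 - \<gamma>)"
proof -
  let ?f = "\<lambda>k::nat. real k powr (- (\<gamma> / 2))"
  define H where "H = (\<Sum>k\<in>{1..N}. ?f k)"
  have H0: "H \<ge> 0" unfolding H_def by (intro sum_nonneg) auto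
  have "H \<le> (\<Sum>k\<in>{1..N}. real N powr (1 - \<gamma> / 2) * (1 / real k))"
    unfolding H_def
  proof (rule sum_mono)
    fix k assume k: "k \<in> {1..N}"
    have "?f k = real k powr (1 - \<gamma> / 2) * (1 / real k)"
      using k powr_add[of "real k" "1 - \<gamma> / 2" "- 1"] by (simp add: powr_minus_divide)
    also have "\<dots> \<le> real N powr (1 - \<gamma> / 2) * (1 / real k)"
      using k gamma by (intro mult_right_mono powr_mono2) auto
    finally show "?f k \<le> real N powr (1 - \<gamma> / 2) * (1 / real k)" .
  qed
  also have "\<dots> = real N powr (1 - \<gamma> / 2) * (\<Sum>k\<in>{1..N}. 1 / real k)" by (simp add: sum_distrib_left)
  also have "\<dots> \<le> real N powr (1 - \<gamma> / 2) * (2 * L)"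
    using harmonic_sum_le[of N] L_ge_1 N3 by (intro mult_left_mono) auto
  finally have "H\<^sup>2 \<le> (real N powr (1 - \<gamma> / 2) * (2 * L))\<^sup>2" using H0 by (intro power_mono) auto
  also have "\<dots> = 4 * L\<^sup>2 * real N powr (2 - \<gamma>)"
  proof -
    have "(real N powr (1 - \<gamma> / 2))\<^sup>2 = real N powr (2 - \<gamma>)"
      unfolding power2_eq_square powr_add[symmetric] by (rule arg_cong[where f = "\<lambda>z. real N powr z"]) simp
    then show ?thesis by (simp add: power_mult_distrib)
  qed
  finally have H: "H\<^sup>2 \<le> 4 * L\<^sup>2 * real N powr (2 - \<gamma>)" .
  define Q where "Q = (\<lambda>(\<phi> :: nat \<Rightarrow> nat) A. (\<Sum>y\<in>A. ?f (\<phi> y)))"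
  have Q: "Q \<phi> A \<le> H" "0 \<le> Q \<phi> A" if "inj_on \<phi> A" "\<phi> ` A \<subseteq> {1..N}" for \<phi> :: "nat \<Rightarrow> nat" and A
  proof -
    show "Q \<phi> A \<le> H" unfolding Q_def H_def using that by (intro sum_le_inj_image) auto
    show "0 \<le> Q \<phi> A" unfolding Q_def by (intro sum_nonneg) auto
  qed
  have half: "1 / z powr \<gamma> \<le> ?f a * ?f b" if "real a \<le> z" "real b \<le> z" "1 \<le> a" "1 \<le> b" for a b z
  proof -
    have z: "z > 0" using that by linarith
    have "1 / z powr \<gamma> = z powr (- (\<gamma> / 2)) * z powr (- (\<gamma> / 2))"
      using z by (simp add: powr_minus_divide powr_add[symmetric])
    also have "\<dots> \<le> ?f a * ?f b" using that gamma by (intro mult_mono powr_mono2') auto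
    finally show ?thesis .
  qed
  have "(\<Sum>x\<in>{1..h}. \<Sum>y\<in>{h<..N}. 1 / tdist x y powr \<gamma>)
     \<le> (\<Sum>x\<in>{1..h}. \<Sum>y\<in>{h<..N}. ?f (h + 1 - x) * ?f (y - h) + ?f x * ?f (N + 1 - y))"
  proof (intro sum_mono)
    fix x y assume xy: "x \<in> {1..h}" "y \<in> {h<..N}"
    then have t: "x \<in> torus N" "y \<in> torus N" "x \<noteq> y" using h by (auto simp: torus_def)
    have "1 / \<bar>real x - real y\<bar> powr \<gamma> \<le> ?f (h + 1 - x) * ?f (y - h)"
      using xy by (intro half) (auto simp: of_nat_diff)
    moreover have "1 / (real N - \<bar>real x - real y\<bar>) powr \<gamma> \<le> ?f x * ?f (N + 1 - y)"
      using xy by (intro half) (auto simp: of_nat_diff)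
    moreover have "?f (h + 1 - x) * ?f (y - h) \<ge> 0" "?f x * ?f (N + 1 - y) \<ge> 0" by auto
    moreover have "1 / tdist x y powr \<gamma> = 1 / \<bar>real x - real y\<bar> powr \<gamma> \<or>
        1 / tdist x y powr \<gamma> = 1 / (real N - \<bar>real x - real y\<bar>) powr \<gamma>"
      using torus_dist_props(3)[OF t] by metis
    ultimately show "1 / tdist x y powr \<gamma> \<le> ?f (h + 1 - x) * ?f (y - h) + ?f x * ?f (N + 1 - y)"
      by linarith
  qed
  also have "\<dots> = Q (\<lambda>x. h + 1 - x) {1..h} * Q (\<lambda>y. y - h) {h<..N} + Q (\<lambda>x. x) {1..h} * Q (\<lambda>y. N + 1 - y) {h<..N}"
    unfolding Q_def by (simp add: sum_product sum.distrib)
  also have "\<dots> \<le> H * H + H * H"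
    using h H0 by (intro add_mono mult_mono Q) (auto simp: inj_on_def)
  finally show ?thesis using H by (simp add: power2_eq_square)
qed

text \<open>
  The clauses are, in this order: the range of the weights, a hub in every interval, the total of the small
  \<open>X\<close> in every interval, the conditional expected degrees, and the conditional expected number of edges
  between the two halves.
\<close>

definition good_weights :: "real \<Rightarrow> real \<Rightarrow> (nat \<Rightarrow> real) \<Rightarrow> bool" where
  "good_weights T t w \<longleftrightarrow>
     (\<forall>x\<in>torus N. w x \<in> {1..R}) \<and>
     (\<forall>a s. 1 \<le> s \<longrightarrow> a + s \<le> N \<longrightarrow> (\<exists>x\<in>{a<..a + s}. real s \<le> T * w x powr (\<tau> - 1))) \<and>
     (\<forall>a s. 1 \<le> s \<longrightarrow> a + s \<le> N \<longrightarrow>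
        (\<Sum>x\<in>{x\<in>{a<..a + s}. X (w x) \<le> real s}. X (w x)) \<le> real s * T) \<and>
     (\<forall>x\<in>torus N. (\<Sum>y\<in>torus N - {x}. edge_prob N \<alpha> w x y) \<le> 2 * T * X (w x)) \<and>
     (\<Sum>x\<in>{1..N div 2}. \<Sum>y\<in>{N div 2<..N}. edge_prob N \<alpha> w x y) \<le> t"

lemma interval_subset_torus: "a + s \<le> N \<Longrightarrow> {a<..a + s} \<subseteq> torus N"
  by (auto simp: torus_def)

lemma weight_range_exception:
  assumes x: "x \<in> torus N"
  shows "{w \<in> space M. w x \<notin> {1..R}} \<in> sets M"
    and "emeasure M {w \<in> space M. w x \<notin> {1..R}} \<le> ennreal (real N powr (- \<gamma>))"
proof -
  interpret P: prob_space "pareto \<tau>" by (rule prob_mu)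
  have eq: "{w \<in> space M. w x \<notin> {1..R}} = {w \<in> space M. \<forall>i\<in>{x}. w i \<in> - {1..R}}" by auto
  show "{w \<in> space M. w x \<notin> {1..R}} \<in> sets M"
    unfolding eq using x by (intro all_coordinates_in) auto
  have R1: "R \<ge> 1" using N3 alpha by (intro ge_one_powr_ge_zero) auto
  have "emeasure M {w \<in> space M. w x \<notin> {1..R}} = emeasure (pareto \<tau>) (- {1..R})"
    unfolding eq using x by (subst all_coordinates_in) auto
  also have "\<dots> \<le> emeasure (pareto \<tau>) ((space (pareto \<tau>) - {1..}) \<union> {R..})"
    by (intro emeasure_mono) (auto simp: space_mu)
  also have "\<dots> \<le> emeasure (pareto \<tau>) (space (pareto \<tau>) - {1..}) + emeasure (pareto \<tau>) {R..}"
    by (intro emeasure_subadditive) (auto simp: space_mu)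
  also have "emeasure (pareto \<tau>) (space (pareto \<tau>) - {1..}) = 0"
    using P.prob_compl[of "{1..}"] measure_pareto_tail[OF tau(1), of 1] by (simp add: P.emeasure_eq_measure)
  also have "emeasure (pareto \<tau>) {R..} = ennreal (real N powr (- \<gamma>))"
    using R1 measure_pareto_tail[OF tau(1), of R]
    by (simp add: P.emeasure_eq_measure powr_powr gamma_eq algebra_simps)
  finally show "emeasure M {w \<in> space M. w x \<notin> {1..R}} \<le> ennreal (real N powr (- \<gamma>))" by simp
qed

text \<open>
  Written as a complement, \<open>B\<close> contains all values below 1, including the negative ones, for which
  \<open>powr\<close> is not monotone.
\<close>

lemma hub_exception:
  assumes T: "1 \<le> T" and s: "1 \<le> s" "a + s \<le> N" "T \<le> real s"
  defines "B \<equiv> - {v. real s / T \<le> v powr (\<tau> - 1) \<and> 1 \<le> v}"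
  shows "{w \<in> space M. \<forall>x\<in>{a<..a + s}. w x \<in> B} \<in> sets M"
    and "emeasure M {w \<in> space M. \<forall>x\<in>{a<..a + s}. w x \<in> B} \<le> ennreal (exp (- T))"
proof -
  interpret P: prob_space "pareto \<tau>" by (rule prob_mu)
  have J: "{a<..a + s} \<subseteq> torus N" by (rule interval_subset_torus[OF s(2)])
  have B: "B \<in> sets borel" unfolding B_def by measurable
  show "{w \<in> space M. \<forall>x\<in>{a<..a + s}. w x \<in> B} \<in> sets M" by (rule all_coordinates_in[OF J B])
  have "emeasure (pareto \<tau>) {v. real s / T \<le> v powr (\<tau> - 1) \<and> 1 \<le> v} = ennreal (T / real s)"
    using pareto_tail[OF tau(1), of "real s / T"] T s by simp
  then have "measure (pareto \<tau>) {v. real s / T \<le> v powr (\<tau> - 1) \<and> 1 \<le> v} = T / real s"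
    using T by (simp add: P.emeasure_eq_measure)
  moreover have "{v. real s / T \<le> v powr (\<tau> - 1) \<and> 1 \<le> v} \<in> sets borel" by measurable
  ultimately have mB: "measure (pareto \<tau>) B = 1 - T / real s"
    unfolding B_def using P.prob_compl[of "{v. real s / T \<le> v powr (\<tau> - 1) \<and> 1 \<le> v}"]
    by (simp add: space_mu Compl_eq_Diff_UNIV)
  have "(1 - T / real s) ^ s \<le> exp (- (T / real s)) ^ s"
    using s T exp_ge_add_one_self[of "- (T / real s)"] by (intro power_mono) auto
  also have "\<dots> = exp (- T)" using s by (simp add: exp_of_nat_mult[symmetric])
  finally have "ennreal ((1 - T / real s) ^ s) \<le> ennreal (exp (- T))" by (rule ennreal_leI)
  moreover have "emeasure M {w \<in> space M. \<forall>x\<in>{a<..a + s}. w x \<in> B} = emeasure (pareto \<tau>) B ^ s"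
    using all_coordinates_in(2)[OF J B] by simp
  moreover have "emeasure (pareto \<tau>) B ^ s = ennreal ((1 - T / real s) ^ s)"
    using s T by (simp add: P.emeasure_eq_measure mB ennreal_power)
  ultimately show "emeasure M {w \<in> space M. \<forall>x\<in>{a<..a + s}. w x \<in> B} \<le> ennreal (exp (- T))" by simp
qed

text \<open>
  Dividing by \<open>s\<close> brings the summands into \<open>[0,1]\<close>. Each has mean at most \<open>10 log N / s\<close>, and there are
  \<open>s\<close> of them.
\<close>

lemma mass_exception:
  assumes s: "1 \<le> s" "a + s \<le> N"
  defines "g \<equiv> (\<lambda>x v. if x \<in> {a<..a + s} then X v * indicator {v. 1 \<le> v \<and> X v \<le> real s} v / real s else 0)"
  shows "{w \<in> space M. (\<Sum>x\<in>torus N. g x (w x)) \<ge> T} \<in> sets M"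
    and "emeasure M {w \<in> space M. (\<Sum>x\<in>torus N. g x (w x)) \<ge> T} \<le> ennreal (exp (20 * L - T))"
proof -
  define m where "m = (\<lambda>x. if x \<in> {a<..a + s} then 10 * L / real s else 0)"
  have J: "{a<..a + s} \<subseteq> torus N" by (rule interval_subset_torus[OF s(2)])
  have meas: "g x \<in> borel_measurable borel" for x unfolding g_def by measurable
  have g01: "0 \<le> g x v \<and> g x v \<le> 1" for x v
    using s by (auto simp: g_def indicator_def)
  have m0: "m x \<ge> 0" for x using L_ge_1 by (simp add: m_def)
  have gm: "(\<integral>\<^sup>+ v. ennreal (g x v) \<partial>pareto \<tau>) \<le> ennreal (m x)" for x
  proof (cases "x \<in> {a<..a + s}")
    case True
    have "(\<integral>\<^sup>+ v. ennreal (g x v) \<partial>pareto \<tau>) \<le> (\<integral>\<^sup>+ v. ennreal (1 / real s) * ennreal (moment_fun v) \<partial>pareto \<tau>)"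
    proof (rule nn_integral_mono)
      fix v :: real
      have "g x v \<le> 1 / real s * moment_fun v"
      proof (cases "1 \<le> v \<and> X v \<le> real s")
        case c: True
        have "X v \<le> real N" using c s by linarith
        then have "X v powr \<alpha> \<le> R" using alpha by (intro powr_mono2) auto
        then have "v \<in> {1..R}" using c X_powr(2)[of v] by simp
        moreover have "X v \<le> X v powr \<gamma>" using powr_mono[of 1 \<gamma> "X v"] X_ge_1[of v] c gamma by simp
        then have "X v \<le> v powr (\<tau> - 1)" using X_powr(1)[of v] c by simp
        ultimately show ?thesis using True c s by (simp add: g_def divide_right_mono)
      qed (auto simp: g_def True)
      then have "ennreal (g x v) \<le> ennreal (1 / real s * moment_fun v)" by (rule ennreal_leI)
      then show "ennreal (g x v) \<le> ennreal (1 / real s) * ennreal (moment_fun v)"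
        by (subst ennreal_mult[symmetric]) auto
    qed
    also have "\<dots> = ennreal (1 / real s) * (\<integral>\<^sup>+ v. ennreal (moment_fun v) \<partial>pareto \<tau>)"
      by (intro nn_integral_cmult) measurable
    also have "\<dots> \<le> ennreal (1 / real s) * ennreal (10 * L)"
      by (intro mult_left_mono truncated_moment) auto
    also have "\<dots> = ennreal (m x)" using True L_ge_1 s by (simp add: m_def ennreal_mult[symmetric])
    finally show ?thesis .
  next
    case False
    then have "g x = (\<lambda>_. 0)" by (auto simp: g_def)
    then show ?thesis by simp
  qed
  have "(\<Sum>x\<in>torus N. m x) = (\<Sum>x\<in>{a<..a + s}. 10 * L / real s)"
    unfolding m_def using J finite_I by (intro sum.mono_neutral_cong_right) auto
  then have msum: "(\<Sum>x\<in>torus N. m x) = 10 * L" using s by simp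
  show "{w \<in> space M. (\<Sum>x\<in>torus N. g x (w x)) \<ge> T} \<in> sets M"
    by (rule sum_upper_tail(1)[where g = g and m = m, OF meas g01 m0 gm])
  show "emeasure M {w \<in> space M. (\<Sum>x\<in>torus N. g x (w x)) \<ge> T} \<le> ennreal (exp (20 * L - T))"
    using sum_upper_tail(2)[where g = g and m = m and t = T, OF meas g01 m0 gm] msum by simp
qed

text \<open>
  The integer \<open>v\<close> stands for an upper bound on \<open>X\<^sub>x\<close>. Fixing it makes the summands functions
  of one weight each, hence independent; a union bound over \<open>v\<close> then stands in for conditioning
  on \<open>w x\<close>. The mean of a summand is at most \<open>min 1 (10 log N \<cdot> (v/r)^\<gamma>) \<le> 10 log N \<cdot> v/r\<close> at distance \<open>r\<close>, and the harmonic sum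
  over \<open>r\<close> costs one more logarithm.
\<close>

lemma degree_exception:
  fixes v :: nat
  assumes x: "x \<in> torus N" and v: "1 \<le> v"
  defines "g \<equiv> (\<lambda>y u. if y = x then 0 else min 1 (real v powr \<gamma> * moment_fun u / tdist x y powr \<gamma>))"
  shows "{w \<in> space M. (\<Sum>y\<in>torus N. g y (w y)) \<ge> T * real v} \<in> sets M"
    and "emeasure M {w \<in> space M. (\<Sum>y\<in>torus N. g y (w y)) \<ge> T * real v} \<le> ennreal (exp ((160 * L\<^sup>2 - T) * real v))"
proof -
  define m where "m = (\<lambda>y. if y = x then 0 else 10 * L * real v * (1 / tdist x y))"
  have meas: "g y \<in> borel_measurable borel" for y unfolding g_def by measurable
  have g01: "0 \<le> g y u \<and> g y u \<le> 1" for y u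
    by (auto simp: g_def)
  have m0: "m y \<ge> 0" if "y \<in> torus N" for y
    using L_ge_1 torus_dist_props(1)[OF x that] by (auto simp: m_def)
  have gm: "(\<integral>\<^sup>+ u. ennreal (g y u) \<partial>pareto \<tau>) \<le> ennreal (m y)" if y: "y \<in> torus N" for y
  proof (cases "y = x")
    case False
    define r where "r = tdist x y"
    have r: "r \<ge> 1" unfolding r_def using torus_dist_props(1)[OF x y] False by simp
    have m: "m y = 10 * L * (real v / r)" using False by (simp add: m_def r_def)
    show ?thesis
    proof (cases "real v \<le> r")
      case True
      have q: "(real v / r) powr \<gamma> \<le> real v / r"
        using powr_mono'[of 1 \<gamma> "real v / r"] True r v gamma by simp
      have "(\<integral>\<^sup>+ u. ennreal (g y u) \<partial>pareto \<tau>) \<le> (\<integral>\<^sup>+ u. ennreal (real v / r) * ennreal (moment_fun u) \<partial>pareto \<tau>)"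
      proof (rule nn_integral_mono)
        fix u :: real
        have "g y u \<le> real v powr \<gamma> * moment_fun u / r powr \<gamma>" using False by (simp add: g_def r_def)
        also have "\<dots> = (real v / r) powr \<gamma> * moment_fun u" using r by (simp add: powr_divide)
        also have "\<dots> \<le> real v / r * moment_fun u" using q by (intro mult_right_mono) auto
        finally have "ennreal (g y u) \<le> ennreal (real v / r * moment_fun u)" by (rule ennreal_leI)
        then show "ennreal (g y u) \<le> ennreal (real v / r) * ennreal (moment_fun u)"
          using r by (subst ennreal_mult[symmetric]) auto
      qed
      also have "\<dots> = ennreal (real v / r) * (\<integral>\<^sup>+ u. ennreal (moment_fun u) \<partial>pareto \<tau>)"
        by (intro nn_integral_cmult) measurable
      also have "\<dots> \<le> ennreal (real v / r) * ennreal (10 * L)"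
        by (intro mult_left_mono truncated_moment) auto
      also have "\<dots> = ennreal (m y)" using L_ge_1 r m by (simp add: ennreal_mult[symmetric] mult_ac)
      finally show ?thesis .
    next
      case large: False
      have "(\<integral>\<^sup>+ u. ennreal (g y u) \<partial>pareto \<tau>) \<le> (\<integral>\<^sup>+ u. 1 \<partial>pareto \<tau>)"
        using g01 by (intro nn_integral_mono) auto
      also have "\<dots> = ennreal 1" using emeasure_mu_UNIV by simp
      also have "\<dots> \<le> ennreal (m y)"
      proof (rule ennreal_leI)
        have "1 * 1 \<le> (10 * L) * (real v / r)" using L_ge_1 large r by (intro mult_mono) auto
        then show "1 \<le> m y" using m by simp
      qed
      finally show ?thesis .
    qed
  qed (simp add: g_def)
  have "(\<Sum>y\<in>torus N. m y) = (\<Sum>y\<in>torus N - {x}. 10 * L * real v * (1 / tdist x y))"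
    unfolding m_def using finite_I by (intro sum.mono_neutral_cong_right) auto
  also have "\<dots> = 10 * L * real v * (\<Sum>y\<in>torus N - {x}. 1 / tdist x y)" by (simp add: sum_distrib_left)
  also have "\<dots> \<le> 10 * L * real v * (8 * L)"
    using L_ge_1 by (intro mult_left_mono sum_inverse_dist x) auto
  finally have msum: "2 * (\<Sum>y\<in>torus N. m y) - T * real v \<le> (160 * L\<^sup>2 - T) * real v"
    by (simp add: power2_eq_square algebra_simps)
  show "{w \<in> space M. (\<Sum>y\<in>torus N. g y (w y)) \<ge> T * real v} \<in> sets M"
    by (rule sum_upper_tail(1)[where g = g and m = m, OF meas g01 m0 gm])
  have "emeasure M {w \<in> space M. (\<Sum>y\<in>torus N. g y (w y)) \<ge> T * real v} \<le> ennreal (exp (2 * (\<Sum>y\<in>torus N. m y) - T * real v))"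
    by (rule sum_upper_tail(2)[where g = g and m = m, OF meas g01 m0 gm])
  also have "\<dots> \<le> ennreal (exp ((160 * L\<^sup>2 - T) * real v))" using msum by (intro ennreal_leI) simp
  finally show "emeasure M {w \<in> space M. (\<Sum>y\<in>torus N. g y (w y)) \<ge> T * real v} \<le> ennreal (exp ((160 * L\<^sup>2 - T) * real v))" .
qed

text \<open>
  Markov's inequality, as the expected number of edges across the cut factorises by independence
  of the two endpoint weights.
\<close>

lemma cut_exception:
  assumes t: "t > 0"
  defines "F \<equiv> (\<lambda>w. \<Sum>x\<in>{1..N div 2}. \<Sum>y\<in>{N div 2<..N}. moment_fun (w x) * moment_fun (w y) / tdist x y powr \<gamma>)"
  shows "{w \<in> space M. F w \<ge> t} \<in> sets M"
    and "emeasure M {w \<in> space M. F w \<ge> t} \<le> ennreal (800 * L ^ 4 * real N powr (2 - \<gamma>) / t)"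
proof -
  have xyT: "x \<in> torus N" "y \<in> torus N" "x \<noteq> y" if "x \<in> {1..N div 2}" "y \<in> {N div 2<..N}" for x y
    using that by (auto simp: torus_def)
  define G where "G = (\<lambda>x y w. moment_fun (w x) * moment_fun (w y) / tdist x y powr \<gamma>)"
  have mG: "G x y \<in> borel_measurable M" if "x \<in> {1..N div 2}" "y \<in> {N div 2<..N}" for x y
  proof -
    note [measurable] = coordinate_measurable[OF xyT(1)[OF that]] coordinate_measurable[OF xyT(2)[OF that]]
    show ?thesis unfolding G_def by measurable
  qed
  have F: "F \<in> borel_measurable M" unfolding F_def G_def[symmetric]
    by (intro borel_measurable_sum) (rule mG[unfolded G_def])
  show "{w \<in> space M. F w \<ge> t} \<in> sets M"
    using F unfolding borel_measurable_iff_ge by blast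
  have G0: "G x y w \<ge> 0" for x y w unfolding G_def by simp
  have one: "(\<integral>\<^sup>+ w. ennreal (G x y w) \<partial>M) \<le> ennreal (100 * L\<^sup>2 * (1 / tdist x y powr \<gamma>))"
    if "x \<in> {1..N div 2}" "y \<in> {N div 2<..N}" for x y
  proof -
    have "(\<integral>\<^sup>+ w. ennreal (G x y w) \<partial>M) = (\<integral>\<^sup>+ w. ennreal (moment_fun (w x)) * (ennreal (moment_fun (w y)) * ennreal (1 / tdist x y powr \<gamma>)) \<partial>M)"
      unfolding G_def by (intro nn_integral_cong) (simp add: ennreal_mult[symmetric])
    also have "\<dots> = (\<integral>\<^sup>+ v. ennreal (moment_fun v) \<partial>pareto \<tau>) * (\<integral>\<^sup>+ v. ennreal (moment_fun v) * ennreal (1 / tdist x y powr \<gamma>) \<partial>pareto \<tau>)"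
      by (intro nn_integral_coordinate_pair[OF xyT[OF that]]) measurable
    also have "(\<integral>\<^sup>+ v. ennreal (moment_fun v) * ennreal (1 / tdist x y powr \<gamma>) \<partial>pareto \<tau>)
        = (\<integral>\<^sup>+ v. ennreal (moment_fun v) \<partial>pareto \<tau>) * ennreal (1 / tdist x y powr \<gamma>)"
      by (intro nn_integral_multc) measurable
    also have "(\<integral>\<^sup>+ v. ennreal (moment_fun v) \<partial>pareto \<tau>) * ((\<integral>\<^sup>+ v. ennreal (moment_fun v) \<partial>pareto \<tau>) * ennreal (1 / tdist x y powr \<gamma>))
        \<le> ennreal (10 * L) * (ennreal (10 * L) * ennreal (1 / tdist x y powr \<gamma>))"
      by (intro mult_mono truncated_moment) auto
    also have "\<dots> = ennreal (100 * L\<^sup>2 * (1 / tdist x y powr \<gamma>))"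
      using L_ge_1 by (simp add: ennreal_mult[symmetric] power2_eq_square)
    finally show ?thesis .
  qed
  have h: "1 \<le> N div 2" "N div 2 < N" using N3 by auto
  have "(\<integral>\<^sup>+ w. ennreal (F w) \<partial>M) = (\<integral>\<^sup>+ w. (\<Sum>x\<in>{1..N div 2}. \<Sum>y\<in>{N div 2<..N}. ennreal (G x y w)) \<partial>M)"
  proof (rule nn_integral_cong)
    fix w
    have "ennreal (F w) = ennreal (\<Sum>x\<in>{1..N div 2}. \<Sum>y\<in>{N div 2<..N}. G x y w)" by (simp add: F_def G_def)
    also have "\<dots> = (\<Sum>x\<in>{1..N div 2}. ennreal (\<Sum>y\<in>{N div 2<..N}. G x y w))"
      by (intro sum_ennreal[symmetric] sum_nonneg G0)
    also have "\<dots> = (\<Sum>x\<in>{1..N div 2}. \<Sum>y\<in>{N div 2<..N}. ennreal (G x y w))"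
      by (intro sum.cong refl sum_ennreal[symmetric] G0)
    finally show "ennreal (F w) = (\<Sum>x\<in>{1..N div 2}. \<Sum>y\<in>{N div 2<..N}. ennreal (G x y w))" .
  qed
  also have "\<dots> = (\<Sum>x\<in>{1..N div 2}. \<integral>\<^sup>+ w. (\<Sum>y\<in>{N div 2<..N}. ennreal (G x y w)) \<partial>M)"
    by (intro nn_integral_sum borel_measurable_sum measurable_compose[OF mG measurable_ennreal])
  also have "\<dots> = (\<Sum>x\<in>{1..N div 2}. \<Sum>y\<in>{N div 2<..N}. \<integral>\<^sup>+ w. ennreal (G x y w) \<partial>M)"
    by (intro sum.cong refl nn_integral_sum measurable_compose[OF mG measurable_ennreal])
  also have "\<dots> \<le> (\<Sum>x\<in>{1..N div 2}. \<Sum>y\<in>{N div 2<..N}. ennreal (100 * L\<^sup>2 * (1 / tdist x y powr \<gamma>)))"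
    by (intro sum_mono one)
  also have "\<dots> = ennreal (\<Sum>x\<in>{1..N div 2}. \<Sum>y\<in>{N div 2<..N}. 100 * L\<^sup>2 * (1 / tdist x y powr \<gamma>))"
    by (simp add: sum_nonneg)
  also have "\<dots> \<le> ennreal (100 * L\<^sup>2 * (8 * L\<^sup>2 * real N powr (2 - \<gamma>)))"
    using sum_dist_cut[OF h] unfolding sum_distrib_left[symmetric]
    by (intro ennreal_leI mult_left_mono) auto
  finally have E: "(\<integral>\<^sup>+ w. ennreal (F w) \<partial>M) \<le> ennreal (800 * L ^ 4 * real N powr (2 - \<gamma>))"
    by (simp add: power2_eq_square power4_eq_xxxx mult_ac)
  have "{w \<in> space M. F w \<ge> t} = {w \<in> space M. 1 \<le> ennreal (1 / t) * ennreal (F w)}"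
  proof (intro Collect_cong conj_cong refl)
    fix w
    have F0: "F w \<ge> 0" unfolding F_def by (intro sum_nonneg) auto
    then have "ennreal (1 / t) * ennreal (F w) = ennreal (F w / t)" using t by (simp add: ennreal_mult[symmetric])
    then show "(t \<le> F w) = (1 \<le> ennreal (1 / t) * ennreal (F w))"
      using t F0 by (simp add: le_divide_eq flip: ennreal_1)
  qed
  also have "emeasure M \<dots> \<le> ennreal (1 / t) * (\<integral>\<^sup>+ w. ennreal (F w) * indicator (space M) w \<partial>M)"
    using F by (intro nn_integral_Markov_inequality) auto
  also have "(\<integral>\<^sup>+ w. ennreal (F w) * indicator (space M) w \<partial>M) = (\<integral>\<^sup>+ w. ennreal (F w) \<partial>M)"
    by (intro nn_integral_cong) simp
  also have "ennreal (1 / t) * \<dots> \<le> ennreal (1 / t) * ennreal (800 * L ^ 4 * real N powr (2 - \<gamma>))"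
    by (intro mult_left_mono E) auto
  also have "\<dots> = ennreal (800 * L ^ 4 * real N powr (2 - \<gamma>) / t)"
    using t by (simp add: ennreal_mult[symmetric])
  finally show "emeasure M {w \<in> space M. F w \<ge> t} \<le> ennreal (800 * L ^ 4 * real N powr (2 - \<gamma>) / t)" 
    by (simp add: mult_left_mono)
qed

text \<open>
  A union bound over the exceptional sets; the threshold on \<open>T\<close> is what the means in \<open>degree_exception\<close>
  require, and it dominates the one needed for \<open>mass_exception\<close>.
\<close>

lemma good_weights_likely:
  assumes T: "T \<ge> 320 * L\<^sup>2" and t: "t > 0"
  shows "\<exists>B\<in>sets M. emeasure M B \<le> ennreal (real N * real N powr (- \<gamma>) + 3 * ((real N)\<^sup>2 * exp (- T / 2))
      + 800 * L ^ 4 * real N powr (2 - \<gamma>) / t) \<and> (\<forall>w\<in>space M - B. good_weights T t w)"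
proof -
  define e where "e = exp (- T / 2)"
  have L2: "1 \<le> L" "L \<le> L\<^sup>2" using L_ge_1 by (auto simp: power2_eq_square mult_left_le)
  have T1: "T \<ge> 1" using T L2 by linarith
  define P where "P = {(a, s). a < N \<and> 1 \<le> s \<and> s \<le> N \<and> a + s \<le> N}"
  have Psub: "P \<subseteq> {0..<N} \<times> {1..N}" by (auto simp: P_def)
  then have finP: "finite P" by (rule finite_subset) auto
  have "card P \<le> card ({0..<N} \<times> {1..N})" using Psub by (intro card_mono) auto
  then have cP: "real (card P) \<le> (real N)\<^sup>2"
    by (simp add: power2_eq_square flip: of_nat_mult)
  define B1 where "B1 = (\<lambda>x. {w \<in> space M. w x \<notin> {1..R}})"
  define B2 where "B2 = (\<lambda>(a, s). if T \<le> real s then {w \<in> space M. \<forall>x\<in>{a<..a + s}. w x \<in> - {v. real s / T \<le> v powr (\<tau> - 1) \<and> 1 \<le> v}} else {})"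
  define B3 where "B3 = (\<lambda>(a, s). {w \<in> space M. (\<Sum>x\<in>torus N. if x \<in> {a<..a + s} then X (w x) * indicator {v. 1 \<le> v \<and> X v \<le> real s} (w x) / real s else 0) \<ge> T})"
  define B4 where "B4 = (\<lambda>(x, v). {w \<in> space M. (\<Sum>y\<in>torus N. if y = x then 0 else min 1 (real v powr \<gamma> * moment_fun (w y) / tdist x y powr \<gamma>)) \<ge> T * real v})"
  define B5 where "B5 = {w \<in> space M. (\<Sum>x\<in>{1..N div 2}. \<Sum>y\<in>{N div 2<..N}. moment_fun (w x) * moment_fun (w y) / tdist x y powr \<gamma>) \<ge> t}"
  have e0: "e \<ge> 0" by (simp add: e_def)
  have B1': "B1 x \<in> sets M \<and> emeasure M (B1 x) \<le> ennreal (real N powr (- \<gamma>))" if "x \<in> torus N" for x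
    unfolding B1_def using weight_range_exception[OF that] by blast
  have c1: "real (card (torus N)) \<le> real N" by (simp add: torus_def)
  note B1 = emeasure_finite_union_le[OF finite_I B1' powr_ge_zero c1]
  have B2': "B2 i \<in> sets M \<and> emeasure M (B2 i) \<le> ennreal e" if "i \<in> P" for i
  proof -
    obtain a s where i: "i = (a, s)" by force
    show ?thesis
    proof (cases "T \<le> real s")
      case True
      have "exp (- T) \<le> e" unfolding e_def using T1 by simp
      then have "ennreal (exp (- T)) \<le> ennreal e" by (rule ennreal_leI)
      moreover have "1 \<le> s" "a + s \<le> N" using that by (auto simp: P_def i)
      note hub_exception[OF T1 this True]
      ultimately show ?thesis
        unfolding B2_def i prod.case if_P[OF True] by (meson order_trans)
    qed (simp add: B2_def i)
  qed
  have B3': "B3 i \<in> sets M \<and> emeasure M (B3 i) \<le> ennreal e" if "i \<in> P" for i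
  proof -
    obtain a s where i: "i = (a, s)" by force
    have "20 * L - T \<le> - T / 2" using T L2 by linarith
    then have "ennreal (exp (20 * L - T)) \<le> ennreal e" unfolding e_def by (intro ennreal_leI) simp
    moreover have "1 \<le> s" "a + s \<le> N" using that by (auto simp: P_def i)
    note mass_exception[OF this, of T]
    ultimately show ?thesis
      unfolding B3_def i prod.case by (meson order_trans)
  qed
  have B4': "B4 i \<in> sets M \<and> emeasure M (B4 i) \<le> ennreal e" if "i \<in> torus N \<times> {1..N}" for i
  proof -
    obtain x v where i: "i = (x, v)" by force
    have v: "real v \<ge> 1" using that i by simp
    have "(160 * L\<^sup>2 - T) * real v \<le> (- T / 2) * real v" using T v by (intro mult_right_mono) auto
    also have "\<dots> \<le> (- T / 2) * 1" using v T1 by (intro mult_left_mono_neg) auto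
    finally have "ennreal (exp ((160 * L\<^sup>2 - T) * real v)) \<le> ennreal e" unfolding e_def by (intro ennreal_leI) simp
    moreover have "x \<in> torus N" "1 \<le> v" using that by (auto simp: i)
    note degree_exception[OF this, of T]
    ultimately show ?thesis
      unfolding B4_def i prod.case by (meson order_trans)
  qed
  have cT: "real (card (torus N \<times> {1..N})) \<le> (real N)\<^sup>2"
    by (simp add: torus_def power2_eq_square)
  have finT: "finite (torus N \<times> {1..N})" using finite_I by simp
  note B2 = emeasure_finite_union_le[OF finP B2' e0 cP]
  note B3 = emeasure_finite_union_le[OF finP B3' e0 cP]
  note B4 = emeasure_finite_union_le[OF finT B4' e0 cT]
  have B5: "B5 \<in> sets M" "emeasure M B5 \<le> ennreal (800 * L ^ 4 * real N powr (2 - \<gamma>) / t)"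
    unfolding B5_def by (rule cut_exception[OF t])+
  define B where "B = (\<Union>x\<in>torus N. B1 x) \<union> ((\<Union>i\<in>P. B2 i) \<union> ((\<Union>i\<in>P. B3 i) \<union> ((\<Union>i\<in>torus N \<times> {1..N}. B4 i) \<union> B5)))"
  have Bs: "B \<in> sets M" unfolding B_def using B1 B2 B3 B4 B5 by auto
  have "emeasure M B \<le> emeasure M (\<Union>x\<in>torus N. B1 x) + (emeasure M (\<Union>i\<in>P. B2 i) + (emeasure M (\<Union>i\<in>P. B3 i)
      + (emeasure M (\<Union>i\<in>torus N \<times> {1..N}. B4 i) + emeasure M B5)))"
    unfolding B_def using B1 B2 B3 B4 B5
    by (intro order_trans[OF emeasure_subadditive] add_left_mono order_refl) auto
  also have "\<dots> \<le> ennreal (real N * real N powr (- \<gamma>)) + (ennreal ((real N)\<^sup>2 * e) + (ennreal ((real N)\<^sup>2 * e)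
      + (ennreal ((real N)\<^sup>2 * e) + ennreal (800 * L ^ 4 * real N powr (2 - \<gamma>) / t))))"
    by (intro add_mono B1 B2 B3 B4 B5)
  also have "\<dots> = ennreal (real N * real N powr (- \<gamma>) + 3 * ((real N)\<^sup>2 * e) + 800 * L ^ 4 * real N powr (2 - \<gamma>) / t)"
    using e0 t L_ge_1 by (simp add: ennreal_plus[symmetric] del: ennreal_plus)
  finally have Bm: "emeasure M B \<le> ennreal (real N * real N powr (- \<gamma>) + 3 * ((real N)\<^sup>2 * e) + 800 * L ^ 4 * real N powr (2 - \<gamma>) / t)" .
  have good: "good_weights T t w" if w: "w \<in> space M - B" for w
  proof -
    have wM: "w \<in> space M" using w by simp
    have r: "w x \<in> {1..R}" if "x \<in> torus N" for x
      using w that unfolding B_def B1_def by auto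
    have mf: "moment_fun (w x) = w x powr (\<tau> - 1)" if "x \<in> torus N" for x using r[OF that] by simp
    \<comment> \<open>For \<open>s < T\<close> every vertex qualifies, because all weights are at least 1.\<close>
    have g2: "\<exists>x\<in>{a<..a + s}. real s \<le> T * w x powr (\<tau> - 1)" if as: "1 \<le> s" "a + s \<le> N" for a s
    proof (cases "T \<le> real s")
      case True
      have "(a, s) \<in> P" using as by (auto simp: P_def)
      then have "w \<notin> B2 (a, s)" using w unfolding B_def by blast
      then obtain x where "x \<in> {a<..a + s}" "real s / T \<le> w x powr (\<tau> - 1)"
        using wM True unfolding B2_def by auto
      then show ?thesis using T1 by (auto simp: field_simps)
    next
      case False
      have x: "a + s \<in> torus N" using as by (auto simp: torus_def)
      have "1 \<le> w (a + s) powr (\<tau> - 1)" using r[OF x] tau by (intro ge_one_powr_ge_zero) auto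
      then have "real s \<le> T * w (a + s) powr (\<tau> - 1)" using False T1 mult_left_mono[of 1 "w (a + s) powr (\<tau> - 1)" T] by linarith
      then show ?thesis using as by (intro bexI[of _ "a + s"]) auto
    qed
    have g3: "(\<Sum>x\<in>{x\<in>{a<..a + s}. X (w x) \<le> real s}. X (w x)) \<le> real s * T" if as: "1 \<le> s" "a + s \<le> N" for a s
    proof -
      have J: "{a<..a + s} \<subseteq> torus N" by (rule interval_subset_torus[OF as(2)])
      have "(a, s) \<in> P" using as by (auto simp: P_def)
      then have "w \<notin> B3 (a, s)" using w unfolding B_def by blast
      then have "(\<Sum>x\<in>torus N. if x \<in> {a<..a + s} then X (w x) * indicator {v. 1 \<le> v \<and> X v \<le> real s} (w x) / real s else 0) < T"
        using wM unfolding B3_def by auto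
      also have "(\<Sum>x\<in>torus N. if x \<in> {a<..a + s} then X (w x) * indicator {v. 1 \<le> v \<and> X v \<le> real s} (w x) / real s else 0)
          = (\<Sum>x\<in>{x\<in>{a<..a + s}. X (w x) \<le> real s}. X (w x) / real s)"
        using J r finite_I by (intro sum.mono_neutral_cong_right) (auto simp: indicator_def)
      also have "\<dots> = (\<Sum>x\<in>{x\<in>{a<..a + s}. X (w x) \<le> real s}. X (w x)) / real s"
        by (simp add: sum_divide_distrib)
      finally show ?thesis using as by (simp add: field_simps)
    qed
    have g4: "(\<Sum>y\<in>torus N - {x}. edge_prob N \<alpha> w x y) \<le> 2 * T * X (w x)" if x: "x \<in> torus N" for x
    proof -
      have Xx: "1 \<le> X (w x)" "X (w x) \<le> real N" using r[OF x] X_ge_1 X_le_N by auto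
      define v where "v = nat \<lceil>X (w x)\<rceil>"
      have v: "X (w x) \<le> real v" "real v \<le> 2 * X (w x)" "v \<in> {1..N}"
        using Xx unfolding v_def by (auto simp: Suc_le_eq) linarith+
      have "(x, v) \<in> torus N \<times> {1..N}" using x v by auto
      then have "w \<notin> B4 (x, v)" using w unfolding B_def by blast
      then have lt: "(\<Sum>y\<in>torus N. if y = x then 0 else min 1 (real v powr \<gamma> * moment_fun (w y) / tdist x y powr \<gamma>)) < T * real v"
        using wM unfolding B4_def by auto
      have "(\<Sum>y\<in>torus N - {x}. edge_prob N \<alpha> w x y) \<le>
          (\<Sum>y\<in>torus N - {x}. min 1 (real v powr \<gamma> * moment_fun (w y) / tdist x y powr \<gamma>))"
      proof (intro sum_mono min.boundedI)
        fix y assume y: "y \<in> torus N - {x}"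
        show "edge_prob N \<alpha> w x y \<le> 1" using r[OF x] r[of y] y by (intro edge_prob_01) auto
        have "edge_prob N \<alpha> w x y \<le> w x powr (\<tau> - 1) * w y powr (\<tau> - 1) / tdist x y powr \<gamma>"
          using x y r[OF x] r[of y] by (intro edge_prob_le) auto
        also have "w x powr (\<tau> - 1) = X (w x) powr \<gamma>" using r[OF x] by (intro X_powr(1)[symmetric]) auto
        also have "X (w x) powr \<gamma> * w y powr (\<tau> - 1) / tdist x y powr \<gamma> \<le> real v powr \<gamma> * w y powr (\<tau> - 1) / tdist x y powr \<gamma>"
          using v gamma by (intro divide_right_mono mult_right_mono powr_mono2) auto
        finally show "edge_prob N \<alpha> w x y \<le> real v powr \<gamma> * moment_fun (w y) / tdist x y powr \<gamma>"
          using y by (simp add: mf)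
      qed
      also have "\<dots> = (\<Sum>y\<in>torus N. if y = x then 0 else min 1 (real v powr \<gamma> * moment_fun (w y) / tdist x y powr \<gamma>))"
        using finite_I by (intro sum.mono_neutral_cong_left) auto
      also have "\<dots> \<le> T * (2 * X (w x))" using lt v T1 by (smt (verit) mult_left_mono)
      finally show ?thesis by simp
    qed
    have g5: "(\<Sum>x\<in>{1..N div 2}. \<Sum>y\<in>{N div 2<..N}. edge_prob N \<alpha> w x y) \<le> t"
    proof -
      have "w \<notin> B5" using w unfolding B_def by blast
      then have lt: "(\<Sum>x\<in>{1..N div 2}. \<Sum>y\<in>{N div 2<..N}. moment_fun (w x) * moment_fun (w y) / tdist x y powr \<gamma>) < t"
        using wM unfolding B5_def by auto
      have "(\<Sum>x\<in>{1..N div 2}. \<Sum>y\<in>{N div 2<..N}. edge_prob N \<alpha> w x y) \<le>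
          (\<Sum>x\<in>{1..N div 2}. \<Sum>y\<in>{N div 2<..N}. moment_fun (w x) * moment_fun (w y) / tdist x y powr \<gamma>)"
      proof (intro sum_mono)
        fix x y assume xy: "x \<in> {1..N div 2}" "y \<in> {N div 2<..N}"
        then have t: "x \<in> torus N" "y \<in> torus N" "x \<noteq> y" by (auto simp: torus_def)
        show "edge_prob N \<alpha> w x y \<le> moment_fun (w x) * moment_fun (w y) / tdist x y powr \<gamma>"
          using edge_prob_le[OF t, of w] r[OF t(1)] r[OF t(2)] by (simp add: mf t)
      qed
      then show ?thesis using lt by linarith
    qed
    show ?thesis unfolding good_weights_def using r g2 g3 g4 g5 by blast
  qed
  show ?thesis using Bs Bm good unfolding e_def by blast
qed

section \<open>Typical graphs for typical weights\<close>

definition good_graph :: "real \<Rightarrow> real \<Rightarrow> (nat \<Rightarrow> real) \<Rightarrow> nat set set \<Rightarrow> bool" where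
  "good_graph T t w E \<longleftrightarrow>
     (\<forall>x. 1 \<le> x \<longrightarrow> x < N \<longrightarrow> {x, Suc x} \<in> E) \<and>
     (\<forall>x\<in>torus N. \<forall>y\<in>torus N. x \<noteq> y \<longrightarrow> T * \<bar>real x - real y\<bar> \<le> X (w x) * X (w y) \<longrightarrow> {x, y} \<in> E) \<and>
     (\<forall>x\<in>torus N. real (degree (torus N) E x) \<le> 5 * T * X (w x)) \<and>
     cut_size (torus N) E {1..N div 2} \<le> t"

text \<open>
  Given the weights, each required edge is missing with probability at most \<open>exp (-T)\<close>, degrees exceed
  their conditional means by a constant factor with probability at most \<open>exp (-T)\<close>, and the cut is
  controlled by Markov's inequality.
\<close>

lemma good_graph_likely:
  assumes w: "good_weights T t w" and T: "T \<ge> 1" and t': "t' > 0"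
  shows "measure_pmf.prob (sfp_given_weights N \<alpha> w) {E. \<not> good_graph T t' w E}
     \<le> 2 * ((real N)\<^sup>2 * exp (- T)) + t / t'"
proof -
  define S where "S = vertex_pairs N"
  define p where "p = (\<lambda>(x, y). edge_prob N \<alpha> w x y)"
  define Q where "Q = Pi_pmf S False (\<lambda>e. bernoulli_pmf (p e))"
  define G where "G = (\<lambda>g. {{x, y} | x y. (x, y) \<in> vertex_pairs N \<and> g (x, y)} :: nat set set)"
  have finS: "finite S" unfolding S_def by (rule finite_vertex_pairs)
  have wr: "1 \<le> w x" "w x \<le> R" if "x \<in> torus N" for x using w that unfolding good_weights_def by auto
  have p01: "0 \<le> p e \<and> p e \<le> 1" if "e \<in> S" for e
  proof -
    obtain x y where e: "e = (x, y)" by force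
    then have "x \<in> torus N" "y \<in> torus N" using that by (auto simp: S_def vertex_pairs_def)
    then show ?thesis unfolding e p_def using edge_prob_01[of w x y] wr[of x] wr[of y] by auto
  qed
  have law: "sfp_given_weights N \<alpha> w = map_pmf G Q"
    unfolding sfp_given_weights_def G_def Q_def S_def p_def by (simp add: case_prod_unfold)
  have edge: "{x, y} \<in> G g \<longleftrightarrow> g (min x y, max x y)" if "x \<in> torus N" "y \<in> torus N" "x \<noteq> y" for x y g
  proof -
    have *: "{x, y} \<in> G g \<longleftrightarrow> g (x, y)" if "x < y" "x \<in> torus N" "y \<in> torus N" for x y
      using that by (auto simp: G_def vertex_pairs_def doubleton_eq_iff)
    show ?thesis
      using *[of x y] *[of y x] that by (cases "x < y") (auto simp: insert_commute min_def max_def)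
  qed
  \<comment> \<open>\<open>C\<close> lists the pairs that must be joined: consecutive vertices, and pairs with large weights.\<close>
  define C where "C = {(x, y) \<in> S. y = Suc x \<or> T * \<bar>real x - real y\<bar> \<le> X (w x) * X (w y)}"
  have CS: "C \<subseteq> S" by (auto simp: C_def)
  have closed: "measure_pmf.prob Q {g. \<not> g e} \<le> exp (- T)" if e: "e \<in> C" for e
  proof -
    obtain x y where xy: "e = (x, y)" by force
    have t: "x \<in> torus N" "y \<in> torus N" "x < y" using e CS by (auto simp: xy S_def vertex_pairs_def)
    have "1 - p e \<le> exp (- T)"
    proof (cases "y = torus_succ N x \<or> x = torus_succ N y")
      case True
      then have "p e = 1" by (simp add: p_def xy edge_prob_def)
      then show ?thesis by simp
    next
      case False
      then have "y \<noteq> Suc x" using t by (auto simp: torus_succ_def torus_def)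
      then have far: "T * \<bar>real x - real y\<bar> \<le> X (w x) * X (w y)" using e by (auto simp: C_def xy)
      note d = torus_dist_props[OF t(1,2)]
      have "T * tdist x y \<le> T * \<bar>real x - real y\<bar>" using d(2) t T by (intro mult_left_mono) auto
      then have "T * tdist x y \<le> X (w x) * X (w y)" using far by linarith
      then have "T \<le> X (w x) * X (w y) / tdist x y" using d(1) t by (simp add: le_divide_eq)
      then have "T powr \<alpha> \<le> (X (w x) * X (w y) / tdist x y) powr \<alpha>" using T alpha by (intro powr_mono2) auto
      also have "\<dots> = w x * w y / tdist x y powr \<alpha>"
        using wr[OF t(1)] wr[OF t(2)] d(1) t alpha by (simp add: powr_divide powr_mult powr_powr)
      finally have "T powr \<alpha> \<le> w x * w y / tdist x y powr \<alpha>" .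
      moreover have "T \<le> T powr \<alpha>" using powr_mono[of 1 \<alpha> T] T alpha_gt_gamma by simp
      ultimately have "exp (- (w x * w y / tdist x y powr \<alpha>)) \<le> exp (- T)" by simp
      then show ?thesis using False by (simp add: p_def xy edge_prob_def)
    qed
    then show ?thesis unfolding Q_def using Pi_pmf_closed[OF finS, of e p] p01[of e] e CS by auto
  qed
  have cS: "real (card C) \<le> (real N)\<^sup>2"
  proof -
    have "card C \<le> card (torus N \<times> torus N)"
      using CS finite_I by (intro card_mono) (auto simp: S_def vertex_pairs_def)
    then show ?thesis by (simp add: torus_def power2_eq_square flip: of_nat_mult)
  qed
  define D1 where "D1 = (\<Union>e\<in>C. {g. \<not> g e})"
  have D1: "measure_pmf.prob Q D1 \<le> (real N)\<^sup>2 * exp (- T)"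
  proof -
    have "measure_pmf.prob Q D1 \<le> (\<Sum>e\<in>C. measure_pmf.prob Q {g. \<not> g e})"
      unfolding D1_def using CS finS finite_subset by (intro measure_pmf.finite_measure_subadditive_finite) auto
    also have "\<dots> \<le> (\<Sum>e\<in>C. exp (- T))" by (intro sum_mono closed)
    also have "\<dots> \<le> (real N)\<^sup>2 * exp (- T)" using cS by simp
    finally show ?thesis .
  qed
  \<comment> \<open>Pairs are listed with the smaller vertex first, so those incident to \<open>x\<close> have to be reordered.\<close>
  define A where "A = (\<lambda>x. (\<lambda>y. (min x y, max x y)) ` (torus N - {x}))"
  have inj: "inj_on (\<lambda>y. (min x y, max x y)) Z" for x :: nat and Z
    by (auto simp: inj_on_def min_def max_def split: if_splits)
  have AS: "A x \<subseteq> S" if "x \<in> torus N" for x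
    using that by (auto simp: A_def S_def vertex_pairs_def min_def max_def)
  have deg: "real (degree (torus N) (G g) x) = (\<Sum>e\<in>A x. of_bool (g e))" if x: "x \<in> torus N" for x g
  proof -
    have "real (degree (torus N) (G g) x) = (\<Sum>y\<in>{y \<in> torus N. y \<noteq> x \<and> {x, y} \<in> G g}. 1)"
      by (simp add: degree_def)
    also have "\<dots> = (\<Sum>y\<in>torus N - {x}. of_bool ({x, y} \<in> G g))"
      using finite_I by (intro sum.mono_neutral_cong_left) auto
    also have "\<dots> = (\<Sum>y\<in>torus N - {x}. of_bool (g (min x y, max x y)))"
      using x by (intro sum.cong refl) (auto simp: edge)
    also have "\<dots> = (\<Sum>e\<in>A x. of_bool (g e))"
      unfolding A_def by (subst sum.reindex[OF inj]) simp
    finally show ?thesis .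
  qed
  have pA: "(\<Sum>e\<in>A x. p e) \<le> 2 * T * X (w x)" if x: "x \<in> torus N" for x
  proof -
    have "(\<Sum>e\<in>A x. p e) = (\<Sum>y\<in>torus N - {x}. edge_prob N \<alpha> w x y)"
      unfolding A_def
    proof (subst sum.reindex[OF inj], intro sum.cong refl)
      fix y
      show "(p \<circ> (\<lambda>y. (min x y, max x y))) y = edge_prob N \<alpha> w x y"
        using edge_prob_commute[of w x y] by (cases "x \<le> y") (simp_all add: p_def min_def max_def)
    qed
    then show ?thesis using w x unfolding good_weights_def by auto
  qed
  define D2 where "D2 = (\<Union>x\<in>torus N. {g. (\<Sum>e\<in>A x. of_bool (g e)) \<ge> 5 * T * X (w x)})"
  have D2: "measure_pmf.prob Q D2 \<le> (real N)\<^sup>2 * exp (- T)"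
  proof -
    have "measure_pmf.prob Q D2 \<le> (\<Sum>x\<in>torus N. measure_pmf.prob Q {g. (\<Sum>e\<in>A x. of_bool (g e)) \<ge> 5 * T * X (w x)})"
      unfolding D2_def using finite_I by (intro measure_pmf.finite_measure_subadditive_finite) auto
    also have "\<dots> \<le> (\<Sum>x\<in>torus N. exp (- T))"
    proof (rule sum_mono)
      fix x assume x: "x \<in> torus N"
      have "T * 1 \<le> T * X (w x)" using X_ge_1 wr[OF x] T by (intro mult_left_mono) auto
      then have "2 * (\<Sum>e\<in>A x. p e) - 5 * T * X (w x) \<le> - T" using pA[OF x] by linarith
      then have "exp (2 * (\<Sum>e\<in>A x. p e) - 5 * T * X (w x)) \<le> exp (- T)" by simp
      moreover have tail: "measure_pmf.prob Q {g. (\<Sum>e\<in>A x. of_bool (g e)) \<ge> 5 * T * X (w x)}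
          \<le> exp (2 * (\<Sum>e\<in>A x. p e) - 5 * T * X (w x))"
        unfolding Q_def by (rule Pi_pmf_sum_upper_tail[OF finS AS[OF x] p01])
      ultimately show "measure_pmf.prob Q {g. (\<Sum>e\<in>A x. of_bool (g e)) \<ge> 5 * T * X (w x)} \<le> exp (- T)"
        by linarith
    qed
    also have "\<dots> = real N * exp (- T)" by (simp add: torus_def)
    also have "\<dots> \<le> (real N)\<^sup>2 * exp (- T)"
      using N3 by (intro mult_right_mono) (auto simp: power2_eq_square)
    finally show ?thesis .
  qed
  \<comment> \<open>These are the pairs across the cut between the two halves.\<close>
  define K where "K = {1..N div 2} \<times> {N div 2<..N}"
  have KS: "K \<subseteq> S" by (auto simp: K_def S_def vertex_pairs_def torus_def)
  have cut: "cut_size (torus N) (G g) {1..N div 2} = (\<Sum>e\<in>K. of_bool (g e))" for g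
  proof -
    have "torus N - {1..N div 2} = {N div 2<..N}" by (auto simp: torus_def)
    then have "cut_size (torus N) (G g) {1..N div 2} = (\<Sum>x\<in>{1..N div 2}. \<Sum>y\<in>{N div 2<..N}. of_bool ({x, y} \<in> G g))"
      by (simp add: cut_size_def)
    also have "\<dots> = (\<Sum>x\<in>{1..N div 2}. \<Sum>y\<in>{N div 2<..N}. of_bool (g (x, y)))"
    proof (intro sum.cong refl)
      fix x y assume xy: "x \<in> {1..N div 2}" "y \<in> {N div 2<..N}"
      then have "{x, y} \<in> G g \<longleftrightarrow> g (x, y)" by (subst edge) (auto simp: torus_def)
      then show "of_bool ({x, y} \<in> G g) = (of_bool (g (x, y)) :: real)" by simp
    qed
    also have "\<dots> = (\<Sum>e\<in>K. of_bool (g e))" unfolding K_def by (subst sum.cartesian_product) (simp add: case_prod_unfold)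
    finally show ?thesis .
  qed
  define D3 where "D3 = {g. (\<Sum>e\<in>K. of_bool (g e)) \<ge> t'}"
  have D3: "measure_pmf.prob Q D3 \<le> t / t'"
  proof -
    have "(\<Sum>e\<in>K. p e) = (\<Sum>x\<in>{1..N div 2}. \<Sum>y\<in>{N div 2<..N}. edge_prob N \<alpha> w x y)"
      unfolding K_def p_def by (rule sum.cartesian_product[symmetric])
    also have "\<dots> \<le> t" using w unfolding good_weights_def by auto
    finally have "(\<Sum>e\<in>K. p e) / t' \<le> t / t'" using t' by (intro divide_right_mono) auto
    moreover have "measure_pmf.prob Q D3 \<le> (\<Sum>e\<in>K. p e) / t'"
      unfolding Q_def D3_def by (rule Pi_pmf_sum_Markov[OF finS KS p01 t'])
    ultimately show ?thesis by linarith
  qed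
  have "good_graph T t' w (G g)" if g: "g \<notin> D1 \<union> D2 \<union> D3" for g
    unfolding good_graph_def
  proof (intro conjI allI ballI impI)
    have C1: "g e" if "e \<in> C" for e using g that by (auto simp: D1_def)
    fix x assume x: "1 \<le> x" "x < N"
    then have "(x, Suc x) \<in> C" by (auto simp: C_def S_def vertex_pairs_def torus_def)
    then show "{x, Suc x} \<in> G g" using C1 x by (subst edge) (auto simp: torus_def)
  next
    fix x y assume xy: "x \<in> torus N" "y \<in> torus N" "x \<noteq> y" "T * \<bar>real x - real y\<bar> \<le> X (w x) * X (w y)"
    have C1: "g e" if "e \<in> C" for e using g that by (auto simp: D1_def)
    have "(min x y, max x y) \<in> C"
      using xy by (auto simp: C_def S_def vertex_pairs_def min_def max_def abs_minus_commute mult.commute)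
    then show "{x, y} \<in> G g" using C1 xy by (subst edge) auto
  next
    fix x assume x: "x \<in> torus N"
    then show "real (degree (torus N) (G g) x) \<le> 5 * T * X (w x)"
      using g by (subst deg) (auto simp: D2_def)
  next
    show "cut_size (torus N) (G g) {1..N div 2} \<le> t'" using g by (subst cut) (auto simp: D3_def)
  qed
  then have "G -` {E. \<not> good_graph T t' w E} \<subseteq> D1 \<union> D2 \<union> D3" by auto
  then have "measure_pmf.prob (sfp_given_weights N \<alpha> w) {E. \<not> good_graph T t' w E} \<le> measure_pmf.prob Q (D1 \<union> D2 \<union> D3)"
    unfolding law measure_map_pmf by (intro measure_pmf.finite_measure_mono) auto
  also have "\<dots> \<le> measure_pmf.prob Q D1 + measure_pmf.prob Q D2 + measure_pmf.prob Q D3"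
    using measure_Un_le[of "D1 \<union> D2" "measure_pmf Q" D3] measure_Un_le[of D1 "measure_pmf Q" D2]
    by simp
  finally show ?thesis using D1 D2 D3 by linarith
qed

lemma sfp_two_stage:
  assumes B: "B \<in> sets M" "emeasure M B \<le> ennreal e1" and e: "0 \<le> e1" "0 \<le> e2"
    and cond: "\<And>w. w \<in> space M - B \<Longrightarrow> measure_pmf.prob (sfp_given_weights N \<alpha> w) Z \<le> e2"
  shows "measure (sfp N \<alpha> \<tau>) Z \<le> e1 + e2"
proof -
  interpret P: prob_space M by (intro prob_space_PiM prob_mu)
  interpret S: prob_space "sfp N \<alpha> \<tau>" by (rule prob_space_sfp[OF tau(1)])
  have "emeasure (sfp N \<alpha> \<tau>) Z = (\<integral>\<^sup>+ w. emeasure (measure_pmf (sfp_given_weights N \<alpha> w)) Z \<partial>M)"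
    unfolding sfp_def using P.not_empty measurable_sfp_given_weights by (intro emeasure_bind) auto
  also have "\<dots> \<le> (\<integral>\<^sup>+ w. indicator B w + ennreal e2 \<partial>M)"
  proof (rule nn_integral_mono)
    fix w assume w: "w \<in> space M"
    show "emeasure (measure_pmf (sfp_given_weights N \<alpha> w)) Z \<le> indicator B w + ennreal e2"
    proof (cases "w \<in> B")
      case True
      have "emeasure (measure_pmf (sfp_given_weights N \<alpha> w)) Z \<le> 1" by (rule measure_pmf.emeasure_le_1)
      also have "\<dots> \<le> indicator B w + ennreal e2" using True by simp
      finally show ?thesis .
    next
      case False
      then have "ennreal (measure_pmf.prob (sfp_given_weights N \<alpha> w) Z) \<le> ennreal e2"
        using cond w by (intro ennreal_leI) auto
      then show ?thesis using False by (simp add: measure_pmf.emeasure_eq_measure)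
    qed
  qed
  also have "\<dots> = emeasure M B + ennreal e2"
    using B by (subst nn_integral_add) (auto simp: P.emeasure_space_1)
  also have "\<dots> \<le> ennreal e1 + ennreal e2" using B by (intro add_right_mono)
  also have "\<dots> = ennreal (e1 + e2)" using e by simp
  finally show ?thesis using e by (simp add: S.emeasure_eq_measure del: ennreal_plus)
qed

section \<open>The mixing time up to powers of the logarithm\<close>

text \<open>
  The Poincare inequality is applied with \<open>5T\<^sup>2\<close> in place of \<open>T\<close>: one factor \<open>5T\<close> comes from
  replacing degrees by \<open>X\<close>, the other from the bound on the sum of the small \<open>X\<close>.
\<close>

lemma mixing_time_bounds:
  fixes s0 d :: nat
  assumes w: "good_weights T t w" and E: "good_graph T t' w E" and T: "T \<ge> 1"
    and s0: "s0 \<ge> 1" "\<And>s. s > s0 \<Longrightarrow> 4 * (5 * T\<^sup>2) ^ 4 * real s powr (\<gamma> - 1) \<le> real s"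
    and d: "d \<ge> 1" "N \<le> 2 ^ d"
  defines "K \<equiv> 3 * (1 + real d)\<^sup>2 * (32 * (5 * T\<^sup>2) ^ 5 * real N powr (\<gamma> - 1) + (real s0)\<^sup>2 * (5 * T\<^sup>2))"
  shows "real (mixing_time (torus N) E) \<le> 8 * K * ln (3 * real N) + 1"
    and "real N / 3 \<le> 2 * real (mixing_time (torus N) E) * t'"
proof -
  let ?deg = "\<lambda>x. real (degree (torus N) E x)"
  have tor: "torus N = {1..N}" by (simp add: torus_def)
  have wr: "1 \<le> w x" "w x \<le> R" if "x \<in> {1..N}" for x
    using w that unfolding good_weights_def tor by auto
  have T5: "T \<le> 5 * T\<^sup>2" "1 \<le> 5 * T\<^sup>2"
  proof -
    have "T * 1 \<le> T * T" using T by (intro mult_left_mono) auto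
    then have "T \<le> T\<^sup>2" by (simp add: power2_eq_square)
    then show "T \<le> 5 * T\<^sup>2" "1 \<le> 5 * T\<^sup>2" using T by linarith+
  qed
  interpret hub_graph N \<gamma> "5 * T\<^sup>2" E "\<lambda>x. X (w x)" ?deg
  proof
    show "1 < \<gamma>" "\<gamma> < 2" by (rule gamma)+
    show "1 \<le> 5 * T\<^sup>2" by (rule T5)
    show "1 \<le> X (w x)" if "x \<in> {1..N}" for x using X_ge_1 wr[OF that] by simp
    show "0 \<le> ?deg x" for x by simp
    show "{x, Suc x} \<in> E" if "1 \<le> x" "x < N" for x using E that unfolding good_graph_def by blast
  next
    fix a s :: nat assume as: "1 \<le> s" "a + s \<le> N"
    then obtain x where x: "x \<in> {a<..a + s}" "real s \<le> T * w x powr (\<tau> - 1)"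
      using w unfolding good_weights_def by blast
    have xN: "x \<in> {1..N}" using x as by auto
    have "w x powr (\<tau> - 1) = X (w x) powr \<gamma>" using wr[OF xN] by (intro X_powr(1)[symmetric]) auto
    moreover have "T * w x powr (\<tau> - 1) \<le> 5 * T\<^sup>2 * w x powr (\<tau> - 1)" using T5 by (intro mult_right_mono) auto
    ultimately show "\<exists>x\<in>{a<..a + s}. real s \<le> 5 * T\<^sup>2 * X (w x) powr \<gamma>" using x by (metis order_trans)
  next
    fix x y assume xy: "x \<in> {1..N}" "y \<in> {1..N}" "x \<noteq> y" "5 * T\<^sup>2 * \<bar>real x - real y\<bar> \<le> X (w x) * X (w y)"
    have "T * \<bar>real x - real y\<bar> \<le> 5 * T\<^sup>2 * \<bar>real x - real y\<bar>" using T5 by (intro mult_right_mono) auto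
    then have "T * \<bar>real x - real y\<bar> \<le> X (w x) * X (w y)" using xy by linarith
    then show "{x, y} \<in> E" using E xy unfolding good_graph_def tor by blast
  next
    fix a s :: nat assume as: "1 \<le> s" "a + s \<le> N"
    have "(\<Sum>x\<in>{x\<in>{a<..a + s}. X (w x) \<le> real s}. ?deg x) \<le> (\<Sum>x\<in>{x\<in>{a<..a + s}. X (w x) \<le> real s}. 5 * T * X (w x))"
      using E as unfolding good_graph_def tor by (intro sum_mono) auto
    also have "\<dots> = 5 * T * (\<Sum>x\<in>{x\<in>{a<..a + s}. X (w x) \<le> real s}. X (w x))" by (simp add: sum_distrib_left)
    also have "\<dots> \<le> 5 * T * (real s * T)"
      using w as T unfolding good_weights_def by (intro mult_left_mono) auto
    finally show "(\<Sum>x\<in>{x\<in>{a<..a + s}. X (w x) \<le> real s}. ?deg x) \<le> real s * (5 * T\<^sup>2)"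
      by (simp add: power2_eq_square mult_ac)
  qed
  interpret finite_graph "torus N" E
  proof
    show "finite (torus N)" "torus N \<noteq> {}" using N3 by (auto simp: tor)
    fix x assume x: "x \<in> torus N"
    have "\<exists>y. y \<in> torus N \<and> y \<noteq> x \<and> {x, y} \<in> E"
    proof (cases "x < N")
      case True then show ?thesis using line[of x] x by (intro exI[of _ "Suc x"]) (auto simp: tor)
    next
      case False
      then have "x = N" using x by (simp add: tor)
      then show ?thesis using line[of "N - 1"] N3
        by (intro exI[of _ "N - 1"]) (auto simp: tor insert_commute)
    qed
    then have "{y \<in> torus N. y \<noteq> x \<and> {x, y} \<in> E} \<noteq> {}" by blast
    then show "0 < degree (torus N) E x" unfolding degree_def by (subst card_gt_0_iff) (auto simp: tor)
  qed
  have card: "real (card (torus N)) = real N" by (simp add: tor)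
  have P: "\<exists>c. (\<Sum>x\<in>torus N. ?deg x * (f x - c)\<^sup>2) \<le> K * energy (torus N) E f" for f
  proof -
    have "X (w x) \<le> real N" if "x \<in> {1..N}" for x using wr[OF that] by (intro X_le_N) auto
    then show ?thesis unfolding K_def tor using N3 by (intro hub_Poincare[unfolded tor[symmetric], unfolded tor] s0 d) auto
  qed
  have K1: "K \<ge> 1"
  proof -
    have "1 \<le> (5 * T\<^sup>2) ^ 5" using T5 by (intro one_le_power)
    moreover have "1 \<le> real N powr (\<gamma> - 1)" using N3 gamma by (intro ge_one_powr_ge_zero) auto
    ultimately have "1 * 1 \<le> (5 * T\<^sup>2) ^ 5 * real N powr (\<gamma> - 1)" by (intro mult_mono) auto
    then have "1 \<le> 32 * (5 * T\<^sup>2) ^ 5 * real N powr (\<gamma> - 1)" by linarith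
    moreover have "0 \<le> (real s0)\<^sup>2 * (5 * T\<^sup>2)" by simp
    ultimately have "1 \<le> 32 * (5 * T\<^sup>2) ^ 5 * real N powr (\<gamma> - 1) + (real s0)\<^sup>2 * (5 * T\<^sup>2)" by linarith
    moreover have "1 \<le> (1 + real d)\<^sup>2" by (intro one_le_power) simp
    then have "1 \<le> 3 * (1 + real d)\<^sup>2" by linarith
    ultimately have "1 * 1 \<le> K" unfolding K_def by (intro mult_mono) auto
    then show ?thesis by simp
  qed
  show "real (mixing_time (torus N) E) \<le> 8 * K * ln (3 * real N) + 1"
    using mixing_time_le_Poincare(1)[OF K1 P] unfolding card .
  have "min (real (card {1..N div 2})) (real (card (torus N - {1..N div 2})))
      \<le> 2 * real (mixing_time (torus N) E) * cut_size (torus N) E {1..N div 2}"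
  proof (rule walk_dist_cut)
    show "walk_dist (torus N) E (mixing_time (torus N) E) < 1 / 4"
      by (rule mixing_time_le_Poincare(2)[OF K1 P])
    have "N \<in> torus N" "N \<notin> {1..N div 2}" using N3 by (auto simp: tor)
    then show "{1..N div 2} \<noteq> torus N" by blast
  qed (use N3 in \<open>auto simp: tor\<close>)
  also have "\<dots> \<le> 2 * real (mixing_time (torus N) E) * t'"
    using E unfolding good_graph_def by (intro mult_left_mono) auto
  finally have "min (real (card {1..N div 2})) (real (card (torus N - {1..N div 2}))) \<le> 2 * real (mixing_time (torus N) E) * t'" .
  moreover have "card (torus N - {1..N div 2}) = N - N div 2"
    by (subst card_Diff_subset) (auto simp: tor)
  moreover have "real N / 3 \<le> real (N div 2)" "real N / 3 \<le> real (N - N div 2)" using N3 by linarith+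
  ultimately show "real N / 3 \<le> 2 * real (mixing_time (torus N) E) * t'" by simp
qed

text \<open>
  Pure bookkeeping with \<open>T = (log N)^3\<close>. The exponent \<open>q = 1/(2-\<gamma>)\<close> enters through \<open>s0\<close>, the length
  below which \<open>T\<close> spoils the windows of \<open>strong_pair_bound\<close>: there \<open>s^(2-\<gamma>)\<close> is smaller than a
  power of \<open>T\<close>.
\<close>

lemma mixing_time_polylog:
  assumes w: "good_weights (L ^ 3) t w" and E: "good_graph (L ^ 3) (real N powr (2 - \<gamma>) * L ^ 6) w E"
    and L6: "L \<ge> 6"
  defines "q \<equiv> 1 / (2 - \<gamma>)"
  assumes L_large: "L \<ge> 768 * (100000 + 20 * (2500 powr q)\<^sup>2) + 1"
  shows "real N powr (\<gamma> - 1) * L powr (- 7) \<le> real (mixing_time (torus N) E)"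
    and "real (mixing_time (torus N) E) \<le> real N powr (\<gamma> - 1) * ln (real N + 3) powr (48 * q + 34)"
proof -
  have L1: "L \<ge> 1" by (rule L_ge_1)
  have L0: "L > 0" using L1 by simp
  have q: "q > 0" using gamma by (simp add: q_def)
  have N0: "real N > 0" using N3 by simp
  \<comment> \<open>Here \<open>2500 L^24 = 4 (5T\<^sup>2)^4\<close> is the value that \<open>s^(2-\<gamma>)\<close> has to exceed in \<open>strong_pair_bound\<close>.\<close>
  define s0 where "s0 = nat \<lceil>(2500 * L ^ 24) powr q\<rceil>"
  define d where "d = nat \<lceil>log 2 (real N)\<rceil>"
  define z where "z = L powr (24 * q)"
  have z: "(2500 * L ^ 24) powr q = 2500 powr q * z"
  proof -
    have "L ^ 24 = L powr real 24" by (rule powr_realpow[OF L0, symmetric])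
    then have "(L ^ 24) powr q = L powr (real 24 * q)" by (simp only: powr_powr)
    then show ?thesis by (simp add: powr_mult z_def)
  qed
  have z1: "z \<ge> 1" unfolding z_def using L1 q by (intro ge_one_powr_ge_zero) auto
  have c1: "2500 powr q \<ge> 1" using q by (intro ge_one_powr_ge_zero) auto
  have cz: "1 * 1 \<le> 2500 powr q * z" using c1 z1 by (intro mult_mono) auto
  have ceil: "y \<le> real (nat \<lceil>y\<rceil>)" "nat \<lceil>y\<rceil> \<ge> 1" "real (nat \<lceil>y\<rceil>) \<le> 2 * y" if "1 \<le> y" for y :: real
    using that by linarith+
  have s0: "(2500 * L ^ 24) powr q \<le> real s0" "s0 \<ge> 1" "real s0 \<le> 2 * (2500 powr q * z)"
    using ceil[of "2500 powr q * z"] cz unfolding s0_def z by simp_all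
  have s0_large: "4 * (5 * (L ^ 3)\<^sup>2) ^ 4 * real s powr (\<gamma> - 1) \<le> real s" if s: "s > s0" for s
  proof -
    have "(2500 * L ^ 24) powr q \<le> real s" using s0(1) s by linarith
    then have "((2500 * L ^ 24) powr q) powr (2 - \<gamma>) \<le> real s powr (2 - \<gamma>)"
      using gamma by (intro powr_mono2) auto
    then have "2500 * L ^ 24 \<le> real s powr (2 - \<gamma>)"
      using gamma L0 by (simp add: powr_powr q_def)
    then have "2500 * L ^ 24 * real s powr (\<gamma> - 1) \<le> real s powr (2 - \<gamma>) * real s powr (\<gamma> - 1)"
      by (intro mult_right_mono) auto
    also have "\<dots> = real s" using s by (simp flip: powr_add)
    also have "2500 * L ^ 24 = 4 * (5 * (L ^ 3)\<^sup>2) ^ 4"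
      by (simp add: power_mult_distrib flip: power_mult)
    finally show ?thesis .
  qed
  have lg: "log 2 (real N) \<le> 3 / 2 * L" "log 2 (real N) > 0"
  proof -
    have "L / ln 2 \<le> L / (2 / 3)" using ln2_ge_two_thirds L1 by (intro divide_left_mono) auto
    then show "log 2 (real N) \<le> 3 / 2 * L" by (simp add: log_def)
    show "log 2 (real N) > 0" using N3 by simp
  qed
  have d: "d \<ge> 1" "real d \<le> 3 / 2 * L + 1" "N \<le> 2 ^ d"
  proof -
    show "d \<ge> 1" unfolding d_def using lg by linarith
    show "real d \<le> 3 / 2 * L + 1" unfolding d_def using lg by linarith
    have "real N = 2 powr log 2 (real N)" using N3 by simp
    also have "\<dots> \<le> 2 powr real d" unfolding d_def by (intro powr_mono real_nat_ceiling_ge) auto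
    also have "\<dots> = real (2 ^ d)" by (simp add: powr_realpow)
    finally show "N \<le> 2 ^ d" by (simp only: of_nat_le_iff)
  qed
  define K where "K = 3 * (1 + real d)\<^sup>2 * (32 * (5 * (L ^ 3)\<^sup>2) ^ 5 * real N powr (\<gamma> - 1) + (real s0)\<^sup>2 * (5 * (L ^ 3)\<^sup>2))"
  have T1: "L ^ 3 \<ge> 1" using L1 by simp
  note bounds = mixing_time_bounds[OF w E T1 s0(2) s0_large d(1,3), folded K_def]
  define m where "m = real (mixing_time (torus N) E)"
  define G where "G = real N powr (\<gamma> - 1)"
  have G1: "G \<ge> 1" unfolding G_def using N3 gamma by (intro ge_one_powr_ge_zero) auto
  show "real N powr (\<gamma> - 1) * L powr (- 7) \<le> real (mixing_time (torus N) E)"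
  proof -
    define h where "h = real N powr (2 - \<gamma>)"
    have "real N / 3 \<le> 2 * m * (h * L ^ 6)" using bounds(2) unfolding m_def h_def .
    then have "G * h \<le> 6 * L ^ 6 * m * h"
      using N0 unfolding G_def h_def by (simp add: mult_ac flip: powr_add)
    moreover have "h > 0" using N0 by (simp add: h_def)
    ultimately have "G \<le> 6 * L ^ 6 * m" by simp
    also have "\<dots> \<le> L * L ^ 6 * m" using L6 L0 by (intro mult_right_mono) (auto simp: m_def)
    also have "L * L ^ 6 = L powr 7" using L0 by (simp add: powr_numeral eval_nat_numeral)
    finally show ?thesis using L0 unfolding G_def m_def by (simp add: powr_minus field_simps)
  qed
  show "real (mixing_time (torus N) E) \<le> real N powr (\<gamma> - 1) * ln (real N + 3) powr (48 * q + 34)"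
  proof -
    have zz: "z\<^sup>2 \<ge> 1" using z1 by simp
    have L30: "L ^ 6 \<le> L ^ 30" using L1 by (intro power_increasing) auto
    have "(1 + real d)\<^sup>2 \<le> (4 * L)\<^sup>2" using d(2) L1 L6 by (intro power_mono) auto
    then have dd: "(1 + real d)\<^sup>2 \<le> 16 * L\<^sup>2" by (simp add: power_mult_distrib)
    have "(real s0)\<^sup>2 \<le> (2 * (2500 powr q * z))\<^sup>2" using s0(3) by (intro power_mono) auto
    then have ss: "(real s0)\<^sup>2 \<le> 4 * (2500 powr q)\<^sup>2 * z\<^sup>2" by (simp add: power_mult_distrib)
    have t1: "32 * (5 * (L ^ 3)\<^sup>2) ^ 5 * G \<le> 100000 * (L ^ 30 * z\<^sup>2 * G)"
    proof -
      have "32 * (5 * (L ^ 3)\<^sup>2) ^ 5 * G = 100000 * (L ^ 30 * 1 * G)"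
        by (simp add: power_mult_distrib flip: power_mult)
      also have "\<dots> \<le> 100000 * (L ^ 30 * z\<^sup>2 * G)"
        using zz L0 G1 by (intro mult_left_mono mult_right_mono) auto
      finally show ?thesis .
    qed
    have t2: "(real s0)\<^sup>2 * (5 * (L ^ 3)\<^sup>2) \<le> 20 * (2500 powr q)\<^sup>2 * (L ^ 30 * z\<^sup>2 * G)"
    proof -
      have "(real s0)\<^sup>2 * (5 * (L ^ 3)\<^sup>2) \<le> (4 * (2500 powr q)\<^sup>2 * z\<^sup>2) * (5 * (L ^ 3)\<^sup>2)"
        using ss by (intro mult_right_mono) auto
      also have "\<dots> = 20 * (2500 powr q)\<^sup>2 * (L ^ 6 * z\<^sup>2 * 1)" by (simp flip: power_mult)
      also have "\<dots> \<le> 20 * (2500 powr q)\<^sup>2 * (L ^ 30 * z\<^sup>2 * G)"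
        using L30 G1 L0 by (intro mult_left_mono mult_mono) auto
      finally show ?thesis .
    qed
    define C where "C = 100000 + 20 * (2500 powr q)\<^sup>2"
    define Y where "Y = L ^ 30 * z\<^sup>2 * G"
    have Y1: "Y \<ge> 1"
    proof -
      have "1 * 1 * 1 \<le> L ^ 30 * z\<^sup>2 * G" using zz G1 one_le_power[OF L1, of 30] by (intro mult_mono) auto
      then show ?thesis by (simp add: Y_def)
    qed
    have C0: "C \<ge> 0" by (simp add: C_def)
    have K: "K \<le> 3 * (16 * L\<^sup>2) * (C * Y)"
    proof -
      have "32 * (5 * (L ^ 3)\<^sup>2) ^ 5 * G + (real s0)\<^sup>2 * (5 * (L ^ 3)\<^sup>2) \<le> C * Y"
        unfolding C_def Y_def distrib_right using t1 t2 by (rule add_mono)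
      moreover have "0 \<le> 32 * (5 * (L ^ 3)\<^sup>2) ^ 5 * G + (real s0)\<^sup>2 * (5 * (L ^ 3)\<^sup>2)"
        using L0 G1 by simp
      ultimately have "3 * (1 + real d)\<^sup>2 * (32 * (5 * (L ^ 3)\<^sup>2) ^ 5 * G + (real s0)\<^sup>2 * (5 * (L ^ 3)\<^sup>2))
          \<le> 3 * (16 * L\<^sup>2) * (C * Y)"
        using dd by (intro mult_mono) auto
      then show ?thesis unfolding K_def G_def .
    qed
    moreover have "ln (3 * real N) \<le> 2 * L"
    proof -
      have "ln (3 * real N) = ln 3 + L" using N0 by (simp add: ln_mult)
      moreover have "ln 3 \<le> L" using N3 by (subst ln_le_cancel_iff) auto
      ultimately show ?thesis by linarith
    qed
    moreover have "ln (3 * real N) \<ge> 0" using N3 by simp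
    moreover have "8 * K \<le> 8 * (3 * (16 * L\<^sup>2) * (C * Y))" using K by linarith
    moreover have "0 \<le> 8 * (3 * (16 * L\<^sup>2) * (C * Y))" using C0 Y1 by simp
    ultimately have "8 * K * ln (3 * real N) \<le> 8 * (3 * (16 * L\<^sup>2) * (C * Y)) * (2 * L)"
      by (intro mult_mono[of "8 * K"])
    also have "\<dots> = 768 * C * (L ^ 3 * Y)" by (simp add: power3_eq_cube power2_eq_square)
    finally have "m \<le> 768 * C * (L ^ 3 * Y) + 1" using bounds(1) unfolding m_def by linarith
    also have "1 \<le> L ^ 3 * Y" using mult_mono[of 1 "L ^ 3" 1 Y] L1 Y1 by simp
    then have "768 * C * (L ^ 3 * Y) + 1 \<le> (768 * C + 1) * (L ^ 3 * Y)" by (simp add: distrib_right)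
    also have "\<dots> \<le> L * (L ^ 3 * Y)" using L_large L0 Y1 by (intro mult_right_mono) (auto simp: C_def)
    also have "\<dots> = G * (L powr 34 * z\<^sup>2)"
      using L0 by (simp add: Y_def powr_numeral eval_nat_numeral)
    also have "L powr 34 * z\<^sup>2 = L powr (48 * q + 34)"
      by (simp add: z_def power2_eq_square add.commute flip: powr_add)
    also have "G * L powr (48 * q + 34) \<le> G * ln (real N + 3) powr (48 * q + 34)"
      using G1 q L0 N0 by (intro mult_left_mono powr_mono2) auto
    finally show ?thesis unfolding m_def G_def .
  qed
qed

lemma mixing_time_polylog_likely:
  defines "q \<equiv> 1 / (2 - \<gamma>)"
  assumes L_large: "L \<ge> 768 * (100000 + 20 * (2500 powr q)\<^sup>2) + 1"
  shows "measure (sfp N \<alpha> \<tau>)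
           {E. real N powr (\<gamma> - 1) * L powr (- 7) \<le> real (mixing_time (torus N) E)
             \<and> real (mixing_time (torus N) E) \<le> real N powr (\<gamma> - 1) * ln (real N + 3) powr (48 * q + 34)}
     \<ge> 1 - (real N powr (1 - \<gamma>) + 5 * ((real N)\<^sup>2 * exp (- (L ^ 3) / 2)) + 801 / L)"
proof -
  interpret S: prob_space "sfp N \<alpha> \<tau>" by (rule prob_space_sfp[OF tau(1)])
  define A where "A = {E. real N powr (\<gamma> - 1) * L powr (- 7) \<le> real (mixing_time (torus N) E)
             \<and> real (mixing_time (torus N) E) \<le> real N powr (\<gamma> - 1) * ln (real N + 3) powr (48 * q + 34)}"
  define h where "h = real N powr (2 - \<gamma>)"
  have h: "h > 0" using N3 by (simp add: h_def)
  have L320: "L \<ge> 320"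
  proof -
    have big: "320 \<le> 768 * (100000 + 20 * c) + 1" if "c \<ge> 0" for c :: real using that by simp
    have "320 \<le> 768 * (100000 + 20 * (2500 powr q)\<^sup>2) + 1" by (rule big) simp
    then show ?thesis using L_large by (rule order_trans)
  qed
  then have T: "L ^ 3 \<ge> 320 * L\<^sup>2" by (simp add: power3_eq_cube power2_eq_square mult_right_mono)
  have T1: "L ^ 3 \<ge> 1" using L320 by (intro one_le_power) linarith
  have L0: "L > 0" using L320 by linarith
  obtain B where B: "B \<in> sets M" "emeasure M B \<le> ennreal (real N * real N powr (- \<gamma>) + 3 * ((real N)\<^sup>2 * exp (- (L ^ 3) / 2))
      + 800 * L ^ 4 * real N powr (2 - \<gamma>) / (h * L ^ 5))" "\<And>w. w \<in> space M - B \<Longrightarrow> good_weights (L ^ 3) (h * L ^ 5) w"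
    using good_weights_likely[OF T, of "h * L ^ 5"] h L0 by (auto simp: mult_pos_pos)
  have "measure (sfp N \<alpha> \<tau>) (UNIV - A) \<le>
      (real N * real N powr (- \<gamma>) + 3 * ((real N)\<^sup>2 * exp (- (L ^ 3) / 2)) + 800 * L ^ 4 * real N powr (2 - \<gamma>) / (h * L ^ 5))
      + (2 * ((real N)\<^sup>2 * exp (- (L ^ 3))) + (h * L ^ 5) / (h * L ^ 6))"
  proof (rule sfp_two_stage[OF B(1,2)])
    fix w assume w: "w \<in> space M - B"
    have "UNIV - A \<subseteq> {E. \<not> good_graph (L ^ 3) (h * L ^ 6) w E}"
      using mixing_time_polylog[OF B(3)[OF w], folded h_def q_def] L320 L_large unfolding A_def by auto
    then have "measure_pmf.prob (sfp_given_weights N \<alpha> w) (UNIV - A)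
        \<le> measure_pmf.prob (sfp_given_weights N \<alpha> w) {E. \<not> good_graph (L ^ 3) (h * L ^ 6) w E}"
      by (intro measure_pmf.finite_measure_mono) auto
    also have "\<dots> \<le> 2 * ((real N)\<^sup>2 * exp (- (L ^ 3))) + (h * L ^ 5) / (h * L ^ 6)"
      using h L0 by (intro good_graph_likely[OF B(3)[OF w] T1]) auto
    finally show "measure_pmf.prob (sfp_given_weights N \<alpha> w) (UNIV - A)
        \<le> 2 * ((real N)\<^sup>2 * exp (- (L ^ 3))) + (h * L ^ 5) / (h * L ^ 6)" .
  qed (use h L0 in auto)
  also have "(h * L ^ 5) / (h * L ^ 6) = 1 / L" using h L0 by (simp add: eval_nat_numeral)
  also have "800 * L ^ 4 * real N powr (2 - \<gamma>) / (h * L ^ 5) = 800 / L"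
    using h L0 unfolding h_def[symmetric] by (simp add: eval_nat_numeral)
  also have "real N * real N powr (- \<gamma>) = real N powr (1 - \<gamma>)"
    using N3 by (simp add: powr_mult_base)
  also have "exp (- (L ^ 3)) \<le> exp (- (L ^ 3) / 2)" using L0 by simp
  then have "real N powr (1 - \<gamma>) + 3 * ((real N)\<^sup>2 * exp (- (L ^ 3) / 2)) + 800 / L + (2 * ((real N)\<^sup>2 * exp (- (L ^ 3))) + 1 / L)
      \<le> real N powr (1 - \<gamma>) + 3 * ((real N)\<^sup>2 * exp (- (L ^ 3) / 2)) + 800 / L + (2 * ((real N)\<^sup>2 * exp (- (L ^ 3) / 2)) + 1 / L)"
    by (intro add_mono mult_left_mono order_refl) auto
  also have "\<dots> = real N powr (1 - \<gamma>) + 5 * ((real N)\<^sup>2 * exp (- (L ^ 3) / 2)) + 801 / L" by (simp add: add_divide_distrib[symmetric])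
  finally have "measure (sfp N \<alpha> \<tau>) (UNIV - A) \<le> real N powr (1 - \<gamma>) + 5 * ((real N)\<^sup>2 * exp (- (L ^ 3) / 2)) + 801 / L" .
  moreover have "measure (sfp N \<alpha> \<tau>) (space (sfp N \<alpha> \<tau>) - A) = 1 - measure (sfp N \<alpha> \<tau>) A"
    by (rule S.prob_compl) (simp add: sets_sfp[OF tau(1)])
  moreover have "space (sfp N \<alpha> \<tau>) = UNIV" using sets_eq_imp_space_eq[of "sfp N \<alpha> \<tau>" "count_space UNIV"] sets_sfp[OF tau(1)] by simp
  ultimately show ?thesis unfolding A_def by simp
qed

end

text \<open>
  Replacing the integer part by its bounds from both sides changes the argument of the logarithm by at most 1.
  The shift by 3 keeps the logarithm positive at \<open>n = 0\<close>.
\<close>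

lemma slowly_varying_ln_powr: "slowly_varying (\<lambda>n. ln (real n + 3) powr c)"
  unfolding slowly_varying_def
proof (intro conjI allI impI)
  fix n :: nat
  show "0 < ln (real n + 3) powr c" by (simp add: ln_gt_zero)
next
  fix s :: real assume s: "s > 0"
  define r where "r = (\<lambda>n. ln (real (nat \<lfloor>s * real n\<rfloor>) + 3) / ln (real n + 3))"
  have pos: "ln (real n + 3) > 0" for n by (simp add: ln_gt_zero)
  have "r \<longlonglongrightarrow> 1"
  proof (rule tendsto_sandwich)
    show "(\<lambda>n. ln (s * real n + 2) / ln (real n + 3)) \<longlonglongrightarrow> 1" using s by real_asymp
    show "(\<lambda>n. ln (s * real n + 3) / ln (real n + 3)) \<longlonglongrightarrow> 1" using s by real_asymp
    show "\<forall>\<^sub>F n in sequentially. ln (s * real n + 2) / ln (real n + 3) \<le> r n"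
    proof (rule always_eventually, rule allI)
      fix n :: nat
      have "0 \<le> s * real n" using s by simp
      moreover have "s * real n + 2 \<le> real (nat \<lfloor>s * real n\<rfloor>) + 3" by linarith
      ultimately have "ln (s * real n + 2) \<le> ln (real (nat \<lfloor>s * real n\<rfloor>) + 3)" by simp
      then show "ln (s * real n + 2) / ln (real n + 3) \<le> r n"
        unfolding r_def using pos by (intro divide_right_mono) (auto intro: less_imp_le)
    qed
    show "\<forall>\<^sub>F n in sequentially. r n \<le> ln (s * real n + 3) / ln (real n + 3)"
    proof (rule always_eventually, rule allI)
      fix n :: nat
      have "0 \<le> s * real n" using s by simp
      then have "real (nat \<lfloor>s * real n\<rfloor>) + 3 \<le> s * real n + 3" by linarith
      then have "ln (real (nat \<lfloor>s * real n\<rfloor>) + 3) \<le> ln (s * real n + 3)"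
        using \<open>0 \<le> s * real n\<close> by (intro ln_mono) linarith+
      then show "r n \<le> ln (s * real n + 3) / ln (real n + 3)"
        unfolding r_def using pos by (intro divide_right_mono) (auto intro: less_imp_le)
    qed
  qed
  then have "(\<lambda>n. r n powr c) \<longlonglongrightarrow> 1 powr c" by (intro tendsto_intros) auto
  moreover have "r n powr c = ln (real (nat \<lfloor>s * real n\<rfloor>) + 3) powr c / ln (real n + 3) powr c" for n
    unfolding r_def by (rule powr_divide)
  ultimately show "(\<lambda>n. ln (real (nat \<lfloor>s * real n\<rfloor>) + 3) powr c / ln (real n + 3) powr c) \<longlonglongrightarrow> 1"
    by simp
qed

theorem theorem2p3:
  fixes \<alpha> \<tau> \<gamma> :: real
  assumes "\<alpha> > 0" and "1 < \<tau>" and "\<tau> < 2"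
    and "\<gamma> = \<alpha> * (\<tau> - 1)" and "1 < \<gamma>" and "\<gamma> < 2"
  shows "\<exists>c>0. \<exists>l. slowly_varying l \<and>
    (\<lambda>N. measure (sfp N \<alpha> \<tau>)
           {E. real N powr (\<gamma> - 1) * ln (real N) powr (- c) \<le> real (mixing_time (torus N) E)
             \<and> real (mixing_time (torus N) E) \<le> real N powr (\<gamma> - 1) * l N})
      \<longlonglongrightarrow> 1"
proof (intro exI[of _ "7 :: real"] conjI)
  define q where "q = 1 / (2 - \<gamma>)"
  define l where "l = (\<lambda>n. ln (real n + 3) powr (48 * q + 34))"
  define C where "C = 768 * (100000 + 20 * (2500 powr q)\<^sup>2) + 1"
  show "(7::real) > 0" by simp
  show "\<exists>l. slowly_varying l \<and>
    (\<lambda>N. measure (sfp N \<alpha> \<tau>)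
           {E. real N powr (\<gamma> - 1) * ln (real N) powr (- 7) \<le> real (mixing_time (torus N) E)
             \<and> real (mixing_time (torus N) E) \<le> real N powr (\<gamma> - 1) * l N})
      \<longlonglongrightarrow> 1"
  proof (intro exI[of _ l] conjI)
    show "slowly_varying l" unfolding l_def by (rule slowly_varying_ln_powr)
    have large: "\<forall>\<^sub>F N in sequentially. 3 \<le> N \<and> C \<le> ln (real N)"
    proof (rule eventually_conj)
      show "\<forall>\<^sub>F N :: nat in sequentially. 3 \<le> N" by (rule eventually_ge_at_top)
      have "filterlim (\<lambda>N. ln (real N)) at_top sequentially" by real_asymp
      then show "\<forall>\<^sub>F N in sequentially. C \<le> ln (real N)" by (simp add: filterlim_at_top)
    qed
    let ?err = "\<lambda>N. real N powr (1 - \<gamma>) + 5 * ((real N)\<^sup>2 * exp (- (ln (real N) ^ 3) / 2)) + 801 / ln (real N)"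
    show "(\<lambda>N. measure (sfp N \<alpha> \<tau>)
           {E. real N powr (\<gamma> - 1) * ln (real N) powr (- 7) \<le> real (mixing_time (torus N) E)
             \<and> real (mixing_time (torus N) E) \<le> real N powr (\<gamma> - 1) * l N}) \<longlonglongrightarrow> 1"
    proof (rule tendsto_sandwich)
      have "(\<lambda>N. 1 - ?err N) \<longlonglongrightarrow> 1 - (0 + 5 * 0 + 0)"
      proof (intro tendsto_intros)
        show "(\<lambda>N. real N powr (1 - \<gamma>)) \<longlonglongrightarrow> 0" using assms(5) by real_asymp
        show "(\<lambda>N. (real N)\<^sup>2 * exp (- (ln (real N) ^ 3) / 2)) \<longlonglongrightarrow> 0" by real_asymp
        show "(\<lambda>N. 801 / ln (real N)) \<longlonglongrightarrow> 0" by real_asymp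
      qed
      then show "(\<lambda>N. 1 - ?err N) \<longlonglongrightarrow> 1" by simp
      show "\<forall>\<^sub>F N in sequentially. 1 - ?err N \<le> measure (sfp N \<alpha> \<tau>)
           {E. real N powr (\<gamma> - 1) * ln (real N) powr (- 7) \<le> real (mixing_time (torus N) E)
             \<and> real (mixing_time (torus N) E) \<le> real N powr (\<gamma> - 1) * l N}"
        using large
      proof eventually_elim
        case (elim N)
        then interpret sfp_parameters N \<alpha> \<tau> \<gamma> using assms by unfold_locales auto
        show ?case using mixing_time_polylog_likely elim unfolding l_def C_def q_def by simp
      qed
      show "\<forall>\<^sub>F N in sequentially. measure (sfp N \<alpha> \<tau>)
           {E. real N powr (\<gamma> - 1) * ln (real N) powr (- 7) \<le> real (mixing_time (torus N) E)
             \<and> real (mixing_time (torus N) E) \<le> real N powr (\<gamma> - 1) * l N} \<le> 1"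
        using prob_space.prob_le_1[OF prob_space_sfp[OF assms(2)]] by (intro always_eventually) auto
    qed (rule tendsto_const)
  qed
qed

end
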